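(* Let $L$ be an $n$-dimensional closed manifold, let $J^1(L,\mathbb{R})$ be its space of $1$-jets, let $\alpha=dz-p\,dq$ be its canonical contact form and $\xi=\ker\alpha$ its associated contact structure. There exists a loop of Legendrian immersions $\varphi_t:L\to J^1(L,\mathbb{R})$, $t\in S^1$, starting from the $0$-section and positive in the following sense: $\frac{\partial\varphi}{\partial t}$ is transverse to $\xi$ at every point. Moreover, $\varphi_t$ may be chosen $C^0$-close to the stationary loop.
   Context: $J^1(L,\mathbb{R})\cong T^*L\times\mathbb{R}$, of dimension $2n+1$, has local coordinates $(q,p,z)$, where $q$ are local coordinates on $L$, $p$ the dual fiber coordinates of $T^*L$ and $z\in\mathbb{R}$; $p\,dq$ is the Liouville form. The $0$-section is the map $L\to J^1(L,\mathbb{R})$, $q\mapsto(q,0,0)$. A Legendrian immersion of $L$ is an immersion $f:L\to J^1(L,\mathbb{R})$ with $f^*\alpha=0$. Here $\varphi(x,t)=\varphi_t(x)$ for $(x,t)\in L\times S^1$, and a vector $v$ is transverse to $\xi$ if $\alpha(v)\neq 0$. "Starting from the $0$-section" means that $\varphi_0$ is the $0$-section, $0$ being the base point of $S^1$. The stationary loop is the constant loop at the $0$-section. *)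

theory Defs
  imports "HOL-Analysis.Analysis"
begin

section \<open>Smooth maps between Euclidean spaces\<close>

text \<open>For open \<open>S\<close> in a finite-dimensional space this is the class \<open>C^k\<close>: all iterated directional
  derivatives of order at most \<open>k\<close> exist and are continuous on \<open>S\<close>.\<close>

primrec Ck_on :: "nat \<Rightarrow> 'e::euclidean_space set \<Rightarrow> ('e \<Rightarrow> 'f::euclidean_space) \<Rightarrow> bool" where
  "Ck_on 0 S f \<longleftrightarrow> continuous_on S f"
| "Ck_on (Suc k) S f \<longleftrightarrow> (\<forall>x\<in>S. f differentiable at x) \<and>
     (\<forall>v. Ck_on k S (\<lambda>x. frechet_derivative f (at x) v))"

definition smooth_on :: "'e::euclidean_space set \<Rightarrow> ('e \<Rightarrow> 'f::euclidean_space) \<Rightarrow> bool" where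
  "smooth_on S f \<longleftrightarrow> (\<forall>k. Ck_on k S f)"


section \<open>Manifolds given by an atlas\<close>

text \<open>A chart is a pair of a domain and a coordinate map; the values of the coordinate map outside
  the domain are irrelevant.  The atlas determines the underlying set of the manifold (which need
  not be the whole type), its topology and its smooth structure.\<close>

type_synonym ('a, 'e) chart = "'a set \<times> ('a \<Rightarrow> 'e)"
type_synonym ('a, 'e) atlas = "('a, 'e) chart set"

definition carrier_of :: "('a, 'e) atlas \<Rightarrow> 'a set" where
  "carrier_of A = (\<Union>(U, c)\<in>A. U)"

definition smooth_atlas :: "('a, 'e::euclidean_space) atlas \<Rightarrow> bool" where
  "smooth_atlas A \<longleftrightarrow>
     (\<forall>(U, c)\<in>A. inj_on c U \<and> open (c ` U)) \<and>
     (\<forall>(U, c)\<in>A. \<forall>(V, d)\<in>A.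
        open (c ` (U \<inter> V)) \<and> smooth_on (c ` (U \<inter> V)) (d \<circ> inv_into U c))"

text \<open>For a smooth atlas this is the topology for which every chart is a homeomorphism from
  an open set of the manifold onto an open set of the Euclidean space.\<close>

definition atlas_topology :: "('a, 'e::euclidean_space) atlas \<Rightarrow> 'a topology" where
  "atlas_topology A = topology_generated_by {U \<inter> c -` V |U c V. (U, c) \<in> A \<and> open V}"

definition closed_manifold :: "('a, 'e::euclidean_space) atlas \<Rightarrow> bool" where
  "closed_manifold A \<longleftrightarrow> smooth_atlas A \<and> Hausdorff_space (atlas_topology A) \<and>
     second_countable (atlas_topology A) \<and> compact_space (atlas_topology A)"

definition smooth_map ::
  "('a, 'e::euclidean_space) atlas \<Rightarrow> ('b, 'f::euclidean_space) atlas \<Rightarrow> ('a \<Rightarrow> 'b) \<Rightarrow> bool" where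
  "smooth_map A B f \<longleftrightarrow> f ` carrier_of A \<subseteq> carrier_of B \<and>
     (\<forall>(U, c)\<in>A. \<forall>(V, d)\<in>B.
        open (c ` (U \<inter> f -` V)) \<and> smooth_on (c ` (U \<inter> f -` V)) (d \<circ> f \<circ> inv_into U c))"

text \<open>The derivative at \<open>x\<close> of \<open>f\<close> read in the chart \<open>(U, c)\<close> of the source and the coordinate
  map \<open>d\<close> of the target.\<close>

definition chart_derivative ::
  "('a, 'e::euclidean_space) chart \<Rightarrow> ('b \<Rightarrow> 'f::euclidean_space) \<Rightarrow> ('a \<Rightarrow> 'b) \<Rightarrow> 'a \<Rightarrow> 'e \<Rightarrow> 'f" where
  "chart_derivative = (\<lambda>(U, c) d f x. frechet_derivative (d \<circ> f \<circ> inv_into U c) (at (c x)))"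

definition immersion ::
  "('a, 'e::euclidean_space) atlas \<Rightarrow> ('b, 'f::euclidean_space) atlas \<Rightarrow> ('a \<Rightarrow> 'b) \<Rightarrow> bool" where
  "immersion A B f \<longleftrightarrow> smooth_map A B f \<and>
     (\<forall>(U, c)\<in>A. \<forall>(V, d)\<in>B. \<forall>x\<in>U. f x \<in> V \<longrightarrow> inj (chart_derivative (U, c) d f x))"

text \<open>The product of a manifold with the real line.\<close>

definition times_line :: "('a, 'e::euclidean_space) atlas \<Rightarrow> ('a \<times> real, 'e \<times> real) atlas" where
  "times_line A = (\<lambda>(U, c). (U \<times> UNIV, map_prod c id)) ` A"


section \<open>The space of 1-jets of real functions\<close>

definition smooth_near :: "('a, 'e::euclidean_space) atlas \<Rightarrow> 'a \<Rightarrow> ('a \<Rightarrow> real) \<Rightarrow> bool" where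
  "smooth_near A x f \<longleftrightarrow> (\<exists>W. openin (atlas_topology A) W \<and> x \<in> W \<and>
     (\<forall>(U, c)\<in>A. smooth_on (c ` (U \<inter> W)) (f \<circ> inv_into U c)))"

definition same_1jet :: "('a, 'e::euclidean_space) atlas \<Rightarrow> 'a \<Rightarrow> ('a \<Rightarrow> real) \<Rightarrow> ('a \<Rightarrow> real) \<Rightarrow> bool" where
  "same_1jet A x f g \<longleftrightarrow> f x = g x \<and>
     (\<forall>(U, c)\<in>A. x \<in> U \<longrightarrow> chart_derivative (U, c) id f x = chart_derivative (U, c) id g x)"

text \<open>A 1-jet is its base point together with an equivalence class of functions smooth near
  that point.\<close>

type_synonym 'a jet = "'a \<times> ('a \<Rightarrow> real) set"

definition jet1 :: "('a, 'e::euclidean_space) atlas \<Rightarrow> 'a \<Rightarrow> ('a \<Rightarrow> real) \<Rightarrow> 'a jet" where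
  "jet1 A x f = (x, {g. smooth_near A x g \<and> same_1jet A x f g})"

definition J1 :: "('a, 'e::euclidean_space) atlas \<Rightarrow> 'a jet set" where
  "J1 A = {jet1 A x f |x f. x \<in> carrier_of A \<and> smooth_near A x f}"

text \<open>The coordinates \<open>(q, p, z)\<close> induced by a chart: the 1-jet of \<open>f\<close> at \<open>x\<close> has \<open>q = c x\<close>,
  \<open>p\<close> the partial derivatives of \<open>f\<close> in the chart, i.e. the coefficients of \<open>df\<close> in the basis dual
  to the coordinate vector fields, and \<open>z = f x\<close>.\<close>

definition jet_coords :: "('a, real^'n) chart \<Rightarrow> 'a jet \<Rightarrow> (real^'n) \<times> (real^'n) \<times> real" where
  "jet_coords = (\<lambda>(U, c) (x, F). let f = (SOME f. f \<in> F) in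
     (c x, \<chi> i. chart_derivative (U, c) id f x (axis i 1), f x))"

definition jet_atlas :: "('a, real^'n) atlas \<Rightarrow> ('a jet, (real^'n) \<times> (real^'n) \<times> real) atlas" where
  "jet_atlas A = (\<lambda>(U, c). ({j \<in> J1 A. fst j \<in> U}, jet_coords (U, c))) ` A"

lemma jet_coords_jet1:
  assumes "(U, c) \<in> A" "x \<in> U" "smooth_near A x f"
  shows "jet_coords (U, c) (jet1 A x f) =
    (c x, \<chi> i. frechet_derivative (f \<circ> inv_into U c) (at (c x)) (axis i 1), f x)"
proof -
  define F where "F = {g. smooth_near A x g \<and> same_1jet A x f g}"
  have "f \<in> F"
    using assms by (auto simp: F_def same_1jet_def)
  hence "(SOME g. g \<in> F) \<in> F"
    by (rule someI[where P = "\<lambda>g. g \<in> F"])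
  hence "f x = (SOME g. g \<in> F) x"
    and "chart_derivative (U, c) id f x = chart_derivative (U, c) id (SOME g. g \<in> F) x"
    using assms by (auto simp: F_def same_1jet_def)
  thus ?thesis
    by (simp add: jet_coords_def jet1_def F_def[symmetric] chart_derivative_def Let_def)
qed

definition zero_section :: "('a, real^'n) atlas \<Rightarrow> 'a \<Rightarrow> 'a jet" where
  "zero_section A x = jet1 A x (\<lambda>_. 0)"


section \<open>Positive loops of Legendrian immersions\<close>

text \<open>\<open>\<alpha> = dz - p dq\<close> in the coordinates \<open>(q, p, z)\<close>, applied to a tangent vector at that point.\<close>

definition contact_form ::
  "(real^'n) \<times> (real^'n) \<times> real \<Rightarrow> (real^'n) \<times> (real^'n) \<times> real \<Rightarrow> real" where
  "contact_form = (\<lambda>(q, p, z) (dq, dp, dz). dz - p \<bullet> dq)"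

definition legendrian_immersion :: "('a, real^'n) atlas \<Rightarrow> ('a \<Rightarrow> 'a jet) \<Rightarrow> bool" where
  "legendrian_immersion A f \<longleftrightarrow> immersion A (jet_atlas A) f \<and>
     (\<forall>(U, c)\<in>A. \<forall>(V, d)\<in>jet_atlas A. \<forall>x\<in>U. f x \<in> V \<longrightarrow>
        (\<forall>v. contact_form (d (f x)) (chart_derivative (U, c) d f x v) = 0))"

text \<open>The circle is \<open>\<real>/\<int>\<close> with base point \<open>0\<close>: maps on \<open>L \<times> S^1\<close> are maps on \<open>L \<times> \<real>\<close> of period 1
  in the second variable.\<close>

definition legendrian_loop :: "('a, real^'n) atlas \<Rightarrow> (real \<Rightarrow> 'a \<Rightarrow> 'a jet) \<Rightarrow> bool" where
  "legendrian_loop A \<phi> \<longleftrightarrow>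
     smooth_map (times_line A) (jet_atlas A) (\<lambda>(x, t). \<phi> t x) \<and>
     (\<forall>x\<in>carrier_of A. \<forall>t. \<phi> (t + 1) x = \<phi> t x) \<and>
     (\<forall>t. legendrian_immersion A (\<phi> t))"

definition starts_from_zero_section :: "('a, real^'n) atlas \<Rightarrow> (real \<Rightarrow> 'a \<Rightarrow> 'a jet) \<Rightarrow> bool" where
  "starts_from_zero_section A \<phi> \<longleftrightarrow> (\<forall>x\<in>carrier_of A. \<phi> 0 x = zero_section A x)"

definition positive_loop :: "('a, real^'n) atlas \<Rightarrow> (real \<Rightarrow> 'a \<Rightarrow> 'a jet) \<Rightarrow> bool" where
  "positive_loop A \<phi> \<longleftrightarrow>
     (\<forall>x\<in>carrier_of A. \<forall>t. \<forall>(V, d)\<in>jet_atlas A. \<phi> t x \<in> V \<longrightarrow>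
        contact_form (d (\<phi> t x)) (vector_derivative (\<lambda>s. d (\<phi> s x)) (at t)) \<noteq> 0)"

text \<open>The \<open>C^0\<close> topology on loops of maps from \<open>L\<close> to \<open>J^1(L, \<real>)\<close>: a neighbourhood of the stationary
  loop at the zero section is given by an open neighbourhood \<open>W\<close> of its graph, and consists of the
  loops whose graph lies in \<open>W\<close>.  Here \<open>[0, 1]\<close> is a fundamental domain of the circle; as
  \<open>L \<times> [0, 1]\<close> is compact, this is the compact-open topology.\<close>

definition loop_graph :: "('a, real^'n) atlas \<Rightarrow> (real \<Rightarrow> 'a \<Rightarrow> 'a jet) \<Rightarrow> (('a \<times> real) \<times> 'a jet) set" where
  "loop_graph A \<phi> = {((x, t), \<phi> t x) |x t. x \<in> carrier_of A \<and> t \<in> {0..1}}"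

definition stationary_nbhd :: "('a, real^'n) atlas \<Rightarrow> (('a \<times> real) \<times> 'a jet) set \<Rightarrow> bool" where
  "stationary_nbhd A W \<longleftrightarrow>
     openin (prod_topology (prod_topology (atlas_topology A) (top_of_set {0..1}))
                           (atlas_topology (jet_atlas A))) W \<and>
     loop_graph A (\<lambda>_. zero_section A) \<subseteq> W"

end

theory Submission
  imports Defs
begin

text \<open>A plane front with zigzags all of whose slopes are positive becomes a positive loop by translating
  it in the direction \<open>- q\<close>, as it is periodic.  With wave length \<open>1 / N\<close> such a front is \<open>C^0\<close>-close to
  the flat one, from which it can be created through immersions with slopes at least \<open>- \<eta>\<close>; cutting
  off its amplitude makes sense in a chart of any manifold.  The zigzags are switched on in the charts of
  a finite cover, one after the other.  While they are on, their translation moves the front upwards at a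
  high speed on the main part of the chart, and downwards at most with a speed proportional to \<open>\<eta>\<close>
  elsewhere.  This gain is spent on a lowering of the whole front there, compensated by a lifting during
  the rest of the period, so that the front moves upwards everywhere and at all times.  The translation
  is made so fast that switching the zigzags on and off does not matter.  Finally the contact scaling
  \<open>(p, z) \<mapsto> (\<epsilon> p, \<epsilon> z)\<close> makes the loop small in the fibres.\<close>

section \<open>Calculus of smooth maps\<close>

text \<open>A positive loop cannot consist of graphs, since \<open>z\<close> would increase forever
  over every point. A periodic plane front with positive slopes must fold back in \<open>q\<close>,
  and as long as there are no folds, periodicity forbids slopes of one sign. Hence two amplitudes:
  the first creates the folds with slopes of order \<eta>, the second makes the slopes positive and
  may be nonzero only where the first equals 1.

  Fronts are described as envelopes of families of functions, so positivity is an inequality for the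
  time derivative of such a family. In units of \<open>speed / N\<close>, zigzags of second
  amplitude \<open>s\<close> contribute at least \<open>s / 10 - \<eta>\<close>, up to the cost of
  switching; the height function contributes at least \<open>(M - s) / 10\<close>, where
  \<open>M\<close> is the mean of a pulse over a period. With \<open>\<eta> = M / 20\<close> the sum
  is at least \<open>M / 20\<close>.

  The choice of constants is not circular: the size of the cover determines the width \<kappa> of
  the pulses, \<kappa> determines \<open>M\<close> and the bound \<open>D\<close> on switching,
  these determine the speed, the cover and the neighbourhood determine \<open>N\<close>, and
  \<epsilon> comes last because the profiles which it scales do not contain it.\<close>

abbreviation fderiv :: "('e::euclidean_space \<Rightarrow> 'f::euclidean_space) \<Rightarrow> 'e \<Rightarrow> 'e \<Rightarrow> 'f" where
  "fderiv f x \<equiv> frechet_derivative f (at x)"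

text \<open>\<open>Ck_on\<close> differentiates in the whole space at the points of
  \<open>S\<close>; openness makes these derivatives depend on the values on \<open>S\<close>
  alone.\<close>

lemma Ck_on_cong_imp:
  assumes "open S" "\<And>x. x \<in> S \<Longrightarrow> f x = g x" "Ck_on k S f"
  shows "Ck_on k S g"
  using assms(2,3)
proof (induction k arbitrary: f g)
  case 0
  then show ?case by (simp cong: continuous_on_cong)
next
  case (Suc k)
  have *: "(g has_derivative fderiv f x) (at x)" if "x \<in> S" for x
    using has_derivative_transform_within_open[OF _ assms(1) that] Suc.prems that
    by (metis Ck_on.simps(2) frechet_derivative_works)
  have d: "fderiv f x = fderiv g x" if "x \<in> S" for x
    using frechet_derivative_at[OF *[OF that]] .
  show ?case
    unfolding Ck_on.simps(2)
  proof (intro conjI ballI allI)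
    show "g differentiable at x" if "x \<in> S" for x using *[OF that] differentiable_def by blast
    show "Ck_on k S (\<lambda>x. fderiv g x v)" for v
      by (rule Suc.IH[of "\<lambda>x. fderiv f x v"]) (use d Suc.prems in auto)
  qed
qed

lemma Ck_on_SucI:
  assumes "open S" "\<And>x. x \<in> S \<Longrightarrow> (f has_derivative f' x) (at x)"
    "\<And>v. Ck_on k S (\<lambda>x. f' x v)"
  shows "Ck_on (Suc k) S f"
proof -
  have "f' x = fderiv f x" if "x \<in> S" for x
    using frechet_derivative_at[OF assms(2)[OF that]] .
  then show ?thesis
    using assms Ck_on_cong_imp[OF assms(1), of "\<lambda>x. f' x _" "\<lambda>x. fderiv f x _"]
    by (auto simp: differentiable_def)
qed

lemma Ck_on_Suc_imp: "Ck_on (Suc k) S f \<Longrightarrow> Ck_on k S f"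
proof (induction k arbitrary: f)
  case 0
  then show ?case
    by (auto intro!: continuous_at_imp_continuous_on differentiable_imp_continuous_within)
next
  case (Suc k)
  then show ?case by (metis Ck_on.simps(2))
qed

lemma Ck_on_local:
  assumes "\<And>x. x \<in> S \<Longrightarrow> \<exists>N. open N \<and> x \<in> N \<and> Ck_on k N f"
  shows "Ck_on k S f"
  using assms
proof (induction k arbitrary: f)
  case 0
  show ?case
    unfolding Ck_on.simps
  proof (rule continuous_at_imp_continuous_on, rule ballI)
    fix x assume "x \<in> S"
    then obtain N where "open N" "x \<in> N" "continuous_on N f" using 0 unfolding Ck_on.simps by blast
    then show "isCont f x" by (simp add: continuous_on_eq_continuous_at)
  qed
next
  case (Suc k)
  show ?case
    unfolding Ck_on.simps(2)
  proof (intro conjI ballI allI Suc.IH)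
    fix x assume "x \<in> S"
    then obtain N where "x \<in> N" "Ck_on (Suc k) N f" using Suc.prems by blast
    then show "f differentiable at x" unfolding Ck_on.simps(2) by blast
  next
    fix v x assume "x \<in> S"
    then obtain N where "open N" "x \<in> N" "Ck_on (Suc k) N f" using Suc.prems by blast
    then show "\<exists>N. open N \<and> x \<in> N \<and> Ck_on k N (\<lambda>x. fderiv f x v)"
      unfolding Ck_on.simps(2) by blast
  qed
qed

lemma Ck_on_subset: "Ck_on k S f \<Longrightarrow> T \<subseteq> S \<Longrightarrow> Ck_on k T f"
  by (induction k arbitrary: f) (auto intro: continuous_on_subset)

lemma Ck_on_const: "Ck_on k S (\<lambda>x. c)"
proof (induction k arbitrary: c)
  case (Suc k)
  have "fderiv (\<lambda>x::'a. c) x = (\<lambda>_. 0)" for x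
    using frechet_derivative_const by blast
  then show ?case using Suc by simp
qed simp

lemma Ck_on_bounded_linear_comp:
  assumes "bounded_linear L" "open S"
  shows "Ck_on k S f \<Longrightarrow> Ck_on k S (\<lambda>x. L (f x))"
proof (induction k arbitrary: f)
  case 0
  then show ?case using assms linear_continuous_on continuous_on_compose2
    by (metis Ck_on.simps(1) bounded_linear.continuous_on)
next
  case (Suc k)
  show ?case
  proof (rule Ck_on_SucI[OF assms(2)])
    fix x assume "x \<in> S"
    then have "(f has_derivative fderiv f x) (at x)"
      using Suc.prems by (auto simp flip: frechet_derivative_works)
    then show "((\<lambda>x. L (f x)) has_derivative (\<lambda>v. L (fderiv f x v))) (at x)"
      by (rule bounded_linear.has_derivative[OF assms(1)])
  next
    fix v show "Ck_on k S (\<lambda>x. L (fderiv f x v))"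
      using Suc by auto
  qed
qed

lemma Ck_on_ident: "open S \<Longrightarrow> Ck_on k S (\<lambda>x. x)"
proof (cases k)
  case (Suc j)
  assume "open S"
  then show ?thesis unfolding Suc
    by (rule Ck_on_SucI[where f' = "\<lambda>_ v. v"]) (auto intro: Ck_on_const)
qed simp

lemma Ck_on_bounded_linear:
  assumes "bounded_linear L" "open S"
  shows "Ck_on k S L"
  using Ck_on_bounded_linear_comp[OF assms Ck_on_ident[OF assms(2)]] .

lemma Ck_on_add:
  assumes "open S"
  shows "Ck_on k S f \<Longrightarrow> Ck_on k S g \<Longrightarrow> Ck_on k S (\<lambda>x. f x + g x)"
proof (induction k arbitrary: f g)
  case 0
  then show ?case by (simp add: continuous_on_add)
next
  case (Suc k)
  show ?case
  proof (rule Ck_on_SucI[OF assms(1)])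
    fix x assume "x \<in> S"
    then show "((\<lambda>x. f x + g x) has_derivative
      (\<lambda>v. fderiv f x v + fderiv g x v)) (at x)"
      using Suc.prems frechet_derivative_works by (auto intro!: has_derivative_add)
  qed (use Suc in auto)
qed

lemma Ck_on_sum:
  assumes "open S" "\<And>i. i \<in> I \<Longrightarrow> Ck_on k S (f i)"
  shows "Ck_on k S (\<lambda>x. \<Sum>i\<in>I. f i x)"
  using assms(2)
proof (induction I rule: infinite_finite_induct)
  case (insert i I)
  then show ?case using Ck_on_add[OF assms(1), of k "f i" "\<lambda>x. \<Sum>i\<in>I. f i x"] by simp
qed (auto intro: Ck_on_const)

lemma Ck_on_bilinear:
  assumes "bounded_bilinear B" "open S"
  shows "Ck_on k S f \<Longrightarrow> Ck_on k S g \<Longrightarrow> Ck_on k S (\<lambda>x. B (f x) (g x))"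
proof (induction k arbitrary: f g)
  case 0
  then show ?case by (simp add: bounded_bilinear.continuous_on[OF assms(1)])
next
  case (Suc k)
  show ?case
  proof (rule Ck_on_SucI[OF assms(2)])
    fix x assume "x \<in> S"
    then have "(f has_derivative fderiv f x) (at x)"
      "(g has_derivative fderiv g x) (at x)"
      using Suc.prems by (auto simp flip: frechet_derivative_works)
    then show "((\<lambda>x. B (f x) (g x)) has_derivative
      (\<lambda>v. B (f x) (fderiv g x v) + B (fderiv f x v) (g x))) (at x)"
      by (rule bounded_bilinear.FDERIV[OF assms(1)])
  next
    fix v show "Ck_on k S (\<lambda>x. B (f x) (fderiv g x v) + B (fderiv f x v) (g x))"
      by (intro Ck_on_add assms(2) Suc.IH) (use Suc.prems Ck_on_Suc_imp in auto)
  qed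
qed

text \<open>The chain rule yields \<open>?dg (f x) (?df x v)\<close>, whose direction varies with
  \<open>x\<close>, while \<open>Ck_on\<close> speaks of fixed directions. Expanding the direction
  in the basis turns it into a sum of products to which the induction hypothesis applies.\<close>

lemma Ck_on_compose:
  fixes f :: "'e::euclidean_space \<Rightarrow> 'f::euclidean_space" and g :: "'f \<Rightarrow> 'g::euclidean_space"
  assumes "open S" "open T" "f ` S \<subseteq> T"
  shows "Ck_on k S f \<Longrightarrow> Ck_on k T g \<Longrightarrow> Ck_on k S (\<lambda>x. g (f x))"
proof (induction k arbitrary: g)
  case 0
  then show ?case using assms(3) by (auto intro: continuous_on_compose2)
next
  case (Suc k)
  let ?df = "\<lambda>x. fderiv f x" and ?dg = "\<lambda>y. fderiv g y"
  have df: "(f has_derivative ?df x) (at x)" if "x \<in> S" for x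
    using Suc.prems that by (auto simp flip: frechet_derivative_works)
  have dg: "(g has_derivative ?dg y) (at y)" if "y \<in> T" for y
    using Suc.prems that by (auto simp flip: frechet_derivative_works)
  show ?case
  proof (rule Ck_on_SucI[OF assms(1)])
    fix x assume x: "x \<in> S"
    then have y: "f x \<in> T" using assms(3) by auto
    have lin: "linear (?dg (f x))" using dg[OF y] has_derivative_linear by blast
    have "?dg (f x) (?df x v) = (\<Sum>b\<in>Basis. (?df x v \<bullet> b) *\<^sub>R ?dg (f x) b)" for v
    proof -
      have "?dg (f x) (?df x v) = ?dg (f x) (\<Sum>b\<in>Basis. (?df x v \<bullet> b) *\<^sub>R b)"
        by (simp only: euclidean_representation)
      then show ?thesis using lin by (simp add: linear_sum linear_scale)
    qed
    moreover have "((\<lambda>x. g (f x)) has_derivative (\<lambda>v. ?dg (f x) (?df x v))) (at x)"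
      using has_derivative_compose[OF df[OF x] dg[OF y]] .
    ultimately show "((\<lambda>x. g (f x)) has_derivative (\<lambda>v. \<Sum>b\<in>Basis. (?df x v \<bullet> b) *\<^sub>R ?dg (f x) b)) (at x)"
      by simp
  next
    fix v
    show "Ck_on k S (\<lambda>x. \<Sum>b\<in>Basis. (?df x v \<bullet> b) *\<^sub>R ?dg (f x) b)"
    proof (intro Ck_on_sum assms(1) Ck_on_bilinear[OF bounded_bilinear_scaleR])
      fix b :: 'f
      show "Ck_on k S (\<lambda>x. ?df x v \<bullet> b)"
        using Suc.prems by (intro Ck_on_bounded_linear_comp[OF bounded_linear_inner_left assms(1)]) auto
      show "Ck_on k S (\<lambda>x. ?dg (f x) b)"
        using Suc.prems Ck_on_Suc_imp[of k S f] by (intro Suc.IH) auto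
    qed
  qed
qed

lemma smooth_on_cong:
  "open S \<Longrightarrow> (\<And>x. x \<in> S \<Longrightarrow> f x = g x) \<Longrightarrow> smooth_on S f \<Longrightarrow> smooth_on S g"
  unfolding smooth_on_def using Ck_on_cong_imp by blast

lemma smooth_on_local:
  assumes "\<And>x. x \<in> S \<Longrightarrow> \<exists>N. open N \<and> x \<in> N \<and> smooth_on N f"
  shows "smooth_on S f"
  unfolding smooth_on_def by (intro allI Ck_on_local) (use assms smooth_on_def in blast)

lemma smooth_on_subset: "smooth_on S f \<Longrightarrow> T \<subseteq> S \<Longrightarrow> smooth_on T f"
  unfolding smooth_on_def using Ck_on_subset by blast

lemma smooth_on_const [intro, simp]: "smooth_on S (\<lambda>x. c)"
  unfolding smooth_on_def using Ck_on_const by blast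

lemma smooth_on_bounded_linear: "bounded_linear L \<Longrightarrow> open S \<Longrightarrow> smooth_on S L"
  unfolding smooth_on_def using Ck_on_bounded_linear by blast

lemma smooth_on_bounded_linear_comp:
  "bounded_linear L \<Longrightarrow> open S \<Longrightarrow> smooth_on S f \<Longrightarrow> smooth_on S (\<lambda>x. L (f x))"
  unfolding smooth_on_def using Ck_on_bounded_linear_comp by blast

lemma smooth_on_ident: "open S \<Longrightarrow> smooth_on S (\<lambda>x. x)"
  unfolding smooth_on_def using Ck_on_ident by blast

lemma smooth_on_add: "open S \<Longrightarrow> smooth_on S f \<Longrightarrow> smooth_on S g \<Longrightarrow> smooth_on S (\<lambda>x. f x + g x)"
  unfolding smooth_on_def using Ck_on_add by blast

lemma smooth_on_sum: "open S \<Longrightarrow> (\<And>i. i \<in> I \<Longrightarrow> smooth_on S (f i)) \<Longrightarrow> smooth_on S (\<lambda>x. \<Sum>i\<in>I. f i x)"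
  by (simp add: smooth_on_def Ck_on_sum)

lemma smooth_on_bilinear:
  "bounded_bilinear B \<Longrightarrow> open S \<Longrightarrow> smooth_on S f \<Longrightarrow> smooth_on S g \<Longrightarrow> smooth_on S (\<lambda>x. B (f x) (g x))"
  by (simp add: smooth_on_def Ck_on_bilinear)

lemmas smooth_on_mult = smooth_on_bilinear[OF bounded_bilinear_mult]
  and smooth_on_scaleR = smooth_on_bilinear[OF bounded_bilinear_scaleR]
  and smooth_on_inner = smooth_on_bilinear[OF bounded_bilinear_inner]

lemma smooth_on_diff: "open S \<Longrightarrow> smooth_on S f \<Longrightarrow> smooth_on S g \<Longrightarrow> smooth_on S (\<lambda>x. f x - g x)"
  using smooth_on_add[of S f "\<lambda>x. - g x"] smooth_on_bounded_linear_comp[OF bounded_linear_minus[OF bounded_linear_ident], of S g]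
  by simp

lemma smooth_on_fst: "open S \<Longrightarrow> smooth_on S f \<Longrightarrow> smooth_on S (\<lambda>x. fst (f x))"
  and smooth_on_snd: "open S \<Longrightarrow> smooth_on S f \<Longrightarrow> smooth_on S (\<lambda>x. snd (f x))"
  by (simp_all add: smooth_on_bounded_linear_comp bounded_linear_fst bounded_linear_snd)

lemma smooth_on_Pair:
  assumes "open S" "smooth_on S f" "smooth_on S g"
  shows "smooth_on S (\<lambda>x. (f x, g x))"
proof -
  have "bounded_linear (\<lambda>x::'b. (x, 0::'c))" "bounded_linear (\<lambda>x::'c. (0::'b, x))"
    by (simp_all add: bounded_linear_Pair bounded_linear_ident bounded_linear_zero)
  then have "smooth_on S (\<lambda>x. (f x, 0) + (0, g x))"
    using assms by (intro smooth_on_add smooth_on_bounded_linear_comp[of "\<lambda>x::'b. (x, 0::'c)"]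
        smooth_on_bounded_linear_comp[of "\<lambda>x::'c. (0::'b, x)"])
  then show ?thesis by simp
qed

lemma smooth_on_compose:
  "open S \<Longrightarrow> open T \<Longrightarrow> f ` S \<subseteq> T \<Longrightarrow> smooth_on S f \<Longrightarrow> smooth_on T g \<Longrightarrow> smooth_on S (\<lambda>x. g (f x))"
  by (simp add: smooth_on_def Ck_on_compose[of S T f])

lemma smooth_on_compose_UNIV:
  "smooth_on UNIV g \<Longrightarrow> open S \<Longrightarrow> smooth_on S f \<Longrightarrow> smooth_on S (\<lambda>x. g (f x))"
  using smooth_on_compose[of S UNIV f g] by simp

lemma smooth_on_power:
  fixes f :: "'e::euclidean_space \<Rightarrow> real"
  shows "open S \<Longrightarrow> smooth_on S f \<Longrightarrow> smooth_on S (\<lambda>x. f x ^ n)"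
  by (induction n) (auto intro!: smooth_on_mult)

lemma smooth_on_frechet_derivative: "smooth_on S f \<Longrightarrow> smooth_on S (\<lambda>x. fderiv f x v)"
  unfolding smooth_on_def using Ck_on.simps(2) by blast

lemma smooth_on_has_derivative:
  "smooth_on S f \<Longrightarrow> x \<in> S \<Longrightarrow> (f has_derivative fderiv f x) (at x)"
  unfolding smooth_on_def using Ck_on.simps(2) frechet_derivative_works by blast

lemma smooth_on_continuous_on: "smooth_on S f \<Longrightarrow> continuous_on S f"
  unfolding smooth_on_def using Ck_on.simps(1) by blast

section \<open>Smooth functions of one real variable\<close>

lemma Ck_on_real_SucI:
  fixes g :: "real \<Rightarrow> real"
  assumes "open S" "\<And>x. x \<in> S \<Longrightarrow> (g has_real_derivative g' x) (at x)" "Ck_on k S g'"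
  shows "Ck_on (Suc k) S g"
proof (rule Ck_on_SucI[OF assms(1)])
  fix x assume "x \<in> S"
  then show "(g has_derivative (\<lambda>v. g' x * v)) (at x)"
    using assms(2) unfolding has_field_derivative_def by auto
next
  fix v show "Ck_on k S (\<lambda>x. g' x * v)"
    using assms by (intro Ck_on_bilinear[OF bounded_bilinear_mult] Ck_on_const)
qed

lemma smooth_on_real_primitive:
  fixes g :: "real \<Rightarrow> real"
  assumes "open S" "\<And>x. x \<in> S \<Longrightarrow> (g has_real_derivative g' x) (at x)" "smooth_on S g'"
  shows "smooth_on S g"
  unfolding smooth_on_def
proof
  fix k show "Ck_on k S g"
  proof (cases k)
    case 0
    have "continuous_on S g"
      by (rule DERIV_continuous_on) (rule has_field_derivative_at_within[OF assms(2)])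
    then show ?thesis using 0 by simp
  next
    case (Suc j)
    have "Ck_on (Suc j) S g"
      by (rule Ck_on_real_SucI[OF assms(1,2)]) (use assms(3) in \<open>simp_all add: smooth_on_def\<close>)
    then show ?thesis using Suc by simp
  qed
qed

lemma smooth_on_sin: "smooth_on UNIV (sin :: real \<Rightarrow> real)"
  and smooth_on_cos: "smooth_on UNIV (cos :: real \<Rightarrow> real)"
proof -
  \<comment> \<open>Linear combinations of both functions are closed under differentiation, so the
    induction runs over all of them at once.\<close>
  have "Ck_on k UNIV (\<lambda>x::real. A * sin x + B * cos x)" for k A B
  proof (induction k arbitrary: A B)
    case (Suc k)
    show ?case
      by (rule Ck_on_real_SucI[OF _ _ Suc.IH[of "- B" A]]) (auto intro!: derivative_eq_intros)
  qed (auto intro!: continuous_intros)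
  from this[of _ 1 0] this[of _ 0 1] show "smooth_on UNIV (sin :: real \<Rightarrow> real)"
     "smooth_on UNIV (cos :: real \<Rightarrow> real)"
    by (auto simp: smooth_on_def)
qed

lemma smooth_on_inverse: "smooth_on {x. x \<noteq> 0} (inverse :: real \<Rightarrow> real)"
proof -
  have op: "open {x::real. x \<noteq> 0}" by (simp add: open_Collect_neq)
  have "Ck_on k {x. x \<noteq> 0} (\<lambda>x::real. inverse x)" for k
  proof (induction k)
    case (Suc k)
    show ?case
    proof (rule Ck_on_real_SucI[OF op])
      show "((\<lambda>x. inverse x) has_real_derivative - (inverse x * inverse x)) (at x)" if "x \<in> {x. x \<noteq> 0}" for x :: real
        using that by (auto intro!: derivative_eq_intros)
      show "Ck_on k {x. x \<noteq> 0} (\<lambda>x::real. - (inverse x * inverse x))"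
        using Ck_on_bounded_linear_comp[OF bounded_linear_minus[OF bounded_linear_ident] op
            Ck_on_bilinear[OF bounded_bilinear_mult op Suc Suc]] by simp
    qed
  qed (auto intro!: continuous_intros)
  then show ?thesis by (simp add: smooth_on_def)
qed

lemma smooth_on_divide:
  fixes f g :: "'e::euclidean_space \<Rightarrow> real"
  assumes "open S" "smooth_on S f" "smooth_on S g" "\<And>x. x \<in> S \<Longrightarrow> g x \<noteq> 0"
  shows "smooth_on S (\<lambda>x. f x / g x)"
  unfolding divide_inverse
  using assms
  by (intro smooth_on_mult smooth_on_compose[of S "{x. x \<noteq> 0}" g inverse] smooth_on_inverse)
     (auto simp: open_Collect_neq)

lemmas smooth_on_intros = smooth_on_const smooth_on_ident smooth_on_add smooth_on_diff smooth_on_mult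
  smooth_on_scaleR smooth_on_inner smooth_on_fst smooth_on_snd smooth_on_Pair smooth_on_power
  smooth_on_sum smooth_on_compose_UNIV[OF smooth_on_sin] smooth_on_compose_UNIV[OF smooth_on_cos]


subsection \<open>A smooth step\<close>

text \<open>The powers in the denominator make the family closed under differentiation up to linear
  combinations, so that smoothness at 0 follows by an induction over all \<open>j\<close>
  simultaneously.\<close>

definition flat_exp :: "nat \<Rightarrow> real \<Rightarrow> real" where
  "flat_exp j x = (if x \<le> 0 then 0 else exp (- (1 / x)) / x ^ j)"

lemma flat_exp_tendsto_0: "(flat_exp j \<longlongrightarrow> 0) (at 0)"
proof -
  have "((\<lambda>x::real. inverse x ^ j / exp (inverse x)) \<longlongrightarrow> 0) (at_right 0)"
    by (rule filterlim_compose[OF tendsto_power_div_exp_0 filterlim_inverse_at_top_right])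
  then have "((\<lambda>x::real. exp (- (1 / x)) / x ^ j) \<longlongrightarrow> 0) (at_right 0)"
    by (simp add: field_simps exp_minus)
  then have "(flat_exp j \<longlongrightarrow> 0) (at_right 0)"
    by (rule Lim_transform_eventually) (auto simp: flat_exp_def eventually_at_filter)
  moreover have "(flat_exp j \<longlongrightarrow> 0) (at_left 0)"
    by (rule Lim_transform_eventually[OF tendsto_const]) (auto simp: flat_exp_def eventually_at_filter)
  ultimately show ?thesis by (simp add: filterlim_split_at)
qed

lemma flat_exp_has_derivative:
  "(flat_exp j has_real_derivative (flat_exp (j + 2) x - j * flat_exp (j + 1) x)) (at x)"
proof (cases x "0::real" rule: linorder_cases)
  case less
  have "((\<lambda>_. 0) has_real_derivative 0) (at x)" by simp
  then have "(flat_exp j has_real_derivative 0) (at x)"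
    by (rule has_field_derivative_transform_within_open[of _ _ _ "{..<0}"])
       (use less in \<open>auto simp: flat_exp_def\<close>)
  then show ?thesis using less by (simp add: flat_exp_def)
next
  case equal
  \<comment> \<open>The difference quotient of \<open>flat_exp j\<close> at 0 is
    \<open>flat_exp (j + 1)\<close>.\<close>
  have "(flat_exp (j + 1) \<longlongrightarrow> 0) (at 0)" by (rule flat_exp_tendsto_0)
  then have "((\<lambda>h. (flat_exp j (0 + h) - flat_exp j 0) / h) \<longlongrightarrow> 0) (at 0)"
    by (rule Lim_transform_eventually) (auto simp: flat_exp_def eventually_at_filter field_simps)
  then show ?thesis using equal by (simp add: DERIV_def flat_exp_def)
next
  case greater
  have "((\<lambda>x. inverse x ^ j) has_real_derivative - (j * inverse x ^ (j + 1))) (at x)"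
    using DERIV_power[OF DERIV_inverse[of x], of j] greater by (cases j) (auto simp: mult_ac)
  moreover have "((\<lambda>x. exp (- (1 / x))) has_real_derivative exp (- (1 / x)) * inverse x ^ 2) (at x)"
    using greater by (auto intro!: derivative_eq_intros simp: field_simps power2_eq_square)
  ultimately have "((\<lambda>x. exp (- (1 / x)) * inverse x ^ j) has_real_derivative
     exp (- (1 / x)) * inverse x ^ 2 * inverse x ^ j + - (j * inverse x ^ (j + 1)) * exp (- (1 / x))) (at x)"
    by (rule DERIV_mult[rotated])
  then have "((\<lambda>x. exp (- (1 / x)) / x ^ j) has_real_derivative
     (exp (- (1 / x)) / x ^ (j + 2) - j * (exp (- (1 / x)) / x ^ (j + 1)))) (at x)"
    by (simp add: divide_inverse power_add power_inverse power2_eq_square mult_ac)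
  then have "(flat_exp j has_real_derivative
     (exp (- (1 / x)) / x ^ (j + 2) - j * (exp (- (1 / x)) / x ^ (j + 1)))) (at x)"
    by (rule has_field_derivative_transform_within_open[of _ _ _ "{0<..}"])
       (use greater in \<open>auto simp: flat_exp_def\<close>)
  then show ?thesis using greater by (simp add: flat_exp_def)
qed

lemma smooth_on_flat_exp: "smooth_on UNIV (flat_exp j)"
proof -
  have "Ck_on k UNIV (flat_exp j)" for k
  proof (induction k arbitrary: j)
    case 0
    show ?case
      unfolding Ck_on.simps
      by (rule DERIV_continuous_on) (rule has_field_derivative_at_within[OF flat_exp_has_derivative])
  next
    case (Suc k)
    show ?case
    proof (rule Ck_on_real_SucI[OF open_UNIV flat_exp_has_derivative])
      have "Ck_on k UNIV (\<lambda>x. flat_exp (j + 2) x + (- real j) * flat_exp (j + 1) x)"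
        by (intro Ck_on_add Ck_on_bilinear[OF bounded_bilinear_mult] Ck_on_const Suc open_UNIV)
      then show "Ck_on k UNIV (\<lambda>x. flat_exp (j + 2) x - real j * flat_exp (j + 1) x)" by simp
    qed
  qed
  then show ?thesis by (simp add: smooth_on_def)
qed

definition smooth_step :: "real \<Rightarrow> real" where
  "smooth_step x = flat_exp 0 x / (flat_exp 0 x + flat_exp 0 (1 - x))"

lemma smooth_step_denominator_pos: "0 < flat_exp 0 x + flat_exp 0 (1 - x)"
  by (auto simp: flat_exp_def intro: add_pos_pos)

lemma smooth_on_smooth_step: "smooth_on UNIV smooth_step"
  unfolding smooth_step_def
  using smooth_step_denominator_pos
  by (intro smooth_on_divide smooth_on_intros smooth_on_compose_UNIV[OF smooth_on_flat_exp] open_UNIV)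
     (metis less_irrefl)

lemma smooth_step_le_0: "x \<le> 0 \<Longrightarrow> smooth_step x = 0"
  and smooth_step_ge_1: "x \<ge> 1 \<Longrightarrow> smooth_step x = 1"
  by (auto simp: smooth_step_def flat_exp_def)

lemma smooth_step_nonneg: "0 \<le> smooth_step x"
  and smooth_step_le_1: "smooth_step x \<le> 1"
  using smooth_step_denominator_pos[of x] by (auto simp: smooth_step_def flat_exp_def divide_simps)


subsection \<open>A smooth implicit function\<close>

text \<open>The uniform lower bound makes \<open>F (e, _)\<close> a bijection of the line for every
  \<open>e\<close>, so the solution is global and no local solutions have to be glued. The first
  derivative comes from the inverse of the map from \<open>(e, w)\<close> to
  \<open>(e, F (e, w))\<close>, the higher ones by induction from the resulting formula.\<close>

lemma smooth_implicit_function: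
  fixes F :: "'e::euclidean_space \<times> real \<Rightarrow> real"
  assumes F: "smooth_on UNIV F" and c: "c > 0"
    and der: "\<And>e w. fderiv F (e, w) (0, 1) \<ge> c"
  obtains W where "smooth_on UNIV W" "\<And>e w. F (e, w) = 0 \<longleftrightarrow> w = W e"
proof -
  have dF: "(F has_derivative fderiv F z) (at z)" for z
    using smooth_on_has_derivative[OF F] by blast
  have d1: "((\<lambda>w. F (e, w)) has_real_derivative fderiv F (e, w) (0, 1)) (at w)" for e w
  proof -
    have "((\<lambda>w. (e, w)) has_derivative (\<lambda>h. (0, h))) (at w)"
      by (rule has_derivative_Pair[OF has_derivative_const has_derivative_ident])
    from has_derivative_compose[OF this dF[of "(e, w)"]]
    have "((\<lambda>w. F (e, w)) has_derivative (\<lambda>h. fderiv F (e, w) (0, h))) (at w)" .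
    moreover have "(\<lambda>h. fderiv F (e, w) (0, h)) = (*) (fderiv F (e, w) (0, 1))"
    proof
      fix h :: real
      have "fderiv F (e, w) (h *\<^sub>R (0, 1)) = h *\<^sub>R fderiv F (e, w) (0, 1)"
        by (rule linear_scale[OF has_derivative_linear[OF dF]])
      then show "fderiv F (e, w) (0, h) = fderiv F (e, w) (0, 1) * h" by simp
    qed
    ultimately show ?thesis unfolding has_field_derivative_def by (simp only:)
  qed
  have mono: "F (e, w') - F (e, w) \<ge> c * (w' - w)" if "w \<le> w'" for e w w'
  proof (cases "w = w'")
    case False
    then have "w < w'" using that by simp
    from MVT2[OF this d1[of e]] obtain z where
      "F (e, w') - F (e, w) = (w' - w) * fderiv F (e, z) (0, 1)" by blast
    moreover have "c * (w' - w) \<le> fderiv F (e, z) (0, 1) * (w' - w)"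
      using der that by (intro mult_right_mono) auto
    ultimately show ?thesis by (simp add: mult.commute)
  qed simp
  have lip: "c * \<bar>w' - w\<bar> \<le> \<bar>F (e, w') - F (e, w)\<bar>" for e w w'
    using mono[of w w' e] mono[of w' w e] by (cases "w \<le> w'") auto
  have ex: "\<exists>w. F (e, w) = v" for e v
  proof -
    let ?r = "\<bar>F (e, 0) - v\<bar> / c"
    have r: "?r \<ge> 0" "c * ?r = \<bar>F (e, 0) - v\<bar>" using c by auto
    have "F (e, - ?r) \<le> v" "v \<le> F (e, ?r)"
      using mono[of "- ?r" 0 e] mono[of 0 ?r e] r by auto
    moreover have "continuous_on {- ?r..?r} (\<lambda>w. F (e, w))"
      by (rule DERIV_continuous_on) (rule has_field_derivative_at_within[OF d1])
    ultimately show ?thesis using IVT'[of "\<lambda>w. F (e, w)" "- ?r" v ?r] r by auto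
  qed
  have inj: "w = w'" if "F (e, w) = F (e, w')" for e w w'
    using lip[of w' w e] that c by (simp add: mult_le_0_iff)
  \<comment> \<open>Solving \<open>F (e, w) = v\<close> for every \<open>v\<close>, and not only for
    0, provides the full inverse map to which the theorem on derivatives of inverses
    applies.\<close>
  define Wt where "Wt = (\<lambda>(e, v). THE w. F (e, w) = v)"
  have Wt: "F (e, Wt (e, v)) = v" for e v
    unfolding Wt_def using ex[of e v] inj by (auto intro: theI2)
  define W where "W e = Wt (e, 0)" for e
  have FW: "F (e, W e) = 0" for e unfolding W_def by (rule Wt)
  have iff: "F (e, w) = 0 \<longleftrightarrow> w = W e" for e w using FW inj by metis
  have contWt: "isCont Wt z" for z
  proof (cases z)
    case (Pair e v)
    have "isCont F (e, Wt (e, v))" using dF has_derivative_continuous by blast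
    then have "((\<lambda>z'. F (fst z', Wt (e, v))) \<longlongrightarrow> F (e, Wt (e, v))) (at (e, v))"
      by (intro isCont_tendsto_compose[of _ F]) (auto intro!: tendsto_eq_intros)
    then have "((\<lambda>z'. \<bar>snd z' - F (fst z', Wt (e, v))\<bar> / c) \<longlongrightarrow> \<bar>v - F (e, Wt (e, v))\<bar> / c) (at (e, v))"
      by (intro tendsto_intros) (use c in \<open>auto intro!: tendsto_eq_intros\<close>)
    then have lim: "((\<lambda>z'. \<bar>snd z' - F (fst z', Wt (e, v))\<bar> / c) \<longlongrightarrow> 0) (at (e, v))"
      using Wt by simp
    have "norm (Wt z' - Wt (e, v)) \<le> \<bar>snd z' - F (fst z', Wt (e, v))\<bar> / c" for z'
      using lip[of "Wt z'" "Wt (e, v)" "fst z'"] Wt[of "fst z'" "snd z'"] c by (simp add: field_simps)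
    then have "((\<lambda>z'. Wt z' - Wt (e, v)) \<longlongrightarrow> 0) (at (e, v))"
      by (intro Lim_null_comparison[OF always_eventually lim] allI)
    then show ?thesis using Pair by (simp add: isCont_def LIM_zero_iff)
  qed
  let ?D = "\<lambda>z. fderiv F z"
  let ?W' = "\<lambda>e v. - (?D (e, W e) (v, 0) / ?D (e, W e) (0, 1))"
  have dW: "(W has_derivative ?W' e) (at e)" for e
  proof -
    let ?d = "?D (e, W e)"
    let ?f = "\<lambda>z. (fst z, F z)" and ?g = "\<lambda>z. (fst z, Wt z)"
    let ?f' = "\<lambda>h. (fst h, ?d h)" and ?g' = "\<lambda>h. (fst h, (snd h - ?d (fst h, 0)) / ?d (0, 1))"
    have lin: "linear ?d" by (rule has_derivative_linear[OF dF])
    have pos: "?d (0, 1) > 0" using der[of e "W e"] c by linarith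
    have split: "?d (x, y) = ?d (x, 0) + y * ?d (0, 1)" for x y
    proof -
      have "?d ((x, 0) + y *\<^sub>R (0, 1)) = ?d (x, 0) + y *\<^sub>R ?d (0, 1)"
        using lin by (simp only: linear_add linear_scale)
      then show ?thesis by simp
    qed
    have bl: "bounded_linear ?d" using has_derivative_bounded_linear[OF dF] .
    have bl2: "bounded_linear (\<lambda>h. ?d (fst h, 0))"
      by (rule bounded_linear_compose[OF bl, of "\<lambda>h. (fst h, 0)", simplified])
         (auto intro!: bounded_linear_Pair bounded_linear_fst bounded_linear_zero)
    have "(?g has_derivative ?g') (at (e, 0))"
    proof (rule has_derivative_inverse_basic[where f = ?f and f' = ?f' and T = UNIV])
      show "(?f has_derivative ?f') (at (?g (e, 0)))"
        using dF[of "(e, W e)"] by (auto intro!: has_derivative_Pair has_derivative_fst simp: W_def)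
      show "bounded_linear ?g'"
        by (intro bounded_linear_Pair bounded_linear_fst bounded_linear_divide
            bounded_linear_compose[OF bounded_linear_divide] bounded_linear_sub bounded_linear_snd bl2)
      show "?g' \<circ> ?f' = id"
      proof
        fix h :: "'e \<times> real"
        obtain x y where "h = (x, y)" by fastforce
        then show "(?g' \<circ> ?f') h = id h" using pos split[of x y] by simp
      qed
      show "continuous (at (e, 0)) ?g"
        using contWt by (auto intro!: continuous_intros)
    qed (auto simp: Wt)
    from has_derivative_compose[of "\<lambda>e. (e, 0::real)" "\<lambda>v. (v, 0)" e UNIV ?g, OF _ this]
    have "((\<lambda>e. ?g (e, 0)) has_derivative (\<lambda>v. ?g' (v, 0))) (at e)"
      by (simp add: has_derivative_Pair)
    from has_derivative_snd[OF this] show ?thesis by (simp add: W_def[abs_def])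
  qed
  have "Ck_on k UNIV W" for k
  proof (induction k)
    case 0
    then show ?case using has_derivative_continuous[OF dW]
      by (simp add: continuous_on_eq_continuous_at)
  next
    case (Suc k)
    have CD: "Ck_on k UNIV (\<lambda>e. ?D (e, W e) x)" for x
    proof (rule Ck_on_compose[of UNIV UNIV "\<lambda>e. (e, W e)"])
      have "Ck_on k UNIV (\<lambda>e. (e, 0) + (0, W e))"
        by (intro Ck_on_add Ck_on_bounded_linear Ck_on_bounded_linear_comp[of "\<lambda>y::real. (0, y)"]
            bounded_linear_Pair bounded_linear_ident bounded_linear_zero open_UNIV Suc)
      then show "Ck_on k UNIV (\<lambda>e. (e, W e))" by simp
      show "Ck_on k UNIV (\<lambda>z. ?D z x)"
        using smooth_on_frechet_derivative[OF F] by (simp add: smooth_on_def)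
    qed auto
    have ne: "?D (e, W e) (0, 1) \<noteq> 0" for e using der[of e "W e"] c by linarith
    show ?case
    proof (rule Ck_on_SucI[OF open_UNIV dW])
      fix v
      have "Ck_on k UNIV (\<lambda>e. inverse (?D (e, W e) (0, 1)))"
        by (rule Ck_on_compose[of UNIV "{x. x \<noteq> 0}" _ _ inverse])
           (use CD ne smooth_on_inverse in \<open>auto simp: open_Collect_neq smooth_on_def\<close>)
      then have "Ck_on k UNIV (\<lambda>e. - 1 * (?D (e, W e) (v, 0) * inverse (?D (e, W e) (0, 1))))"
        by (intro Ck_on_bilinear[OF bounded_bilinear_mult] Ck_on_const CD open_UNIV)
      then show "Ck_on k UNIV (\<lambda>e. ?W' e v)" by (simp add: divide_inverse)
    qed
  qed
  then have "smooth_on UNIV W" by (simp add: smooth_on_def)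
  then show ?thesis using that iff by blast
qed

section \<open>Manifolds in charts\<close>

lemma smooth_atlasD:
  assumes "smooth_atlas A" "(U, c) \<in> A" "(V, d) \<in> A"
  shows "inj_on c U" "open (c ` U)" "open (c ` (U \<inter> V))"
    "smooth_on (c ` (U \<inter> V)) (d \<circ> inv_into U c)"
  using assms unfolding smooth_atlas_def by fastforce+

lemma chart_inverse [simp]:
  assumes "smooth_atlas A" "(U, c) \<in> A"
  shows "x \<in> U \<Longrightarrow> inv_into U c (c x) = x"
    "e \<in> c ` U \<Longrightarrow> inv_into U c e \<in> U" "e \<in> c ` U \<Longrightarrow> c (inv_into U c e) = e"
  using smooth_atlasD(1)[OF assms assms(2)] by (auto simp: inv_into_into f_inv_into_f)

lemma carrier_ofI: "(U, c) \<in> A \<Longrightarrow> x \<in> U \<Longrightarrow> x \<in> carrier_of A"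
  unfolding carrier_of_def by blast

lemma carrier_ofE:
  assumes "x \<in> carrier_of A"
  obtains U c where "(U, c) \<in> A" "x \<in> U"
  using assms unfolding carrier_of_def by blast

lemma transition_derivative_inverse:
  assumes "smooth_atlas A" "(U, c) \<in> A" "(V, d) \<in> A" "x \<in> U" "x \<in> V"
  shows "fderiv (c \<circ> inv_into V d) (d x)
    (fderiv (d \<circ> inv_into U c) (c x) v) = v"
proof -
  note UV = smooth_atlasD[OF assms(1,2,3)] and VU = smooth_atlasD[OF assms(1,3,2)]
  have "((d \<circ> inv_into U c) has_derivative fderiv (d \<circ> inv_into U c) (c x)) (at (c x))"
    by (rule smooth_on_has_derivative[OF UV(4)]) (use assms in auto)
  moreover have "((c \<circ> inv_into V d) has_derivative fderiv (c \<circ> inv_into V d) (d x))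
      (at ((d \<circ> inv_into U c) (c x)))"
    using smooth_on_has_derivative[OF VU(4), of "d x"] assms by simp
  ultimately have "((\<lambda>e. (c \<circ> inv_into V d) ((d \<circ> inv_into U c) e)) has_derivative
      (\<lambda>v. fderiv (c \<circ> inv_into V d) (d x)
        (fderiv (d \<circ> inv_into U c) (c x) v))) (at (c x))"
    by (rule has_derivative_compose)
  then have "((\<lambda>e. e) has_derivative
      (\<lambda>v. fderiv (c \<circ> inv_into V d) (d x)
        (fderiv (d \<circ> inv_into U c) (c x) v))) (at (c x))"
    by (rule has_derivative_transform_within_open[OF _ UV(3)]) (use assms in auto)
  from has_derivative_unique[OF this has_derivative_ident] show ?thesis by metis
qed


subsection \<open>Coordinate representations of maps\<close>

text \<open>A map is usually known in one convenient pair of charts around a point. This records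
  such local knowledge, and the lemmas below transfer it to the arbitrary charts over which
  \<open>smooth_map\<close> and \<open>immersion\<close> quantify.\<close>

definition represents ::
  "('a, 'e::euclidean_space) chart \<Rightarrow> ('b, 'f::euclidean_space) chart \<Rightarrow> ('a \<Rightarrow> 'b) \<Rightarrow> 'e set \<Rightarrow> ('e \<Rightarrow> 'f) \<Rightarrow> bool"
where
  "represents = (\<lambda>(U, c) (V, d) f S g. open S \<and> S \<subseteq> c ` U \<and> smooth_on S g \<and>
     (\<forall>e\<in>S. f (inv_into U c e) \<in> V \<and> d (f (inv_into U c e)) = g e))"

lemma represents_change_charts:
  assumes A: "smooth_atlas A" "(U, c) \<in> A" "(U1, c1) \<in> A" and B: "smooth_atlas B" "(V, d) \<in> B" "(V1, d1) \<in> B"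
    and rep: "represents (U, c) (V, d) f S g" and x: "x \<in> U" "x \<in> U1" "c x \<in> S" "f x \<in> V1"
  obtains S1 where "represents (U1, c1) (V1, d1) f S1
      (\<lambda>e. (d1 \<circ> inv_into V d) (g ((c \<circ> inv_into U1 c1) e)))" "c1 x \<in> S1"
proof -
  let ?a = "c \<circ> inv_into U1 c1" and ?b = "d1 \<circ> inv_into V d"
  note a = smooth_atlasD[OF A(1,3,2)] and b = smooth_atlasD[OF B(1,2,3)]
  have S: "open S" "S \<subseteq> c ` U" "smooth_on S g"
    and fS: "\<And>e. e \<in> S \<Longrightarrow> f (inv_into U c e) \<in> V" "\<And>e. e \<in> S \<Longrightarrow> d (f (inv_into U c e)) = g e"
    using rep unfolding represents_def by auto
  define S0 where "S0 = c1 ` (U1 \<inter> U) \<inter> ?a -` S"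
  define S1 where "S1 = S0 \<inter> (\<lambda>e. g (?a e)) -` (d ` (V \<inter> V1))"
  have "open S0" unfolding S0_def
    by (rule continuous_open_preimage[OF smooth_on_continuous_on[OF a(4)] a(3) S(1)])
  have sa: "smooth_on S0 ?a" by (rule smooth_on_subset[OF a(4)]) (simp add: S0_def)
  have sga: "smooth_on S0 (\<lambda>e. g (?a e))"
    by (rule smooth_on_compose[OF \<open>open S0\<close> S(1) _ sa S(3)]) (auto simp: S0_def)
  have "open S1" unfolding S1_def
    by (rule continuous_open_preimage[OF smooth_on_continuous_on[OF sga] \<open>open S0\<close> b(3)])
  have "smooth_on S1 (\<lambda>e. ?b (g (?a e)))"
    by (rule smooth_on_compose[OF \<open>open S1\<close> b(3) _ smooth_on_subset[OF sga] b(4)]) (auto simp: S1_def)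
  moreover have "f (inv_into U1 c1 e) \<in> V1 \<and> d1 (f (inv_into U1 c1 e)) = ?b (g (?a e))" if eS: "e \<in> S1" for e
  proof -
    obtain y where "y \<in> U1" "y \<in> U" "e = c1 y"
      using eS unfolding S1_def S0_def by blast
    with eS have y: "y \<in> U1" "y \<in> U" "e = c1 y" "c y \<in> S" "g (c y) \<in> d ` (V \<inter> V1)"
      unfolding S1_def S0_def by (simp_all add: chart_inverse[OF A(1,3)])
    then have "f y \<in> V" "d (f y) = g (c y)" using fS[of "c y"] by (simp_all add: chart_inverse[OF A(1,2)])
    moreover obtain w where "w \<in> V" "w \<in> V1" "g (c y) = d w" using y by auto
    ultimately have "w = f y" using smooth_atlasD(1)[OF B(1,2,2)] by (auto dest: inj_onD)
    then show ?thesis using y \<open>w \<in> V1\<close> \<open>f y \<in> V\<close>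
      by (simp add: chart_inverse[OF A(1,2)] chart_inverse[OF A(1,3)] chart_inverse[OF B(1,2)]
          flip: \<open>d (f y) = g (c y)\<close>)
  qed
  moreover have "c1 x \<in> S1"
  proof -
    have "g (c x) = d (f x)" "f x \<in> V" using fS[OF x(3)] chart_inverse(1)[OF A(1,2) x(1)] by auto
    then show ?thesis using x chart_inverse(1)[OF A(1,3)] by (auto simp: S1_def S0_def)
  qed
  moreover have "S1 \<subseteq> c1 ` U1" unfolding S1_def S0_def by auto
  ultimately show ?thesis using that[of S1] \<open>open S1\<close> unfolding represents_def by auto
qed

lemma represents_derivative:
  assumes "represents (U, c) (V, d) f S g" "e \<in> S"
  shows "fderiv (d \<circ> f \<circ> inv_into U c) e = fderiv g e"
proof -
  have "(g has_derivative fderiv g e) (at e)"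
    using assms unfolding represents_def by (auto intro: smooth_on_has_derivative)
  then have "((d \<circ> f \<circ> inv_into U c) has_derivative fderiv g e) (at e)"
    by (rule has_derivative_transform_within_open[of _ _ _ _ S]) (use assms in \<open>auto simp: represents_def\<close>)
  from frechet_derivative_at[OF this] show ?thesis by simp
qed

lemma represents_change_charts_derivative:
  assumes A: "smooth_atlas A" "(U, c) \<in> A" "(U1, c1) \<in> A" and B: "smooth_atlas B" "(V, d) \<in> B" "(V1, d1) \<in> B"
    and rep: "represents (U, c) (V, d) f S g" and x: "x \<in> U" "x \<in> U1" "c x \<in> S" "f x \<in> V1"
  shows "fderiv (d1 \<circ> f \<circ> inv_into U1 c1) (c1 x) =
    (\<lambda>v. fderiv (d1 \<circ> inv_into V d) (g (c x)) (fderiv g (c x)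
        (fderiv (c \<circ> inv_into U1 c1) (c1 x) v)))"
proof -
  let ?a = "c \<circ> inv_into U1 c1" and ?b = "d1 \<circ> inv_into V d"
  note a = smooth_atlasD[OF A(1,3,2)] and b = smooth_atlasD[OF B(1,2,3)]
  obtain S1 where S1: "represents (U1, c1) (V1, d1) f S1 (\<lambda>e. ?b (g (?a e)))" "c1 x \<in> S1"
    using represents_change_charts[OF assms] .
  have fx: "f x \<in> V" "d (f x) = g (c x)" using rep x A unfolding represents_def by force+
  have "(?a has_derivative fderiv ?a (c1 x)) (at (c1 x))"
    by (rule smooth_on_has_derivative[OF a(4)]) (use x in auto)
  moreover have "(g has_derivative fderiv g (c x)) (at (?a (c1 x)))"
    using rep x A unfolding represents_def by (auto intro: smooth_on_has_derivative)
  ultimately have "((\<lambda>e. g (?a e)) has_derivative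
      (\<lambda>v. fderiv g (c x) (fderiv ?a (c1 x) v))) (at (c1 x))"
    by (rule has_derivative_compose)
  moreover have "(?b has_derivative fderiv ?b (g (c x))) (at (g (?a (c1 x))))"
  proof -
    have "d (f x) \<in> d ` (V \<inter> V1)" using fx(1) x(4) by blast
    then show ?thesis
      using smooth_on_has_derivative[OF b(4), of "g (c x)"] chart_inverse(1)[OF A(1,3) x(2)] by (simp add: fx(2))
  qed
  ultimately have "((\<lambda>e. ?b (g (?a e))) has_derivative (\<lambda>v. fderiv ?b (g (c x))
      (fderiv g (c x) (fderiv ?a (c1 x) v)))) (at (c1 x))"
    by (rule has_derivative_compose)
  from frechet_derivative_at[OF this] represents_derivative[OF S1] show ?thesis by simp
qed

lemma smooth_map_locally:
  assumes A: "smooth_atlas A" and B: "smooth_atlas B"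
    and loc: "\<And>x. x \<in> carrier_of A \<Longrightarrow> \<exists>U c V d S g. (U, c) \<in> A \<and> (V, d) \<in> B \<and> x \<in> U \<and> c x \<in> S \<and>
      represents (U, c) (V, d) f S g"
  shows "smooth_map A B f"
  unfolding smooth_map_def
proof (intro conjI subsetI, goal_cases)
  case (1 y)
  then obtain x where "x \<in> carrier_of A" "y = f x" by auto
  moreover from loc[OF this(1)] obtain U c V d S g where "(U, c) \<in> A" "(V, d) \<in> B" "x \<in> U" "c x \<in> S"
      "represents (U, c) (V, d) f S g" by auto
  ultimately show ?case using chart_inverse(1)[OF A, of U c x]
    by (auto simp: represents_def intro!: carrier_ofI)
next
  case 2
  have "open (c1 ` (U1 \<inter> f -` V1)) \<and> smooth_on (c1 ` (U1 \<inter> f -` V1)) (d1 \<circ> f \<circ> inv_into U1 c1)"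
    if 1: "(U1, c1) \<in> A" "(V1, d1) \<in> B" for U1 c1 V1 d1
  proof -
    let ?O = "c1 ` (U1 \<inter> f -` V1)"
    have *: "\<exists>N. open N \<and> e \<in> N \<and> N \<subseteq> ?O \<and> smooth_on N (d1 \<circ> f \<circ> inv_into U1 c1)" if e: "e \<in> ?O" for e
    proof -
      obtain x where x: "x \<in> U1" "f x \<in> V1" "e = c1 x" using e by auto
      with loc[OF carrier_ofI[OF 1(1)]] obtain U c V d S g where "(U, c) \<in> A" "(V, d) \<in> B" "x \<in> U" "c x \<in> S"
        "represents (U, c) (V, d) f S g" by metis
      then obtain S1 g1 where S1: "represents (U1, c1) (V1, d1) f S1 g1" "c1 x \<in> S1"
        using represents_change_charts[OF A _ 1(1) B _ 1(2)] x by metis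
      have "S1 \<subseteq> ?O"
      proof
        fix e assume "e \<in> S1"
        then have "f (inv_into U1 c1 e) \<in> V1" "e \<in> c1 ` U1" using S1(1) unfolding represents_def by auto
        then show "e \<in> ?O" using chart_inverse[OF A 1(1)] by (metis IntI image_eqI vimageI)
      qed
      moreover have "smooth_on S1 (d1 \<circ> f \<circ> inv_into U1 c1)"
        by (rule smooth_on_cong[of S1 g1]) (use S1 in \<open>auto simp: represents_def\<close>)
      ultimately show ?thesis using S1 x unfolding represents_def by auto
    qed
    show ?thesis
    proof
      show "open ?O" by (subst open_subopen) (use * in blast)
      show "smooth_on ?O (d1 \<circ> f \<circ> inv_into U1 c1)" by (rule smooth_on_local) (use * in meson)
    qed
  qed
  then show ?case by blast
qed

lemma immersion_locally:
  assumes A: "smooth_atlas A" and B: "smooth_atlas B"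
    and loc: "\<And>x. x \<in> carrier_of A \<Longrightarrow> \<exists>U c V d S g. (U, c) \<in> A \<and> (V, d) \<in> B \<and> x \<in> U \<and> c x \<in> S \<and>
      represents (U, c) (V, d) f S g \<and> inj (fderiv g (c x))"
  shows "immersion A B f"
  unfolding immersion_def
proof
  show "smooth_map A B f" by (rule smooth_map_locally[OF A B]) (use loc in meson)
  have "inj (chart_derivative (U1, c1) d1 f x)"
    if 1: "(U1, c1) \<in> A" "(V1, d1) \<in> B" "x \<in> U1" "f x \<in> V1" for U1 c1 V1 d1 x
  proof -
    from loc[OF carrier_ofI[OF 1(1,3)]] obtain U c V d S g where r: "(U, c) \<in> A" "(V, d) \<in> B" "x \<in> U" "c x \<in> S"
        "represents (U, c) (V, d) f S g" and inj: "inj (fderiv g (c x))" by metis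
    have fx: "f x \<in> V" "d (f x) = g (c x)" using r A unfolding represents_def by force+
    have "inj (fderiv (c \<circ> inv_into U1 c1) (c1 x))"
      by (metis injI transition_derivative_inverse[OF A 1(1) r(1) 1(3) r(3)])
    moreover have "inj (fderiv (d1 \<circ> inv_into V d) (g (c x)))"
      using transition_derivative_inverse[OF B r(2) 1(2) fx(1) 1(4)] fx by (metis injI)
    ultimately show ?thesis
      unfolding chart_derivative_def prod.case represents_change_charts_derivative[OF A r(1) 1(1) B r(2) 1(2) r(5) r(3) 1(3) r(4) 1(4)]
      using inj_compose[OF _ inj_compose[OF inj]] by (simp add: o_def)
  qed
  then show "\<forall>(U, c)\<in>A. \<forall>(V, d)\<in>B. \<forall>x\<in>U. f x \<in> V \<longrightarrow> inj (chart_derivative (U, c) d f x)"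
    by blast
qed


subsection \<open>Topology of a manifold\<close>

lemma topspace_atlas_topology: "topspace (atlas_topology A) = carrier_of A"
proof -
  have "\<Union>{U \<inter> c -` V |U c V. (U, c) \<in> A \<and> open V} = carrier_of A" (is "\<Union>?B = _")
  proof (intro subset_antisym subsetI)
    fix x assume "x \<in> carrier_of A"
    then obtain U c where "(U, c) \<in> A" "x \<in> U" by (rule carrier_ofE)
    then have "U \<inter> c -` UNIV \<in> ?B" "x \<in> U \<inter> c -` UNIV" using open_UNIV by blast+
    then show "x \<in> \<Union>?B" by (rule UnionI)
  next
    fix x assume "x \<in> \<Union>?B"
    then obtain U c where "(U, c) \<in> A" "x \<in> U" by blast
    then show "x \<in> carrier_of A" by (rule carrier_ofI)
  qed
  then show ?thesis unfolding atlas_topology_def by (simp add: topology_generated_by_topspace)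
qed

lemma openin_atlas_topology_chart: "(U, c) \<in> A \<Longrightarrow> open S \<Longrightarrow> openin (atlas_topology A) (U \<inter> c -` S)"
  unfolding atlas_topology_def by (rule topology_generated_by_Basis) blast

lemma openin_atlas_topology_domain: "(U, c) \<in> A \<Longrightarrow> openin (atlas_topology A) U"
  using openin_atlas_topology_chart[of U c A UNIV] by simp

text \<open>Only generating sets have to be tested, and their preimages are preimages of open sets
  under transition maps.\<close>

lemma continuous_map_chart_inverse:
  assumes A: "smooth_atlas A" "(U, c) \<in> A"
  shows "continuous_map (top_of_set (c ` U)) (atlas_topology A) (inv_into U c)"
  unfolding atlas_topology_def
proof (rule continuous_on_generated_topo, goal_cases)
  case (1 W)
  then obtain V d S where W: "W = V \<inter> d -` S" "(V, d) \<in> A" "open S" by auto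
  have "inv_into U c -` W \<inter> topspace (top_of_set (c ` U)) = c ` (U \<inter> V) \<inter> (d \<circ> inv_into U c) -` S"
    using A by (auto simp: W)
  moreover have "open (c ` (U \<inter> V) \<inter> (d \<circ> inv_into U c) -` S)"
    using smooth_atlasD[OF A W(2)] W(3) by (intro continuous_open_preimage smooth_on_continuous_on)
  ultimately show ?case by (simp add: openin_open_eq smooth_atlasD(2)[OF A A(2)]) (auto)
next
  case 2
  have "U \<inter> c -` UNIV \<in> {U \<inter> c -` V |U c V. (U, c) \<in> A \<and> open V}" using A open_UNIV by blast
  moreover have "inv_into U c ` topspace (top_of_set (c ` U)) \<subseteq> U \<inter> c -` UNIV" using A by auto
  ultimately show ?case by blast
qed

lemma open_chart_image:
  assumes A: "smooth_atlas A" "(U, c) \<in> A" and W: "openin (atlas_topology A) W"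
  shows "open (c ` (U \<inter> W))"
proof -
  have "openin (top_of_set (c ` U)) {e \<in> topspace (top_of_set (c ` U)). inv_into U c e \<in> W}"
    using openin_continuous_map_preimage[OF continuous_map_chart_inverse[OF A] W] .
  moreover have "{e \<in> topspace (top_of_set (c ` U)). inv_into U c e \<in> W} = c ` (U \<inter> W)"
    using A by auto
  ultimately show ?thesis using openin_open_trans smooth_atlasD(2)[OF A A(2)] by metis
qed

text \<open>Here the Hausdorff property enters. It permits extending a function with compact support
  in a chart by 0, and it gives points outside a chart a neighbourhood untouched by the zigzags of
  that chart.\<close>

lemma closedin_chart_image_compact:
  assumes A: "smooth_atlas A" "(U, c) \<in> A" and "Hausdorff_space (atlas_topology A)"
    and K: "compact K" "K \<subseteq> c ` U"
  shows "closedin (atlas_topology A) (inv_into U c ` K)"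
proof -
  have "compactin (top_of_set (c ` U)) K" using K by (simp add: compactin_subtopology)
  from image_compactin[OF this continuous_map_chart_inverse[OF A]] show ?thesis
    using assms(3) compactin_imp_closedin by blast
qed

section \<open>Global smooth functions and extension by zero\<close>

definition smooth_function :: "('a, 'e::euclidean_space) atlas \<Rightarrow> ('a \<Rightarrow> real) \<Rightarrow> bool" where
  "smooth_function A f \<longleftrightarrow> (\<forall>(U, c)\<in>A. smooth_on (c ` U) (f \<circ> inv_into U c))"

lemma smooth_functionD: "smooth_function A f \<Longrightarrow> (U, c) \<in> A \<Longrightarrow> smooth_on (c ` U) (f \<circ> inv_into U c)"
  unfolding smooth_function_def by blast

lemma smooth_function_extend_by_0:
  assumes A: "smooth_atlas A" "(U, c) \<in> A" and H: "Hausdorff_space (atlas_topology A)"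
    and F: "smooth_on UNIV F" and K: "compact K" "K \<subseteq> c ` U" "\<And>e. e \<notin> K \<Longrightarrow> F e = 0"
  shows "smooth_function A (\<lambda>x. if x \<in> U then F (c x) else 0)" (is "smooth_function A ?f")
  unfolding smooth_function_def
proof (clarify, rule smooth_on_local)
  fix V d e assume V: "(V, d) \<in> A" and "e \<in> d ` V"
  then obtain x where x: "x \<in> V" "e = d x" by auto
  note t = smooth_atlasD[OF A(1) V A(2)]
  show "\<exists>N. open N \<and> e \<in> N \<and> smooth_on N (?f \<circ> inv_into V d)"
  proof (cases "x \<in> U")
    case True
    have "smooth_on (d ` (V \<inter> U)) (\<lambda>e. F ((c \<circ> inv_into V d) e))"
      by (rule smooth_on_compose_UNIV[OF F t(3) t(4)])
    then have "smooth_on (d ` (V \<inter> U)) (?f \<circ> inv_into V d)"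
      by (rule smooth_on_cong[OF t(3), rotated]) (use A V in auto)
    then show ?thesis using True x t(3) by blast
  next
    case False
    let ?W = "carrier_of A - inv_into U c ` K"
    have "openin (atlas_topology A) ?W"
      using closedin_chart_image_compact[OF A H K(1,2)] by (simp add: closedin_def topspace_atlas_topology)
    then have op: "open (d ` (V \<inter> ?W))" by (rule open_chart_image[OF A(1) V])
    have "smooth_on (d ` (V \<inter> ?W)) (?f \<circ> inv_into V d)"
    proof (rule smooth_on_cong[OF op _ smooth_on_const[of _ 0]])
      fix e assume "e \<in> d ` (V \<inter> ?W)"
      then obtain y where y: "y \<in> V" "y \<notin> inv_into U c ` K" "e = d y" by auto
      then have "?f y = 0" using K(3) A by (metis chart_inverse(1) imageI)
      then show "0 = (?f \<circ> inv_into V d) e"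
        by (simp only: comp_apply y(3) chart_inverse(1)[OF A(1) V y(1)])
    qed
    moreover have "x \<in> ?W"
      using False x V K(2) A by (auto intro: carrier_ofI)
    ultimately show ?thesis using op x by blast
  qed
qed

section \<open>Jet coordinates\<close>

abbreviation jets_over :: "('a, real^'n) atlas \<Rightarrow> 'a set \<Rightarrow> 'a jet set" where
  "jets_over A U \<equiv> {j \<in> J1 A. fst j \<in> U}"

lemma vec_lambda_eq_sum_axis: "(\<chi> i. f i) = (\<Sum>i\<in>UNIV. f i *\<^sub>R axis i (1::real))"
  by (simp add: vec_eq_iff axis_def if_distrib cong: if_cong)

lemma smooth_on_vec_lambda:
  assumes "open S" "\<And>i. smooth_on S (\<lambda>x. f x i)"
  shows "smooth_on S (\<lambda>x. (\<chi> i. f x i) :: real^'n)"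
  unfolding vec_lambda_eq_sum_axis by (intro smooth_on_intros assms)

lemma inner_vec_lambda_linear:
  fixes L :: "real^'n \<Rightarrow> real"
  assumes "linear L"
  shows "(\<chi> i. L (axis i 1)) \<bullet> v = L v"
proof -
  have "L v = L (\<Sum>i\<in>UNIV. v $ i *\<^sub>R axis i 1)" using vec_lambda_eq_sum_axis[of "\<lambda>i. v $ i"] by simp
  also have "\<dots> = (\<Sum>i\<in>UNIV. v $ i * L (axis i 1))" using assms by (simp add: linear_sum linear_scale)
  finally show ?thesis by (simp add: inner_vec_def mult.commute)
qed

lemma smooth_nearI:
  assumes A: "smooth_atlas A" "(U, c) \<in> A" and S: "open S" "smooth_on S F" and x: "x \<in> U" "c x \<in> S"
    and f: "\<And>y. y \<in> U \<Longrightarrow> c y \<in> S \<Longrightarrow> f y = F (c y)"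
  shows "smooth_near A x f"
  unfolding smooth_near_def
proof (intro exI conjI)
  let ?W = "U \<inter> c -` S"
  show W: "openin (atlas_topology A) ?W" by (rule openin_atlas_topology_chart[OF A(2) S(1)])
  show "x \<in> ?W" using x by simp
  show "\<forall>(V, d)\<in>A. smooth_on (d ` (V \<inter> ?W)) (f \<circ> inv_into V d)"
  proof clarify
    fix V d assume V: "(V, d) \<in> A"
    note t = smooth_atlasD[OF A(1) V A(2)]
    have op: "open (d ` (V \<inter> ?W))" by (rule open_chart_image[OF A(1) V W])
    have "smooth_on (d ` (V \<inter> ?W)) (\<lambda>e. F ((c \<circ> inv_into V d) e))"
      by (rule smooth_on_compose[OF op S(1) _ smooth_on_subset[OF t(4)] S(2)])
         (auto simp: chart_inverse[OF A(1) V])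
    then show "smooth_on (d ` (V \<inter> ?W)) (f \<circ> inv_into V d)"
      by (rule smooth_on_cong[OF op, rotated]) (auto simp: chart_inverse[OF A(1) V] f)
  qed
qed

lemma smooth_near_coordinates:
  assumes A: "smooth_atlas A" "(U, c) \<in> A" and f: "smooth_near A x f" and x: "x \<in> U"
  obtains S where "open S" "c x \<in> S" "S \<subseteq> c ` U" "smooth_on S (f \<circ> inv_into U c)"
proof -
  from f[unfolded smooth_near_def] obtain W where W: "openin (atlas_topology A) W" "x \<in> W"
    "\<forall>(U, c)\<in>A. smooth_on (c ` (U \<inter> W)) (f \<circ> inv_into U c)"
    by (elim exE conjE)
  from W(3) A(2) have "smooth_on (c ` (U \<inter> W)) (f \<circ> inv_into U c)" by blast
  then show ?thesis
    using that[OF open_chart_image[OF A W(1)]] W(2) x by blast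
qed

lemma frechet_derivative_change_chart:
  assumes A: "smooth_atlas A" "(U, c) \<in> A" "(V, d) \<in> A" and f: "smooth_near A x f" and x: "x \<in> U" "x \<in> V"
  shows "fderiv (f \<circ> inv_into V d) (d x) =
    (\<lambda>v. fderiv (f \<circ> inv_into U c) (c x) (fderiv (c \<circ> inv_into V d) (d x) v))"
proof -
  note t = smooth_atlasD[OF A(1,3,2)]
  obtain S where S: "open S" "c x \<in> S" "smooth_on S (f \<circ> inv_into U c)"
    using smooth_near_coordinates[OF A(1,2) f x(1)] by metis
  have "((c \<circ> inv_into V d) has_derivative fderiv (c \<circ> inv_into V d) (d x)) (at (d x))"
    by (rule smooth_on_has_derivative[OF t(4)]) (use x in auto)
  moreover have "((f \<circ> inv_into U c) has_derivative fderiv (f \<circ> inv_into U c) (c x))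
      (at ((c \<circ> inv_into V d) (d x)))"
    using smooth_on_has_derivative[OF S(3,2)] by (simp add: chart_inverse[OF A(1,3)] x)
  ultimately have "((\<lambda>e. (f \<circ> inv_into U c) ((c \<circ> inv_into V d) e)) has_derivative
    (\<lambda>v. fderiv (f \<circ> inv_into U c) (c x) (fderiv (c \<circ> inv_into V d) (d x) v))) (at (d x))"
    by (rule has_derivative_compose)
  then have "((f \<circ> inv_into V d) has_derivative
    (\<lambda>v. fderiv (f \<circ> inv_into U c) (c x) (fderiv (c \<circ> inv_into V d) (d x) v))) (at (d x))"
    by (rule has_derivative_transform_within_open[OF _ t(3)])
       (use x in \<open>auto simp: chart_inverse[OF A(1,2)] chart_inverse[OF A(1,3)]\<close>)
  from frechet_derivative_at[OF this] show ?thesis by (rule sym)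
qed

text \<open>By the chain rule, equal differentials in one chart are equal in all charts.\<close>

lemma same_1jetI:
  assumes A: "smooth_atlas A" "(U, c) \<in> A" and fg: "smooth_near A x f" "smooth_near A x g" and x: "x \<in> U"
    and eq: "f x = g x" "fderiv (f \<circ> inv_into U c) (c x) = fderiv (g \<circ> inv_into U c) (c x)"
  shows "same_1jet A x f g"
proof -
  have "chart_derivative (V, d) id f x = chart_derivative (V, d) id g x" if "(V, d) \<in> A" "x \<in> V" for V d
    using frechet_derivative_change_chart[OF A that(1) fg(1) x that(2)]
      frechet_derivative_change_chart[OF A that(1) fg(2) x that(2)] eq(2)
    by (simp add: chart_derivative_def)
  then show ?thesis using eq(1) unfolding same_1jet_def by blast
qed

lemma jet1_eqI: "same_1jet A x f g \<Longrightarrow> jet1 A x f = jet1 A x g"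
proof -
  assume fg: "same_1jet A x f g"
  have "same_1jet A x f h = same_1jet A x g h" for h
    using fg unfolding same_1jet_def split_beta by metis
  then show ?thesis unfolding jet1_def by simp
qed

lemma same_1jet_locally_eq:
  assumes A: "smooth_atlas A" and W: "openin (atlas_topology A) W" "x \<in> W" "\<And>y. y \<in> W \<Longrightarrow> f y = g y"
  shows "same_1jet A x f g"
proof -
  have "chart_derivative (U, c) id f x = chart_derivative (U, c) id g x" if U: "(U, c) \<in> A" "x \<in> U" for U c
  proof -
    have op: "open (c ` (U \<inter> W))" by (rule open_chart_image[OF A U(1) W(1)])
    have "((f \<circ> inv_into U c) has_derivative D) (at (c x)) \<longleftrightarrow> ((g \<circ> inv_into U c) has_derivative D) (at (c x))" for D
    proof
      show "((g \<circ> inv_into U c) has_derivative D) (at (c x))" if "((f \<circ> inv_into U c) has_derivative D) (at (c x))"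
        by (rule has_derivative_transform_within_open[OF that op]) (use U W in \<open>auto simp: chart_inverse[OF A U(1)]\<close>)
      show "((f \<circ> inv_into U c) has_derivative D) (at (c x))" if "((g \<circ> inv_into U c) has_derivative D) (at (c x))"
        by (rule has_derivative_transform_within_open[OF that op]) (use U W in \<open>auto simp: chart_inverse[OF A U(1)]\<close>)
    qed
    then show ?thesis by (simp add: chart_derivative_def frechet_derivative_def)
  qed
  then show ?thesis using W unfolding same_1jet_def by blast
qed

lemma J1E:
  assumes "j \<in> J1 A"
  obtains x f where "j = jet1 A x f" "x \<in> carrier_of A" "smooth_near A x f"
  using assms unfolding J1_def by blast

lemma fst_jet1 [simp]: "fst (jet1 A x f) = x"
  by (simp add: jet1_def)

text \<open>The subset \<open>T\<close> is there for the overlaps of two jet charts.\<close>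

lemma jet_coords_image:
  fixes A :: "('a, real^'n) atlas"
  assumes A: "smooth_atlas A" "(U, c) \<in> A" and T: "T \<subseteq> U"
  shows "jet_coords (U, c) ` jets_over A T = c ` T \<times> UNIV"
proof (intro subset_antisym subsetI)
  fix w assume "w \<in> jet_coords (U, c) ` jets_over A T"
  then obtain j where j: "j \<in> J1 A" "fst j \<in> T" "w = jet_coords (U, c) j" by blast
  obtain x f where f: "j = jet1 A x f" "smooth_near A x f" using J1E[OF j(1)] .
  then have "x \<in> T" using j by simp
  then show "w \<in> c ` T \<times> UNIV"
    unfolding j f jet_coords_jet1[OF A(2) subsetD[OF T \<open>x \<in> T\<close>] f(2)] by simp
next
  fix w :: "(real^'n) \<times> (real^'n) \<times> real" assume "w \<in> c ` T \<times> UNIV"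
  then obtain x p z where w: "x \<in> T" "w = (c x, p, z)" by auto
  then have x: "x \<in> U" using T by auto
  \<comment> \<open>The affine function in the chart with value \<open>z\<close> and gradient
    \<open>p\<close> at the given point has the required jet.\<close>
  let ?F = "\<lambda>e. z + p \<bullet> (e - c x)"
  have sF: "smooth_on UNIV ?F" by (intro smooth_on_intros open_UNIV)
  have sn: "smooth_near A x (\<lambda>y. ?F (c y))"
    by (rule smooth_nearI[OF A open_UNIV sF x]) auto
  have "(?F has_derivative (\<lambda>v. p \<bullet> v)) (at (c x))" by (auto intro!: derivative_eq_intros)
  then have "(((\<lambda>y. ?F (c y)) \<circ> inv_into U c) has_derivative (\<lambda>v. p \<bullet> v)) (at (c x))"
    by (rule has_derivative_transform_within_open[OF _ smooth_atlasD(2)[OF A A(2)]])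
       (use x in \<open>auto simp: chart_inverse[OF A]\<close>)
  note D = frechet_derivative_at[OF this, symmetric]
  have "jet_coords (U, c) (jet1 A x (\<lambda>y. ?F (c y))) = w"
    unfolding jet_coords_jet1[OF A(2) x sn] D w(2) by (simp add: inner_axis vec_eq_iff)
  moreover have "jet1 A x (\<lambda>y. ?F (c y)) \<in> J1 A"
    unfolding J1_def using sn carrier_ofI[OF A(2) x] by blast
  ultimately show "w \<in> jet_coords (U, c) ` jets_over A T"
    using w by (intro image_eqI[of _ _ "jet1 A x (\<lambda>y. ?F (c y))"]) auto
qed

lemma inj_on_jet_coords:
  assumes A: "smooth_atlas A" "(U, c) \<in> A"
  shows "inj_on (jet_coords (U, c)) (jets_over A U)"
proof (rule inj_onI, clarsimp)
  fix x F y G assume F: "(x, F) \<in> J1 A" "x \<in> U" and G: "(y, G) \<in> J1 A" "y \<in> U"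
    and eq: "jet_coords (U, c) (x, F) = jet_coords (U, c) (y, G)"
  obtain f g where f: "(x, F) = jet1 A x f" "smooth_near A x f" and g: "(y, G) = jet1 A y g" "smooth_near A y g"
    by (metis J1E[OF F(1)] J1E[OF G(1)] fst_conv fst_jet1)
  have "c x = c y" "f x = g y" and D: "fderiv (f \<circ> inv_into U c) (c x) (axis i 1) =
      fderiv (g \<circ> inv_into U c) (c y) (axis i 1)" for i
    using eq unfolding f g jet_coords_jet1[OF A(2) F(2) f(2)] jet_coords_jet1[OF A(2) G(2) g(2)]
    by (auto simp: vec_eq_iff)
  then have xy: "x = y" using smooth_atlasD(1)[OF A A(2)] F G by (auto dest: inj_onD)
  have lin: "linear (fderiv (h \<circ> inv_into U c) (c x))" if "smooth_near A x h" for h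
    using smooth_near_coordinates[OF A that F(2)] smooth_on_has_derivative has_derivative_linear by metis
  have "fderiv (f \<circ> inv_into U c) (c x) = fderiv (g \<circ> inv_into U c) (c x)"
  proof
    fix v show "fderiv (f \<circ> inv_into U c) (c x) v = fderiv (g \<circ> inv_into U c) (c x) v"
      using inner_vec_lambda_linear[OF lin[OF f(2)], of v] inner_vec_lambda_linear[OF lin[of g], of v] g(2) D xy by simp
  qed
  then have "same_1jet A x f g" using same_1jetI[OF A f(2) _ F(2)] g(2) xy \<open>f x = g y\<close> by simp
  then show "x = y \<and> F = G" using jet1_eqI f g xy by (metis prod.inject)
qed

lemma jet_coords_inverse:
  assumes A: "smooth_atlas A" "(U, c) \<in> A" and j: "j \<in> J1 A" "fst j \<in> U"
  shows "inv_into (jets_over A U) (jet_coords (U, c)) (jet_coords (U, c) j) = j"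
  using inv_into_f_f[OF inj_on_jet_coords[OF A]] j by simp

text \<open>Covectors transform by the inverse transpose, which is why \<open>p\<close> is paired
  with the derivative of the reverse coordinate change.\<close>

definition jet_transition :: "('a, real^'n) chart \<Rightarrow> ('a, real^'n) chart \<Rightarrow>
    (real^'n) \<times> (real^'n) \<times> real \<Rightarrow> (real^'n) \<times> (real^'n) \<times> real" where
  "jet_transition = (\<lambda>(U, c) (V, d) (q, p, z). ((d \<circ> inv_into U c) q,
     \<chi> i. p \<bullet> fderiv (c \<circ> inv_into V d) ((d \<circ> inv_into U c) q) (axis i 1), z))"

lemma jet_coords_transition:
  assumes A: "smooth_atlas A" "(U, c) \<in> A" "(V, d) \<in> A" and j: "j \<in> J1 A" "fst j \<in> U" "fst j \<in> V"
  shows "jet_coords (V, d) j = jet_transition (U, c) (V, d) (jet_coords (U, c) j)"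
proof -
  obtain x f where jx: "j = jet1 A x f" "smooth_near A x f" and x: "x \<in> U" "x \<in> V"
    using J1E[OF j(1)] j by (metis fst_jet1)
  obtain S where S: "open S" "c x \<in> S" "smooth_on S (f \<circ> inv_into U c)"
    using smooth_near_coordinates[OF A(1,2) jx(2) x(1)] by metis
  have lin: "linear (fderiv (f \<circ> inv_into U c) (c x))"
    using has_derivative_linear[OF smooth_on_has_derivative[OF S(3,2)]] .
  show ?thesis
    unfolding jx(1) jet_coords_jet1[OF A(2) x(1) jx(2)] jet_coords_jet1[OF A(3) x(2) jx(2)] jet_transition_def
    by (simp add: chart_inverse[OF A(1,2) ] x frechet_derivative_change_chart[OF A jx(2) x] inner_vec_lambda_linear[OF lin])
qed

lemma smooth_on_jet_transition:
  assumes A: "smooth_atlas A" "(U, c) \<in> A" "(V, d) \<in> A"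
  shows "smooth_on (c ` (U \<inter> V) \<times> UNIV) (jet_transition (U, c) (V, d))"
proof -
  let ?a = "d \<circ> inv_into U c" and ?b = "c \<circ> inv_into V d" and ?O = "c ` (U \<inter> V) \<times> UNIV"
  note a = smooth_atlasD[OF A] and b = smooth_atlasD[OF A(1,3,2)]
  have op: "open ?O" using a(3) by (simp add: open_Times)
  have s1: "smooth_on ?O (\<lambda>w. ?a (fst w))"
    by (rule smooth_on_compose[OF op a(3) _ _ a(4)]) (auto intro!: smooth_on_intros op)
  have s2: "smooth_on ?O (\<lambda>w. fderiv ?b (?a (fst w)) v)" for v
    by (rule smooth_on_compose[OF op b(3) _ s1 smooth_on_frechet_derivative[OF b(4)]])
       (auto simp: chart_inverse[OF A(1,2)])
  have "smooth_on ?O (\<lambda>w. (?a (fst w), \<chi> i. fst (snd w) \<bullet> fderiv ?b (?a (fst w)) (axis i 1), snd (snd w)))"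
    by (intro smooth_on_Pair smooth_on_vec_lambda s1 op smooth_on_inner s2 smooth_on_fst smooth_on_snd smooth_on_ident)
  then show ?thesis by (simp add: jet_transition_def case_prod_beta')
qed

lemma jet_atlasI: "(U, c) \<in> A \<Longrightarrow> (jets_over A U, jet_coords (U, c)) \<in> jet_atlas A"
  unfolding jet_atlas_def by force

lemma jet_atlasE:
  assumes "(V', d') \<in> jet_atlas A"
  obtains V d where "(V, d) \<in> A" "V' = jets_over A V" "d' = jet_coords (V, d)"
  using assms unfolding jet_atlas_def by auto

lemma smooth_atlas_jet_atlas:
  assumes A: "smooth_atlas A"
  shows "smooth_atlas (jet_atlas A)"
proof -
  have 1: "inj_on (jet_coords (U, c)) (jets_over A U)" "open (jet_coords (U, c) ` jets_over A U)"
    if U: "(U, c) \<in> A" for U c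
    using inj_on_jet_coords[OF A U] jet_coords_image[OF A U order_refl] smooth_atlasD(2)[OF A U U]
    by (auto simp: open_Times)
  have 2: "open (jet_coords (U, c) ` (jets_over A U \<inter> jets_over A V))"
    "smooth_on (jet_coords (U, c) ` (jets_over A U \<inter> jets_over A V))
      (jet_coords (V, d) \<circ> inv_into (jets_over A U) (jet_coords (U, c)))"
    if U: "(U, c) \<in> A" "(V, d) \<in> A" for U c V d
  proof -
    have eq: "jets_over A U \<inter> jets_over A V = {j \<in> J1 A. fst j \<in> U \<inter> V}" by auto
    have im: "jet_coords (U, c) ` {j \<in> J1 A. fst j \<in> U \<inter> V} = c ` (U \<inter> V) \<times> UNIV"
      by (rule jet_coords_image[OF A U(1)]) auto
    show op: "open (jet_coords (U, c) ` (jets_over A U \<inter> jets_over A V))"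
      unfolding eq im using smooth_atlasD(3)[OF A U] by (simp add: open_Times)
    show "smooth_on (jet_coords (U, c) ` (jets_over A U \<inter> jets_over A V))
      (jet_coords (V, d) \<circ> inv_into (jets_over A U) (jet_coords (U, c)))"
      by (rule smooth_on_cong[OF op _ smooth_on_jet_transition[OF A U, folded im, folded eq]])
         (auto simp: jet_coords_inverse[OF A U(1)] jet_coords_transition[OF A U])
  qed
  show ?thesis
    unfolding smooth_atlas_def by (intro conjI; clarify; elim jet_atlasE; simp only: 1 2 simp_thms)
qed

text \<open>Jet transitions preserve \<alpha> exactly, not only up to a factor: \<open>z\<close>
  does not change, and in \<open>p \<bullet> dq\<close> the inverse transpose acting on
  \<open>p\<close> cancels the derivative acting on \<open>dq\<close>.\<close>

lemma contact_form_transition: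
  fixes A :: "('a, real^'n) atlas"
  assumes A: "smooth_atlas A" "(U, c) \<in> A" "(V, d) \<in> A" and j: "j \<in> J1 A" "fst j \<in> U" "fst j \<in> V"
  shows "contact_form (jet_coords (V, d) j)
    (fderiv (jet_coords (V, d) \<circ> inv_into (jets_over A U) (jet_coords (U, c))) (jet_coords (U, c) j) w) = contact_form (jet_coords (U, c) j) w"
proof -
  let ?a = "d \<circ> inv_into U c" and ?b = "c \<circ> inv_into V d"
  let ?T = "jet_coords (V, d) \<circ> inv_into (jets_over A U) (jet_coords (U, c))"
  let ?J = "jet_coords (U, c) j"
  note a = smooth_atlasD[OF A] and b = smooth_atlasD[OF A(1,3,2)]
  define q p z where "q = fst ?J" and "p = fst (snd ?J)" and "z = snd (snd ?J)"
  have J: "?J = (q, p, z)" by (simp add: q_def p_def z_def)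
  have O: "open (c ` (U \<inter> V) \<times> (UNIV :: ((real^'n) \<times> real) set))" using a(3) by (simp add: open_Times)
  have im: "jet_coords (U, c) ` {j \<in> J1 A. fst j \<in> U \<inter> V} = c ` (U \<inter> V) \<times> UNIV"
    by (rule jet_coords_image[OF A(1,2)]) auto
  have JO: "?J \<in> c ` (U \<inter> V) \<times> UNIV" unfolding im[symmetric] using j by auto
  then obtain x where x: "x \<in> U" "x \<in> V" "q = c x" using J by auto
  have T: "?T w = jet_transition (U, c) (V, d) w" if w: "w \<in> c ` (U \<inter> V) \<times> UNIV" for w
    using w unfolding im[symmetric] by (auto simp: jet_coords_inverse[OF A(1,2)] jet_coords_transition[OF A])
  have smT: "smooth_on (c ` (U \<inter> V) \<times> UNIV) ?T"
    by (rule smooth_on_cong[OF O _ smooth_on_jet_transition[OF A]]) (simp only: T)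
  let ?D = "fderiv ?T ?J"
  have dT: "(?T has_derivative ?D) (at ?J)" by (rule smooth_on_has_derivative[OF smT JO])
  have da: "(?a has_derivative fderiv ?a q) (at q)"
    by (rule smooth_on_has_derivative[OF a(4)]) (use x in auto)
  have db: "(?b has_derivative fderiv ?b (d x)) (at (d x))"
    by (rule smooth_on_has_derivative[OF b(4)]) (use x in auto)
  have "((\<lambda>w. ?a (fst w)) has_derivative (\<lambda>w. fderiv ?a q (fst w))) (at ?J)"
  proof (rule has_derivative_compose[OF has_derivative_fst[OF has_derivative_ident]])
    show "(?a has_derivative fderiv ?a q) (at (fst ?J))" using da J by simp
  qed
  then have d1: "((\<lambda>w. fst (?T w)) has_derivative (\<lambda>w. fderiv ?a q (fst w))) (at ?J)"
    by (rule has_derivative_transform_within_open[OF _ O JO])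
       (auto simp: T[unfolded comp_def] jet_transition_def)
  have 1: "fst (?D w) = fderiv ?a q (fst w)" for w
    using fun_cong[OF has_derivative_unique[OF has_derivative_fst[OF dT] d1]] .
  have "((\<lambda>w. snd (snd w)) has_derivative (\<lambda>w. snd (snd w))) (at ?J)"
    by (intro has_derivative_snd has_derivative_ident)
  then have d2: "((\<lambda>w. snd (snd (?T w))) has_derivative (\<lambda>w. snd (snd w))) (at ?J)"
    by (rule has_derivative_transform_within_open[OF _ O JO])
       (auto simp: T[unfolded comp_def] jet_transition_def)
  have 2: "snd (snd (?D w)) = snd (snd w)" for w
    using fun_cong[OF has_derivative_unique[OF has_derivative_snd[OF has_derivative_snd[OF dT]] d2]] .
  have aq: "?a q = d x" using x by (simp add: chart_inverse[OF A(1,2)])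
  have lin: "linear (\<lambda>v. p \<bullet> fderiv ?b (d x) v)"
    using has_derivative_linear[OF has_derivative_inner_right[OF db, of p]] .
  have "fst (snd (jet_coords (V, d) j)) = (\<chi> i. p \<bullet> fderiv ?b (d x) (axis i 1))"
    unfolding jet_coords_transition[OF A j] J jet_transition_def using aq by simp
  then have "fst (snd (jet_coords (V, d) j)) \<bullet> fst (?D w) = p \<bullet> fst w"
    unfolding 1 using inner_vec_lambda_linear[OF lin] transition_derivative_inverse[OF A x(1,2)] x(3) by simp
  then show ?thesis using 2[of w] unfolding contact_form_def J by (simp add: case_prod_beta')
qed

section \<open>Positive loops in local coordinates\<close>

lemma map_prod_image_times_UNIV: "map_prod c id ` (X \<times> UNIV) = c ` X \<times> UNIV"
  by (auto simp: map_prod_def image_iff)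

lemma times_line_chart_inverse:
  assumes A: "smooth_atlas A" "(U, c) \<in> A" and e: "e \<in> c ` U"
  shows "inv_into (U \<times> UNIV) (map_prod c id) (e, t) = (inv_into U c e, t)"
proof (rule inv_into_f_eq)
  show "inj_on (map_prod c id) (U \<times> UNIV)"
    by (rule map_prod_inj_on[OF smooth_atlasD(1)[OF A A(2)] inj_on_id])
qed (use e in \<open>simp_all add: chart_inverse[OF A]\<close>)

lemma smooth_atlas_times_line:
  assumes A: "smooth_atlas A"
  shows "smooth_atlas (times_line A)"
proof -
  have 1: "inj_on (map_prod c id) (U \<times> UNIV)" "open (map_prod c id ` (U \<times> (UNIV :: real set)))"
    if U: "(U, c) \<in> A" for U c
    using map_prod_inj_on[OF smooth_atlasD(1)[OF A U U] inj_on_id] smooth_atlasD(2)[OF A U U]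
    by (simp_all add: map_prod_image_times_UNIV open_Times)
  have 2: "open (map_prod c id ` ((U \<times> UNIV) \<inter> (V \<times> (UNIV :: real set))))"
    "smooth_on (map_prod c id ` ((U \<times> UNIV) \<inter> (V \<times> (UNIV :: real set))))
      (map_prod d id \<circ> inv_into (U \<times> UNIV) (map_prod c id))"
    if U: "(U, c) \<in> A" "(V, d) \<in> A" for U c V d
  proof -
    note t = smooth_atlasD[OF A U]
    have eq: "map_prod c id ` ((U \<times> UNIV) \<inter> (V \<times> (UNIV :: real set))) = c ` (U \<inter> V) \<times> UNIV"
      unfolding map_prod_image_times_UNIV[symmetric] by (rule arg_cong[of _ _ "image _"]) auto
    have op: "open (c ` (U \<inter> V) \<times> (UNIV :: real set))" using t(3) by (simp add: open_Times)
    show "open (map_prod c id ` ((U \<times> UNIV) \<inter> (V \<times> (UNIV :: real set))))" unfolding eq by (rule op)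
    have "smooth_on (c ` (U \<inter> V) \<times> (UNIV :: real set)) (\<lambda>w. (d \<circ> inv_into U c) (fst w))"
      by (rule smooth_on_compose[OF op t(3) _ _ t(4)]) (auto intro!: smooth_on_fst smooth_on_ident op)
    then have "smooth_on (c ` (U \<inter> V) \<times> (UNIV :: real set)) (\<lambda>w. ((d \<circ> inv_into U c) (fst w), snd w))"
      by (intro smooth_on_Pair smooth_on_snd smooth_on_ident op)
    then show "smooth_on (map_prod c id ` ((U \<times> UNIV) \<inter> (V \<times> (UNIV :: real set))))
      (map_prod d id \<circ> inv_into (U \<times> UNIV) (map_prod c id))"
      unfolding eq
    proof (rule smooth_on_cong[OF op, rotated])
      fix w :: "'b \<times> real" assume "w \<in> c ` (U \<inter> V) \<times> UNIV"
      then obtain x s where "x \<in> U" "w = (c x, s)" by auto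
      then show "((d \<circ> inv_into U c) (fst w), snd w) = (map_prod d id \<circ> inv_into (U \<times> UNIV) (map_prod c id)) w"
        using times_line_chart_inverse[OF A U(1), of "c x" s] by simp
    qed
  qed
  have E: P if "(U', c') \<in> times_line A"
    "\<And>U c. (U, c) \<in> A \<Longrightarrow> U' = U \<times> UNIV \<Longrightarrow> c' = map_prod c id \<Longrightarrow> P" for U' c' P
    using that unfolding times_line_def by auto
  show ?thesis
    unfolding smooth_atlas_def by (intro conjI; clarify; elim E; simp only: 1 2 simp_thms)
qed

lemma carrier_of_times_line: "carrier_of (times_line A) = carrier_of A \<times> UNIV"
  unfolding carrier_of_def times_line_def by auto

text \<open>By invariance of the contact form under jet transition maps, it is enough to know the loop in
  one chart around each point.\<close>

definition positive_at :: "('a, real^'n) atlas \<Rightarrow> (real \<Rightarrow> 'a \<Rightarrow> 'a jet) \<Rightarrow> 'a \<Rightarrow> real \<Rightarrow> bool" where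
  "positive_at A \<phi> x t \<longleftrightarrow> (\<exists>U c S J. (U, c) \<in> A \<and> x \<in> U \<and> (c x, t) \<in> S \<and> open S \<and> S \<subseteq> c ` U \<times> UNIV \<and>
     smooth_on S J \<and>
     (\<forall>(e, s)\<in>S. \<phi> s (inv_into U c e) \<in> J1 A \<and> fst (\<phi> s (inv_into U c e)) \<in> U \<and>
        jet_coords (U, c) (\<phi> s (inv_into U c e)) = J (e, s)) \<and>
     (\<forall>v. contact_form (J (c x, t)) (fderiv J (c x, t) (v, 0)) = 0) \<and>
     contact_form (J (c x, t)) (fderiv J (c x, t) (0, 1)) \<noteq> 0 \<and>
     inj (\<lambda>v. fderiv J (c x, t) (v, 0)))"

lemma positive_legendrian_loopI:
  fixes A :: "('a, real^'n) atlas"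
  assumes A: "smooth_atlas A"
    and loc: "\<And>x t. x \<in> carrier_of A \<Longrightarrow> positive_at A \<phi> x t"
    and per: "\<And>x t. x \<in> carrier_of A \<Longrightarrow> \<phi> (t + 1) x = \<phi> t x"
  shows "legendrian_loop A \<phi>" "positive_loop A \<phi>"
proof -
  note JA = smooth_atlas_jet_atlas[OF A] and LA = smooth_atlas_times_line[OF A]
  \<comment> \<open>One local formula \<open>J\<close> in space and time serves three purposes: it
    represents the whole map, each time slice and each path of a fixed point. The derivatives of
    slice and path are the partial derivatives of \<open>J\<close>.\<close>
  have main: "\<exists>U c S J. (U, c) \<in> A \<and> x \<in> U \<and> (c x, t) \<in> S \<and>
      represents (U \<times> UNIV, map_prod c id) (jets_over A U, jet_coords (U, c)) (\<lambda>(x, t). \<phi> t x) S J \<and>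
      represents (U, c) (jets_over A U, jet_coords (U, c)) (\<phi> t) {e. (e, t) \<in> S} (\<lambda>e. J (e, t)) \<and>
      fderiv (\<lambda>e. J (e, t)) (c x) = (\<lambda>v. fderiv J (c x, t) (v, 0)) \<and>
      ((\<lambda>s. J (c x, s)) has_vector_derivative fderiv J (c x, t) (0, 1)) (at t) \<and>
      \<phi> t x \<in> jets_over A U \<and> J (c x, t) = jet_coords (U, c) (\<phi> t x) \<and> (\<forall>s. (c x, s) \<in> S \<longrightarrow> \<phi> s x \<in> jets_over A U \<and> J (c x, s) = jet_coords (U, c) (\<phi> s x)) \<and>
     (\<forall>v. contact_form (J (c x, t)) (fderiv J (c x, t) (v, 0)) = 0) \<and>
     contact_form (J (c x, t)) (fderiv J (c x, t) (0, 1)) \<noteq> 0 \<and>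
     inj (\<lambda>v. fderiv J (c x, t) (v, 0)) \<and> open S"
    if x: "x \<in> carrier_of A" for x t
  proof -
    from loc[OF x, of t, unfolded positive_at_def] obtain U c S J where U: "(U, c) \<in> A" "x \<in> U" and S: "(c x, t) \<in> S" "open S" "S \<subseteq> c ` U \<times> UNIV"
      and J: "smooth_on S J" "\<forall>(e, s)\<in>S. \<phi> s (inv_into U c e) \<in> J1 A \<and> fst (\<phi> s (inv_into U c e)) \<in> U \<and>
        jet_coords (U, c) (\<phi> s (inv_into U c e)) = J (e, s)"
      and C: "\<forall>v. contact_form (J (c x, t)) (fderiv J (c x, t) (v, 0)) = 0"
       "contact_form (J (c x, t)) (fderiv J (c x, t) (0, 1)) \<noteq> 0"
       "inj (\<lambda>v. fderiv J (c x, t) (v, 0))"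
      by (elim exE conjE)
    have dJ: "(J has_derivative fderiv J (c x, t)) (at (c x, t))"
      by (rule smooth_on_has_derivative[OF J(1) S(1)])
    have J2: "\<phi> s (inv_into U c e) \<in> jets_over A U" "jet_coords (U, c) (\<phi> s (inv_into U c e)) = J (e, s)"
      if "(e, s) \<in> S" for e s using J(2) that by auto
    have R1: "represents (U \<times> UNIV, map_prod c id) (jets_over A U, jet_coords (U, c)) (\<lambda>(x, t). \<phi> t x) S J"
      unfolding represents_def prod.case
    proof (intro conjI ballI S(2) J(1))
      show "S \<subseteq> map_prod c id ` (U \<times> UNIV)" using S(3) by (simp add: map_prod_image_times_UNIV)
      fix w assume w: "w \<in> S"
      obtain e s where es: "w = (e, s)" by fastforce
      have "inv_into (U \<times> UNIV) (map_prod c id) w = (inv_into U c e, s)"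
        unfolding es by (rule times_line_chart_inverse[OF A U(1)]) (use S(3) w es in auto)
      then show "(case inv_into (U \<times> UNIV) (map_prod c id) w of (x, t) \<Rightarrow> \<phi> t x) \<in> jets_over A U"
        "jet_coords (U, c) (case inv_into (U \<times> UNIV) (map_prod c id) w of (x, t) \<Rightarrow> \<phi> t x) = J w"
        using J2[of e s] w es by simp_all
    qed
    have opt: "open {e. (e, t) \<in> S}"
      using open_vimage[OF S(2), of "\<lambda>e. (e, t)"] by (simp add: vimage_def continuous_on_Pair)
    have R2: "represents (U, c) (jets_over A U, jet_coords (U, c)) (\<phi> t) {e. (e, t) \<in> S} (\<lambda>e. J (e, t))"
      unfolding represents_def prod.case
    proof (intro conjI ballI opt)
      show "{e. (e, t) \<in> S} \<subseteq> c ` U" using S(3) by auto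
      show "smooth_on {e. (e, t) \<in> S} (\<lambda>e. J (e, t))"
        by (rule smooth_on_compose[OF opt S(2) _ _ J(1)]) (auto intro!: smooth_on_intros opt)
    qed (use J2 in auto)
    have "((\<lambda>e. (e, t)) has_derivative (\<lambda>v. (v, 0))) (at (c x))"
      by (rule has_derivative_Pair[OF has_derivative_ident has_derivative_const])
    from has_derivative_compose[OF this dJ]
    have D1: "fderiv (\<lambda>e. J (e, t)) (c x) = (\<lambda>v. fderiv J (c x, t) (v, 0))"
      by (rule frechet_derivative_at[symmetric])
    have "((\<lambda>s. (c x, s)) has_vector_derivative (0, 1)) (at t)"
      by (intro has_vector_derivative_Pair has_vector_derivative_const has_vector_derivative_id)
    from vector_derivative_diff_chain_within[OF this, of J "fderiv J (c x, t)"] dJ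
    have D2: "((\<lambda>s. J (c x, s)) has_vector_derivative fderiv J (c x, t) (0, 1)) (at t)"
      by (simp add: o_def has_derivative_at_withinI)
    have "\<forall>s. (c x, s) \<in> S \<longrightarrow> \<phi> s x \<in> jets_over A U \<and> J (c x, s) = jet_coords (U, c) (\<phi> s x)"
      using J2[of "c x"] chart_inverse(1)[OF A U] by (metis (no_types, lifting))
    then show ?thesis using U S R1 R2 D1 D2 C by (intro exI[of _ U] exI[of _ c] exI[of _ S] exI[of _ J]) simp
  qed
  have "smooth_map (times_line A) (jet_atlas A) (\<lambda>(x, t). \<phi> t x)"
  proof (rule smooth_map_locally[OF LA JA])
    fix w assume "w \<in> carrier_of (times_line A)"
    then obtain x t where w: "w = (x, t)" "x \<in> carrier_of A" unfolding carrier_of_times_line by auto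
    from main[OF w(2), of t] obtain U c S J where U: "(U, c) \<in> A" "x \<in> U" "(c x, t) \<in> S"
      "represents (U \<times> UNIV, map_prod c id) (jets_over A U, jet_coords (U, c)) (\<lambda>(x, t). \<phi> t x) S J"
      by (elim exE conjE)
    moreover have "(U \<times> UNIV, map_prod c id) \<in> times_line A" using U(1) unfolding times_line_def by force
    ultimately show "\<exists>U c V d S g. (U, c) \<in> times_line A \<and> (V, d) \<in> jet_atlas A \<and> w \<in> U \<and> c w \<in> S \<and>
       represents (U, c) (V, d) (\<lambda>(x, t). \<phi> t x) S g"
      using jet_atlasI[OF U(1)] w(1)
      by (intro exI[of _ "U \<times> UNIV"] exI[of _ "map_prod c id"] exI[of _ "jets_over A U"] exI[of _ "jet_coords (U, c)"] exI[of _ S] exI[of _ J])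
         simp
  qed
  moreover have "legendrian_immersion A (\<phi> t)" for t
    unfolding legendrian_immersion_def
  proof
    show "immersion A (jet_atlas A) (\<phi> t)"
    proof (rule immersion_locally[OF A JA])
      fix x assume x: "x \<in> carrier_of A"
      from main[OF x, of t] obtain U c S J where U: "(U, c) \<in> A" "x \<in> U" "(c x, t) \<in> S"
        "represents (U, c) (jets_over A U, jet_coords (U, c)) (\<phi> t) {e. (e, t) \<in> S} (\<lambda>e. J (e, t))"
        "fderiv (\<lambda>e. J (e, t)) (c x) = (\<lambda>v. fderiv J (c x, t) (v, 0))"
        "inj (\<lambda>v. fderiv J (c x, t) (v, 0))"
        by (elim exE conjE)
      then show "\<exists>U c V d S g. (U, c) \<in> A \<and> (V, d) \<in> jet_atlas A \<and> x \<in> U \<and> c x \<in> S \<and>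
        represents (U, c) (V, d) (\<phi> t) S g \<and> inj (fderiv g (c x))"
        using jet_atlasI[OF U(1)]
        by (intro exI[of _ U] exI[of _ c] exI[of _ "jets_over A U"] exI[of _ "jet_coords (U, c)"] exI[of _ "{e. (e, t) \<in> S}"] exI[of _ "\<lambda>e. J (e, t)"])
           simp
    qed
    have "contact_form (d1 (\<phi> t x)) (chart_derivative (U1, c1) d1 (\<phi> t) x v) = 0"
      if 1: "(U1, c1) \<in> A" "(V1, d1) \<in> jet_atlas A" "x \<in> U1" "\<phi> t x \<in> V1" for U1 c1 V1 d1 x v
    proof -
      from main[OF carrier_ofI[OF 1(1,3)], of t] obtain U c S J where U: "(U, c) \<in> A" "x \<in> U" "(c x, t) \<in> S"
        and R: "represents (U, c) (jets_over A U, jet_coords (U, c)) (\<phi> t) {e. (e, t) \<in> S} (\<lambda>e. J (e, t))"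
        and D: "fderiv (\<lambda>e. J (e, t)) (c x) = (\<lambda>v. fderiv J (c x, t) (v, 0))"
        and N: "\<phi> t x \<in> jets_over A U" "J (c x, t) = jet_coords (U, c) (\<phi> t x)"
        and C: "\<forall>v. contact_form (J (c x, t)) (fderiv J (c x, t) (v, 0)) = 0"
        by (elim exE conjE)
      obtain V d where V: "(V, d) \<in> A" "V1 = jets_over A V" "d1 = jet_coords (V, d)" using jet_atlasE[OF 1(2)] .
      have j: "\<phi> t x \<in> J1 A" "fst (\<phi> t x) \<in> U" "fst (\<phi> t x) \<in> V" using N 1 V by auto
      have cx: "c x \<in> {e. (e, t) \<in> S}" using U by simp
      show ?thesis
        unfolding chart_derivative_def prod.case
          represents_change_charts_derivative[OF A U(1) 1(1) JA jet_atlasI[OF U(1)] 1(2) R U(2) 1(3) cx 1(4)]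
        unfolding D N(2) V(3) contact_form_transition[OF A U(1) V(1) j]
        using C unfolding N(2) by blast
    qed
    then show "\<forall>(U, c)\<in>A. \<forall>(V, d)\<in>jet_atlas A. \<forall>x\<in>U. \<phi> t x \<in> V \<longrightarrow>
        (\<forall>v. contact_form (d (\<phi> t x)) (chart_derivative (U, c) d (\<phi> t) x v) = 0)"
      by blast
  qed
  ultimately show "legendrian_loop A \<phi>" unfolding legendrian_loop_def using per by blast
  have "contact_form (d1 (\<phi> t x)) (vector_derivative (\<lambda>s. d1 (\<phi> s x)) (at t)) \<noteq> 0"
    if 1: "x \<in> carrier_of A" "(V1, d1) \<in> jet_atlas A" "\<phi> t x \<in> V1" for x t V1 d1
  proof -
    from main[OF 1(1), of t] obtain U c S J where U: "(U, c) \<in> A" "x \<in> U" "(c x, t) \<in> S"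
      and D: "((\<lambda>s. J (c x, s)) has_vector_derivative fderiv J (c x, t) (0, 1)) (at t)"
      and N: "\<phi> t x \<in> jets_over A U" "J (c x, t) = jet_coords (U, c) (\<phi> t x)"
      and Ns: "\<forall>s. (c x, s) \<in> S \<longrightarrow> \<phi> s x \<in> jets_over A U \<and> J (c x, s) = jet_coords (U, c) (\<phi> s x)"
      and C: "contact_form (J (c x, t)) (fderiv J (c x, t) (0, 1)) \<noteq> 0"
      and S: "open S"
      by (elim exE conjE)
    obtain V d where V: "(V, d) \<in> A" "V1 = jets_over A V" "d1 = jet_coords (V, d)" using jet_atlasE[OF 1(2)] .
    have j: "\<phi> t x \<in> J1 A" "fst (\<phi> t x) \<in> U" "fst (\<phi> t x) \<in> V" using N 1 V by auto
    let ?T = "jet_coords (V, d) \<circ> inv_into (jets_over A U) (jet_coords (U, c))"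
    note T = smooth_atlasD[OF JA jet_atlasI[OF U(1)] jet_atlasI[OF V(1)]]
    have "(?T has_derivative fderiv ?T (J (c x, t))) (at (J (c x, t)))"
      by (rule smooth_on_has_derivative[OF T(4)]) (use N j in auto)
    from vector_derivative_diff_chain_within[OF D, of ?T] has_derivative_at_withinI[OF this]
    have "((\<lambda>s. ?T (J (c x, s))) has_vector_derivative
        fderiv ?T (J (c x, t)) (fderiv J (c x, t) (0, 1))) (at t)"
      by (simp add: o_def)
    moreover have "open {s. (c x, s) \<in> S}"
      using open_vimage[OF S, of "\<lambda>s. (c x, s)"] by (simp add: vimage_def continuous_on_Pair)
    ultimately have "((\<lambda>s. d1 (\<phi> s x)) has_vector_derivative
        fderiv ?T (J (c x, t)) (fderiv J (c x, t) (0, 1))) (at t)"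
      by (rule has_vector_derivative_transform_within_open)
         (use U Ns in \<open>auto simp: V(3) jet_coords_inverse[OF A U(1)]\<close>)
    then show ?thesis
      using C unfolding vector_derivative_at V(3) N(2)
      by (simp only: vector_derivative_at contact_form_transition[OF A U(1) V(1) j] V(3) not_False_eq_True)
  qed
  then show "positive_loop A \<phi>" unfolding positive_loop_def by blast
qed

section \<open>Legendrian maps from families of functions\<close>

text \<open>The base point is written as \<open>p + 0 *\<^sub>R v\<close> to match the value at 0 of
  the line along which the chain rule is applied.\<close>

lemma frechet_derivative_path:
  assumes "(f has_derivative D) (at (p + (0::real) *\<^sub>R v))"
  shows "((\<lambda>x. f (p + x *\<^sub>R v)) has_vector_derivative D v) (at 0)"
proof -
  have "((\<lambda>x. p + x *\<^sub>R v) has_vector_derivative v) (at 0)"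
    by (auto intro!: derivative_eq_intros)
  from vector_derivative_diff_chain_within[OF this has_derivative_at_withinI[OF assms]]
  show ?thesis by (simp add: o_def)
qed

text \<open>\<open>h (\<omega>, _)\<close> represents the jet at \<open>q \<omega>\<close>.  The contact form of the velocity is then the derivative
  of \<open>h\<close> in its first argument, so that the map is Legendrian iff its front is the envelope of the
  graphs of the functions \<open>h (\<omega>, _)\<close>.\<close>

definition jet_map :: "('w::euclidean_space \<Rightarrow> real^'n) \<Rightarrow> ('w \<times> (real^'n) \<Rightarrow> real) \<Rightarrow>
    'w \<Rightarrow> (real^'n) \<times> (real^'n) \<times> real" where
  "jet_map q h \<omega> = (q \<omega>, \<chi> i. fderiv h (\<omega>, q \<omega>) (0, axis i 1), h (\<omega>, q \<omega>))"

lemma smooth_on_jet_map: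
  assumes S: "open S" "smooth_on S q" and T: "open T" "smooth_on T h" and ST: "\<forall>\<omega>\<in>S. (\<omega>, q \<omega>) \<in> T"
  shows "smooth_on S (\<lambda>\<omega>. fderiv h (\<omega>, q \<omega>) v)" "smooth_on S (jet_map q h)"
proof -
  have g: "smooth_on S (\<lambda>\<omega>. (\<omega>, q \<omega>))" by (intro smooth_on_intros S)
  show 1: "smooth_on S (\<lambda>\<omega>. fderiv h (\<omega>, q \<omega>) v)" for v
    by (rule smooth_on_compose[OF S(1) T(1) _ g smooth_on_frechet_derivative[OF T(2)]]) (use ST in auto)
  have 2: "smooth_on S (\<lambda>\<omega>. h (\<omega>, q \<omega>))"
    by (rule smooth_on_compose[OF S(1) T(1) _ g T(2)]) (use ST in auto)
  show "smooth_on S (jet_map q h)"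
    unfolding jet_map_def[abs_def] by (intro smooth_on_Pair smooth_on_vec_lambda S 1 2)
qed

lemma jet_map_derivative:
  assumes S: "open S" "smooth_on S q" and T: "open T" "smooth_on T h" and ST: "\<forall>\<omega>\<in>S. (\<omega>, q \<omega>) \<in> T"
    and w: "\<omega> \<in> S"
  shows "contact_form (jet_map q h \<omega>) (fderiv (jet_map q h) \<omega> v) =
      fderiv h (\<omega>, q \<omega>) (v, 0)"
    and "fst (fderiv (jet_map q h) \<omega> v) = fderiv q \<omega> v"
    and "fst (snd (fderiv (jet_map q h) \<omega> v)) $ i =
      fderiv (\<lambda>\<omega>. frechet_derivative h (at (\<omega>, q \<omega>)) (0, axis i 1)) \<omega> v"
proof -
  let ?D = "fderiv (jet_map q h) \<omega>" and ?dh = "fderiv h (\<omega>, q \<omega>)"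
    and ?dq = "fderiv q \<omega>"
  have dJ: "(jet_map q h has_derivative ?D) (at \<omega>)"
    by (rule smooth_on_has_derivative[OF smooth_on_jet_map(2)[OF S T ST] w])
  have dq: "(q has_derivative ?dq) (at \<omega>)" by (rule smooth_on_has_derivative[OF S(2) w])
  have dh: "(h has_derivative ?dh) (at (\<omega>, q \<omega>))" by (rule smooth_on_has_derivative[OF T(2) bspec[OF ST w]])
  have "((\<lambda>x. fst (jet_map q h x)) has_derivative ?dq) (at \<omega>)" using dq by (simp add: jet_map_def)
  from fun_cong[OF has_derivative_unique[OF has_derivative_fst[OF dJ] this]]
  show 1: "fst (?D v) = ?dq v" for v .
  have "((\<lambda>x. (x, q x)) has_derivative (\<lambda>v. (v, ?dq v))) (at \<omega>)"
    by (rule has_derivative_Pair[OF has_derivative_ident dq])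
  from has_derivative_compose[OF this dh]
  have "((\<lambda>x. snd (snd (jet_map q h x))) has_derivative (\<lambda>v. ?dh (v, ?dq v))) (at \<omega>)"
    by (simp add: jet_map_def)
  from fun_cong[OF has_derivative_unique[OF has_derivative_snd[OF has_derivative_snd[OF dJ]] this]]
  have 2: "snd (snd (?D v)) = ?dh (v, ?dq v)" for v .
  have lin: "linear ?dh" by (rule has_derivative_linear[OF dh])
  have lin2: "linear (\<lambda>y. ?dh (0, y))"
    by (rule bounded_linear.linear[OF bounded_linear_compose[OF has_derivative_bounded_linear[OF dh]
          bounded_linear_Pair[OF bounded_linear_zero bounded_linear_ident]]])
  \<comment> \<open>The change of \<open>z\<close> is \<open>?dh (v, ?dq v)\<close>; the form
    subtracts \<open>p \<bullet> dq\<close>, which is exactly the part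
    \<open>?dh (0, ?dq v)\<close>.\<close>
  have "?dh ((v, 0) + (0, ?dq v)) = ?dh (v, 0) + ?dh (0, ?dq v)" using lin linear_add by blast
  then have "?dh (v, ?dq v) = ?dh (v, 0) + ?dh (0, ?dq v)" by simp
  then show "contact_form (jet_map q h \<omega>) (?D v) = ?dh (v, 0)"
    unfolding contact_form_def using 1[of v] 2[of v] inner_vec_lambda_linear[OF lin2, of "?dq v"]
    by (simp add: case_prod_beta' jet_map_def)
  have "((\<lambda>x. fst (snd (jet_map q h x)) $ i) has_derivative (\<lambda>v. fst (snd (?D v)) $ i)) (at \<omega>)"
    using bounded_linear.has_derivative[OF bounded_linear_vec_nth has_derivative_fst[OF has_derivative_snd[OF dJ]]] .
  then have "((\<lambda>\<omega>. fderiv h (\<omega>, q \<omega>) (0, axis i 1)) has_derivative (\<lambda>v. fst (snd (?D v)) $ i)) (at \<omega>)"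
    by (simp add: jet_map_def)
  from fun_cong[OF frechet_derivative_at[OF this]] show "fst (snd (?D v)) $ i =
      fderiv (\<lambda>\<omega>. frechet_derivative h (at (\<omega>, q \<omega>)) (0, axis i 1)) \<omega> v" .
qed


section \<open>Travelling zigzags\<close>

text \<open>For fixed amplitudes \<open>s1\<close> and \<open>s2\<close> the front with \<open>q = (u + za s1 u) / N\<close>, \<open>p = zb\<close>, \<open>z = zc / N\<close>
  is Legendrian as soon as \<open>s2 = 0\<close> or \<open>s1 = 1\<close>, and periodic up to translation in \<open>q\<close>.  The amplitude
  \<open>s1\<close> creates the zigzags, with slopes at most \<open>\<eta>\<close>; then \<open>s2\<close> makes all slopes positive, and
  a translation in the \<open>- q\<close> direction becomes positive.\<close>

definition za :: "real \<Rightarrow> real \<Rightarrow> real" where "za s u = 4 * s * sin u"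
text \<open>The coefficient 1 / 2 gives \<open>zB u * (1 + 4 * cos u)\<close> the mean value 0, so
  that its primitive \<open>zC\<close> is periodic. The last term makes \<open>zB\<close> increase
  at the folds for full first amplitude, where \<open>cos u = - 1 / 4\<close>: the derivative there
  is \<open>sin u / 2 + 7 / 10\<close>, so it cannot cancel the contribution of \<eta> at the fold.
  Both coefficients are small enough to keep \<open>zB\<close> positive.\<close>

definition zB :: "real \<Rightarrow> real" where "zB u = 1 - cos u / 2 - 4 / 5 * (sin u * cos u)"
definition zC :: "real \<Rightarrow> real" where
  "zC u = 7 / 2 * sin u - sin u * cos u + 2 / 5 * (cos u)\<^sup>2 + 16 / 15 * (cos u) ^ 3"
definition zb :: "real \<Rightarrow> real \<Rightarrow> real \<Rightarrow> real \<Rightarrow> real" where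
  "zb \<eta> s1 s2 u = s2 * zB u - \<eta> * s1 * sin u"
definition zc :: "real \<Rightarrow> real \<Rightarrow> real \<Rightarrow> real \<Rightarrow> real" where
  "zc \<eta> s1 s2 u = \<eta> * (s1 * cos u + 2 * s1\<^sup>2 * (cos u)\<^sup>2) + s2 * zC u"

lemma zB_has_derivative: "(zB has_real_derivative (sin u / 2 + 4 / 5 - 8 / 5 * (cos u)\<^sup>2)) (at u)"
proof -
  have "(zB has_real_derivative (sin u / 2 - 4 / 5 * (cos u * cos u - sin u * sin u))) (at u)"
    unfolding zB_def[abs_def] by (auto intro!: derivative_eq_intros simp: field_simps)
  moreover have "sin u * sin u = 1 - (cos u)\<^sup>2" using sin_cos_squared_add[of u] by (simp add: power2_eq_square)
  ultimately show ?thesis by (simp add: power2_eq_square algebra_simps)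
qed

lemma zC_has_derivative: "(zC has_real_derivative (zB u * (1 + 4 * cos u))) (at u)"
proof -
  have D: "(zC has_real_derivative (7 / 2 * cos u - (cos u * cos u - sin u * sin u) - 4 / 5 * (cos u * sin u)
     - 16 / 5 * ((cos u)\<^sup>2 * sin u))) (at u)"
    unfolding zC_def[abs_def] by (auto intro!: derivative_eq_intros simp: algebra_simps)
  have "sin u * sin u = 1 - cos u * cos u" using sin_cos_squared_add[of u] by (simp add: power2_eq_square)
  then show ?thesis
    by (intro DERIV_cong[OF D]) (simp only: zB_def, simp add: power2_eq_square field_simps)
qed

lemma abs_sin_cos_le: "\<bar>sin (u::real) * cos u\<bar> \<le> 1 / 2"
proof -
  have "2 * \<bar>sin u * cos u\<bar> = \<bar>sin (2 * u)\<bar>" by (simp add: sin_double abs_mult)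
  then show ?thesis using abs_sin_le_one[of "2 * u"] by linarith
qed

lemma zB_bounds: "1 / 10 \<le> zB u" "\<bar>zB u\<bar> \<le> 2"
  using abs_sin_cos_le[of u] abs_cos_le_one[of u] unfolding zB_def by linarith+

lemma abs_zC_le: "\<bar>zC u\<bar> \<le> 7"
proof -
  have "\<bar>(cos u)\<^sup>2\<bar> \<le> 1" "\<bar>(cos u) ^ 3\<bar> \<le> 1"
    using abs_cos_le_one[of u] by (simp_all add: power_abs power_le_one abs_square_le_1)
  then show ?thesis
    using abs_sin_cos_le[of u] abs_sin_le_one[of u] unfolding zC_def by linarith
qed

lemma zb_ge:
  assumes "0 \<le> s1" "s1 \<le> 1" "0 \<le> s2" "0 \<le> \<eta>"
  shows "s2 / 10 - \<eta> \<le> zb \<eta> s1 s2 u"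
proof -
  have "s2 * (1 / 10) \<le> s2 * zB u" using zB_bounds assms by (intro mult_left_mono) auto
  moreover have "\<eta> * (s1 * sin u) \<le> \<eta> * 1"
    using assms mult_mono[of s1 1 "sin u" 1] by (intro mult_left_mono) (auto simp: sin_le_one intro: order_trans[OF mult_left_le])
  ultimately show ?thesis unfolding zb_def by (simp add: mult.assoc)
qed

text \<open>Because of \<open>X\<close> the derivative of \<open>zb\<close> drops out. The
  Legendrian relation for frozen amplitudes, which needs \<open>S\<close>, collapses the terms in
  \<open>v'\<close> to \<open>zb * v'\<close>. Only derivatives of the amplitudes remain besides; in
  time they are outweighed by a high speed, in space by a large \<open>N\<close>.\<close>

lemma envelope_has_derivative:
  assumes d: "(S1 has_real_derivative s1') (at x)" "(S2 has_real_derivative s2') (at x)"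
      "(V has_real_derivative v') (at x)" "(X has_real_derivative x') (at x)"
    and S: "S2 x \<noteq> 0 \<Longrightarrow> S1 x = 1" and X: "X x = za (S1 x) (V x)"
  shows "((\<lambda>x. zc \<eta> (S1 x) (S2 x) (V x) + zb \<eta> (S1 x) (S2 x) (V x) * (X x - za (S1 x) (V x)))
    has_real_derivative (zb \<eta> (S1 x) (S2 x) (V x) * (v' + x') +
      (\<eta> * (cos (V x) + 4 * S1 x * (cos (V x))\<^sup>2) - 4 * zb \<eta> (S1 x) (S2 x) (V x) * sin (V x)) * s1' + zC (V x) * s2')) (at x)"
proof -
  let ?u = "V x"
  have dB: "((\<lambda>x. zB (V x)) has_real_derivative (sin ?u / 2 + 4 / 5 - 8 / 5 * (cos ?u)\<^sup>2) * v') (at x)"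
    and dC: "((\<lambda>x. zC (V x)) has_real_derivative (zB ?u * (1 + 4 * cos ?u)) * v') (at x)"
    by (rule DERIV_chain2[OF zB_has_derivative d(3)] DERIV_chain2[OF zC_has_derivative d(3)])+
  have da: "((\<lambda>x. za (S1 x) (V x)) has_real_derivative (4 * s1' * sin ?u + 4 * S1 x * cos ?u * v')) (at x)"
    unfolding za_def using d by (auto intro!: derivative_eq_intros)
  obtain b' where db: "((\<lambda>x. zb \<eta> (S1 x) (S2 x) (V x)) has_real_derivative b') (at x)"
    using DERIV_diff[OF DERIV_mult[OF d(2) dB] DERIV_mult[OF DERIV_cmult[OF d(1), of \<eta>] DERIV_fun_sin[OF d(3)]]]
    unfolding zb_def by blast
  have dc: "((\<lambda>x. zc \<eta> (S1 x) (S2 x) (V x)) has_real_derivative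
     (\<eta> * (s1' * cos ?u - S1 x * sin ?u * v' + 4 * S1 x * s1' * (cos ?u)\<^sup>2 - 4 * (S1 x)\<^sup>2 * cos ?u * sin ?u * v')
       + s2' * zC ?u + S2 x * (zB ?u * (1 + 4 * cos ?u) * v'))) (at x)"
    unfolding zc_def using d dC
    by (auto intro!: derivative_eq_intros simp: algebra_simps power2_eq_square)
  have D: "((\<lambda>x. zc \<eta> (S1 x) (S2 x) (V x) + zb \<eta> (S1 x) (S2 x) (V x) * (X x - za (S1 x) (V x)))
    has_real_derivative (\<eta> * (s1' * cos ?u - S1 x * sin ?u * v' + 4 * S1 x * s1' * (cos ?u)\<^sup>2 - 4 * (S1 x)\<^sup>2 * cos ?u * sin ?u * v')
       + s2' * zC ?u + S2 x * (zB ?u * (1 + 4 * cos ?u) * v')) + (b' * (X x - za (S1 x) ?u)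
       + (x' - (4 * s1' * sin ?u + 4 * S1 x * cos ?u * v')) * zb \<eta> (S1 x) (S2 x) ?u)) (at x)"
    by (intro DERIV_add[OF dc] DERIV_mult[OF db] DERIV_diff d(4) da)
  show ?thesis
    by (rule DERIV_cong[OF D])
       (use S in \<open>cases "S2 x = 0"; simp add: X zb_def algebra_simps power2_eq_square\<close>)
qed


lemma smooth_on_deriv:
  fixes f :: "real \<Rightarrow> real"
  assumes "smooth_on UNIV f"
  shows "(f has_real_derivative deriv f x) (at x)" "smooth_on UNIV (deriv f)"
proof -
  have d: "(f has_derivative fderiv f x) (at x)" for x
    using smooth_on_has_derivative[OF assms] by simp
  have D: "(f has_real_derivative fderiv f x 1) (at x)" for x
  proof -
    have "fderiv f x = (*) (fderiv f x 1)"
    proof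
      fix h show "fderiv f x h = fderiv f x 1 * h"
        using linear_scale[OF has_derivative_linear[OF d], of x h 1] by (simp add: mult.commute)
    qed
    then show ?thesis using d[of x] unfolding has_field_derivative_def by (simp only: )
  qed
  have eq: "deriv f = (\<lambda>x. fderiv f x 1)" using DERIV_imp_deriv[OF D] by (rule ext)
  show "(f has_real_derivative deriv f x) (at x)" unfolding eq by (rule D)
  show "smooth_on UNIV (deriv f)" unfolding eq by (rule smooth_on_frechet_derivative[OF assms])
qed

text \<open>The space factors \<open>\<sigma>1\<close>, \<open>\<sigma>2\<close> and the time
  factors \<open>lam\<close>, \<open>mu\<close> each respect the order of switching through
  \<open>full\<close>, hence so do their products. The bound of
  \<open>8 * \<bar>fderiv \<sigma>1 w b\<bar>\<close> by \<open>N\<close> serves twice: it makes the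
  equation for the foot point uniquely solvable, and it keeps the folds nondegenerate where the
  first amplitude varies.\<close>

locale zigzag =
  fixes b :: "'e::euclidean_space" and \<sigma>1 \<sigma>2 :: "'e \<Rightarrow> real" and lam mu :: "real \<Rightarrow> real" and \<eta> N sp :: real
  assumes b: "b \<bullet> b = 1"
    and smooth: "smooth_on UNIV \<sigma>1" "smooth_on UNIV \<sigma>2" "smooth_on UNIV lam" "smooth_on UNIV mu"
    and bounds: "\<And>w. 0 \<le> \<sigma>1 w" "\<And>w. \<sigma>1 w \<le> 1" "\<And>w. 0 \<le> \<sigma>2 w" "\<And>w. \<sigma>2 w \<le> 1"
      "\<And>t. 0 \<le> lam t" "\<And>t. lam t \<le> 1" "\<And>t. 0 \<le> mu t" "\<And>t. mu t \<le> 1"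
    and full: "\<And>w. \<sigma>2 w \<noteq> 0 \<Longrightarrow> \<sigma>1 w = 1" "\<And>t. mu t \<noteq> 0 \<Longrightarrow> lam t = 1"
    and \<eta>: "0 < \<eta>" "\<eta> \<le> 1" and N: "0 < N" "\<And>w. 8 * \<bar>fderiv \<sigma>1 w b\<bar> \<le> N"
begin

definition phase :: "'e \<times> real \<Rightarrow> real" where
  "phase = (\<lambda>(e, t). N * (e \<bullet> b) + sp * t)"

abbreviation "S1 t w \<equiv> lam t * \<sigma>1 w"
abbreviation "S2 t w \<equiv> mu t * \<sigma>2 w"

lemma S_full: "S2 t w \<noteq> 0 \<Longrightarrow> S1 t w = 1"
  using full by auto

lemma S_bounds: "0 \<le> S1 t w" "S1 t w \<le> 1" "0 \<le> S2 t w" "S2 t w \<le> 1"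
  using bounds by (auto intro: mult_le_one)

lemma smooth_on_phase [intro]: "open S \<Longrightarrow> smooth_on S phase"
  unfolding phase_def case_prod_beta' by (intro smooth_on_intros)

lemma shift_exists:
  obtains r where "smooth_on UNIV r"
    "\<And>\<omega> \<rho>. N * \<rho> = za (S1 (snd \<omega>) (fst \<omega> + \<rho> *\<^sub>R b)) (phase \<omega>) \<longleftrightarrow> \<rho> = r \<omega>"
proof -
  define F :: "('e \<times> real) \<times> real \<Rightarrow> real"
    where "F = (\<lambda>z. snd z - 4 / N * (lam (snd (fst z)) * \<sigma>1 (fst (fst z) + snd z *\<^sub>R b) * sin (phase (fst z))))"
  have F: "smooth_on UNIV F"
    unfolding F_def
    by (intro smooth_on_intros smooth_on_compose_UNIV[OF smooth(1)] smooth_on_compose_UNIV[OF smooth(3)]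
        smooth_on_compose_UNIV[OF smooth_on_phase] open_UNIV)
  \<comment> \<open>The derivative differs from 1 by at most \<open>4 / N\<close> times the slope of
    \<open>\<sigma>1\<close>, thus by at most \<open>4 / 8\<close>.\<close>
  have "fderiv F (\<omega>, \<rho>) (0, 1) \<ge> 1 / 2" for \<omega> \<rho>
  proof -
    obtain e t where \<omega>: "\<omega> = (e, t)" by fastforce
    let ?d = "fderiv \<sigma>1 (e + \<rho> *\<^sub>R b) b"
    have "(\<sigma>1 has_derivative fderiv \<sigma>1 (e + \<rho> *\<^sub>R b)) (at ((e + \<rho> *\<^sub>R b) + 0 *\<^sub>R b))"
      using smooth_on_has_derivative[OF smooth(1)] by simp
    from frechet_derivative_path[OF this]
    have d: "((\<lambda>x. \<sigma>1 (e + (\<rho> + x) *\<^sub>R b)) has_real_derivative ?d) (at 0)"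
      by (simp add: has_real_derivative_iff_has_vector_derivative algebra_simps)
    have D1: "((\<lambda>x. (\<rho> + x) - 4 / N * (lam t * \<sigma>1 (e + (\<rho> + x) *\<^sub>R b) * sin (phase \<omega>))) has_real_derivative
        1 - 4 / N * (lam t * ?d * sin (phase \<omega>))) (at 0)"
      using d N(1) by (auto intro!: derivative_eq_intros)
    have "(F has_derivative fderiv F (\<omega>, \<rho>)) (at ((\<omega>, \<rho>) + 0 *\<^sub>R (0, 1)))"
      using smooth_on_has_derivative[OF F] by simp
    from frechet_derivative_path[OF this]
    have "((\<lambda>x. (\<rho> + x) - 4 / N * (lam t * \<sigma>1 (e + (\<rho> + x) *\<^sub>R b) * sin (phase \<omega>))) has_vector_derivative
        fderiv F (\<omega>, \<rho>) (0, 1)) (at 0)"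
      by (simp add: F_def \<omega>)
    from vector_derivative_unique_at[OF this D1[unfolded has_real_derivative_iff_has_vector_derivative]]
    have eq: "fderiv F (\<omega>, \<rho>) (0, 1) = 1 - 4 / N * (lam t * ?d * sin (phase \<omega>))" .
    have "\<bar>lam t\<bar> * (8 * \<bar>?d\<bar>) * \<bar>sin (phase \<omega>)\<bar> \<le> 1 * N * 1"
      using bounds(5,6)[of t] N by (intro mult_mono) auto
    then have "8 * \<bar>lam t * ?d * sin (phase \<omega>)\<bar> \<le> N" by (simp add: abs_mult mult_ac)
    then have "4 / N * (lam t * ?d * sin (phase \<omega>)) \<le> 1 / 2"
      using N(1) by (simp add: field_simps abs_le_iff)
    then show ?thesis unfolding eq by simp
  qed
  then obtain r where r: "smooth_on UNIV r" "\<And>\<omega> \<rho>. F (\<omega>, \<rho>) = 0 \<longleftrightarrow> \<rho> = r \<omega>"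
    using smooth_implicit_function[OF F, of "1 / 2"] by (metis half_gt_zero zero_less_one)
  have "N * \<rho> = za (S1 (snd \<omega>) (fst \<omega> + \<rho> *\<^sub>R b)) (phase \<omega>) \<longleftrightarrow> F (\<omega>, \<rho>) = 0" for \<omega> \<rho>
    using N(1) by (auto simp: F_def za_def field_simps)
  with r show ?thesis using that by blast
qed

definition shift :: "'e \<times> real \<Rightarrow> real" where
  "shift = (SOME r. smooth_on UNIV r \<and>
     (\<forall>\<omega> \<rho>. N * \<rho> = za (S1 (snd \<omega>) (fst \<omega> + \<rho> *\<^sub>R b)) (phase \<omega>) \<longleftrightarrow> \<rho> = r \<omega>))"

text \<open>The amplitudes are evaluated at the foot point \<open>w\<close> of the jet and not at the parameter \<open>e\<close>: the
  envelope condition then needs no correction where the amplitudes vary, at the price of an implicit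
  equation for the foot point \<open>base\<close>.\<close>

definition base :: "'e \<times> real \<Rightarrow> 'e" where
  "base \<omega> = fst \<omega> + shift \<omega> *\<^sub>R b"

text \<open>For frozen amplitudes this is the tangent line to the plane front at the phase of
  \<omega>, evaluated at \<open>w\<close>; the point of contact is
  \<open>base \<omega>\<close>.\<close>

definition wave :: "('e \<times> real) \<times> 'e \<Rightarrow> real" where
  "wave = (\<lambda>(\<omega>, w). (zc \<eta> (S1 (snd \<omega>) w) (S2 (snd \<omega>) w) (phase \<omega>) +
     zb \<eta> (S1 (snd \<omega>) w) (S2 (snd \<omega>) w) (phase \<omega>) * (N * ((w - fst \<omega>) \<bullet> b) - za (S1 (snd \<omega>) w) (phase \<omega>))) / N)"

lemma shift: "smooth_on UNIV shift"
    "N * \<rho> = za (S1 (snd \<omega>) (fst \<omega> + \<rho> *\<^sub>R b)) (phase \<omega>) \<longleftrightarrow> \<rho> = shift \<omega>"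
proof -
  have "\<exists>r. smooth_on UNIV r \<and>
     (\<forall>\<omega> \<rho>. N * \<rho> = za (S1 (snd \<omega>) (fst \<omega> + \<rho> *\<^sub>R b)) (phase \<omega>) \<longleftrightarrow> \<rho> = r \<omega>)"
    using shift_exists by metis
  from someI_ex[OF this] show "smooth_on UNIV shift"
    "N * \<rho> = za (S1 (snd \<omega>) (fst \<omega> + \<rho> *\<^sub>R b)) (phase \<omega>) \<longleftrightarrow> \<rho> = shift \<omega>"
    unfolding shift_def by blast+
qed

lemma smooth_on_base: "open S \<Longrightarrow> smooth_on S base"
  unfolding base_def[abs_def] by (intro smooth_on_intros smooth_on_subset[OF shift(1)]) auto

lemma shift_eq: "N * shift \<omega> = za (S1 (snd \<omega>) (base \<omega>)) (phase \<omega>)"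
  using shift(2)[of "shift \<omega>" \<omega>] by (simp add: base_def)

lemma base_eq: "N * ((base \<omega> - fst \<omega>) \<bullet> b) = za (S1 (snd \<omega>) (base \<omega>)) (phase \<omega>)"
  using shift_eq by (simp add: base_def b)

text \<open>If the amplitude vanishes at \<open>e\<close>, uniqueness of the root gives the shift 0.
  The second form tests the amplitude at the foot point instead and is what keeps foot points inside
  a chart.\<close>

lemma base_inactive: "S1 t e = 0 \<Longrightarrow> base (e, t) = e" "S1 t (base (e, t)) = 0 \<Longrightarrow> base (e, t) = e"
  using shift(2)[of 0 "(e, t)"] shift_eq[of "(e, t)"] N(1) by (auto simp: za_def base_def)

lemma norm_base_diff_le: "norm (base \<omega> - fst \<omega>) \<le> 4 / N"
proof -
  have "\<bar>S1 (snd \<omega>) (base \<omega>) * sin (phase \<omega>)\<bar> \<le> 1 * 1"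
    unfolding abs_mult using S_bounds[of "snd \<omega>" "base \<omega>"] by (intro mult_mono) auto
  then have "\<bar>N * shift \<omega>\<bar> \<le> 4" unfolding shift_eq za_def by simp
  moreover have "norm b = 1" using b by (simp add: norm_eq_sqrt_inner)
  ultimately show ?thesis using N(1) by (simp add: base_def abs_mult field_simps)
qed

lemma wave_inactive: "S1 (snd \<omega>) w = 0 \<Longrightarrow> wave (\<omega>, w) = 0"
proof -
  assume s: "S1 (snd \<omega>) w = 0"
  then have "S2 (snd \<omega>) w = 0" using S_full[of "snd \<omega>" w] by linarith
  then show ?thesis unfolding wave_def by (simp only: s prod.case) (simp add: zc_def zb_def)
qed

lemma smooth_on_wave: "smooth_on UNIV wave"
  unfolding wave_def case_prod_beta' zc_def zb_def za_def zC_def zB_def divide_inverse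
  by (intro smooth_on_intros smooth_on_compose_UNIV[OF smooth(1)] smooth_on_compose_UNIV[OF smooth(2)]
     smooth_on_compose_UNIV[OF smooth(3)] smooth_on_compose_UNIV[OF smooth(4)] smooth_on_compose_UNIV[OF smooth_on_phase] open_UNIV)

text \<open>The partial derivative of \<open>N * wave\<close> in the first amplitude at the point of
  contact.\<close>

definition slope_factor :: "real \<Rightarrow> real \<Rightarrow> real \<Rightarrow> real" where
  "slope_factor s1 s2 u = \<eta> * (cos u + 4 * s1 * (cos u)\<^sup>2) - 4 * zb \<eta> s1 s2 u * sin u"

lemma wave_path:
  assumes "((\<lambda>x. S1 (t' x) (w x)) has_real_derivative s1') (at x)" "((\<lambda>x. S2 (t' x) (w x)) has_real_derivative s2') (at x)"
    "((\<lambda>x. phase (e x, t' x)) has_real_derivative v') (at x)" "((\<lambda>x. N * ((w x - e x) \<bullet> b)) has_real_derivative x') (at x)"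
    and w: "w x = base (e x, t' x)"
  shows "((\<lambda>x. wave ((e x, t' x), w x)) has_real_derivative
    (zb \<eta> (S1 (t' x) (w x)) (S2 (t' x) (w x)) (phase (e x, t' x)) * (v' + x') +
     slope_factor (S1 (t' x) (w x)) (S2 (t' x) (w x)) (phase (e x, t' x)) * s1' + zC (phase (e x, t' x)) * s2') / N) (at x)"
proof -
  have X: "N * ((w x - e x) \<bullet> b) = za (S1 (t' x) (w x)) (phase (e x, t' x))"
    using base_eq[of "(e x, t' x)"] w by simp
  from DERIV_cdivide[OF envelope_has_derivative[where \<eta> = \<eta>, OF assms(1-4) S_full X], of N]
  show ?thesis unfolding wave_def slope_factor_def by simp
qed

text \<open>With the target point fixed, a motion of \<open>e\<close> changes the phase and the
  offset by opposite amounts, so no term in \<open>v\<close> survives: this is the Legendrian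
  condition. The coefficient of \<tau> becomes the contribution of the zigzags to the contact form
  of the time velocity.\<close>

lemma wave_derivative_parameter:
  "fderiv wave ((e, t), base (e, t)) ((v, \<tau>), 0) =
    \<tau> * (zb \<eta> (S1 t (base (e, t))) (S2 t (base (e, t))) (phase (e, t)) * sp +
      slope_factor (S1 t (base (e, t))) (S2 t (base (e, t))) (phase (e, t)) * (deriv lam t * \<sigma>1 (base (e, t))) +
      zC (phase (e, t)) * (deriv mu t * \<sigma>2 (base (e, t)))) / N"
proof -
  let ?w = "base (e, t)"
  have lin: "((\<lambda>x. t + x * \<tau>) has_real_derivative \<tau>) (at 0)" by (auto intro!: derivative_eq_intros)
  have dl: "((\<lambda>x. lam (t + x * \<tau>)) has_real_derivative deriv lam t * \<tau>) (at 0)"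
    by (rule DERIV_chain2[OF _ lin]) (simp add: smooth_on_deriv(1)[OF smooth(3)])
  have dm: "((\<lambda>x. mu (t + x * \<tau>)) has_real_derivative deriv mu t * \<tau>) (at 0)"
    by (rule DERIV_chain2[OF _ lin]) (simp add: smooth_on_deriv(1)[OF smooth(4)])
  have d1: "((\<lambda>x. S1 (t + x * \<tau>) ?w) has_real_derivative deriv lam t * \<tau> * \<sigma>1 ?w) (at 0)"
    and d2: "((\<lambda>x. S2 (t + x * \<tau>) ?w) has_real_derivative deriv mu t * \<tau> * \<sigma>2 ?w) (at 0)"
    by (rule DERIV_cmult_right[OF dl] DERIV_cmult_right[OF dm])+
  have d3: "((\<lambda>x. phase (e + x *\<^sub>R v, t + x * \<tau>)) has_real_derivative (N * (v \<bullet> b) + sp * \<tau>)) (at 0)"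
    unfolding phase_def by (auto intro!: derivative_eq_intros simp: inner_add_left)
  have d4: "((\<lambda>x. N * ((?w - (e + x *\<^sub>R v)) \<bullet> b)) has_real_derivative - (N * (v \<bullet> b))) (at 0)"
    by (auto intro!: derivative_eq_intros simp: inner_add_left inner_diff_left)
  have D: "((\<lambda>x. wave ((e + x *\<^sub>R v, t + x * \<tau>), ?w)) has_real_derivative
     (zb \<eta> (S1 t ?w) (S2 t ?w) (phase (e, t)) * ((N * (v \<bullet> b) + sp * \<tau>) + - (N * (v \<bullet> b))) +
     slope_factor (S1 t ?w) (S2 t ?w) (phase (e, t)) * (deriv lam t * \<tau> * \<sigma>1 ?w) + zC (phase (e, t)) * (deriv mu t * \<tau> * \<sigma>2 ?w)) / N) (at 0)"
    using wave_path[OF d1 d2 d3 d4] by simp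
  have "(wave has_derivative fderiv wave ((e, t), ?w)) (at (((e, t), ?w) + 0 *\<^sub>R ((v, \<tau>), 0)))"
    using smooth_on_has_derivative[OF smooth_on_wave] by simp
  from frechet_derivative_path[OF this]
  have "((\<lambda>x. wave ((e + x *\<^sub>R v, t + x * \<tau>), ?w)) has_vector_derivative
    fderiv wave ((e, t), ?w) ((v, \<tau>), 0)) (at 0)" by simp
  from vector_derivative_unique_at[OF this D[unfolded has_real_derivative_iff_has_vector_derivative]]
  show ?thesis by (simp add: algebra_simps)
qed

text \<open>This is the part of \<open>p\<close> in the direction \<open>b\<close> that is due to
  the zigzags. Gradients of the amplitudes enter it with the factor \<open>1 / N\<close>.\<close>

lemma wave_derivative_target:
  "fderiv wave ((e, t), base (e, t)) (0, b) =
    zb \<eta> (S1 t (base (e, t))) (S2 t (base (e, t))) (phase (e, t)) +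
    (slope_factor (S1 t (base (e, t))) (S2 t (base (e, t))) (phase (e, t)) * (lam t * fderiv \<sigma>1 (base (e, t)) b) +
      zC (phase (e, t)) * (mu t * fderiv \<sigma>2 (base (e, t)) b)) / N"
proof -
  let ?w = "base (e, t)"
  have d: "((\<lambda>x. \<sigma> (?w + x *\<^sub>R b)) has_real_derivative fderiv \<sigma> ?w b) (at 0)"
    if "smooth_on UNIV \<sigma>" for \<sigma> :: "'e \<Rightarrow> real"
    using frechet_derivative_path[of \<sigma> "fderiv \<sigma> ?w" ?w b] smooth_on_has_derivative[OF that]
    by (simp add: has_real_derivative_iff_has_vector_derivative)
  have d1: "((\<lambda>x. S1 t (?w + x *\<^sub>R b)) has_real_derivative lam t * fderiv \<sigma>1 ?w b) (at 0)"
    and d2: "((\<lambda>x. S2 t (?w + x *\<^sub>R b)) has_real_derivative mu t * fderiv \<sigma>2 ?w b) (at 0)"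
    by (rule DERIV_cmult[OF d[OF smooth(1)]] DERIV_cmult[OF d[OF smooth(2)]])+
  have d3: "((\<lambda>x::real. phase (e, t)) has_real_derivative 0) (at 0)" by simp
  have d4: "((\<lambda>x. N * (((?w + x *\<^sub>R b) - e) \<bullet> b)) has_real_derivative N) (at 0)"
    using b by (auto intro!: derivative_eq_intros simp: inner_add_left inner_diff_left)
  have D: "((\<lambda>x. wave ((e, t), ?w + x *\<^sub>R b)) has_real_derivative
     (zb \<eta> (S1 t ?w) (S2 t ?w) (phase (e, t)) * (0 + N) +
     slope_factor (S1 t ?w) (S2 t ?w) (phase (e, t)) * (lam t * fderiv \<sigma>1 ?w b) +
     zC (phase (e, t)) * (mu t * fderiv \<sigma>2 ?w b)) / N) (at 0)"
    using wave_path[where e = "\<lambda>x. e", OF d1 d2 d3 d4] by simp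
  have "(wave has_derivative fderiv wave ((e, t), ?w)) (at (((e, t), ?w) + 0 *\<^sub>R (0, b)))"
    using smooth_on_has_derivative[OF smooth_on_wave] by simp
  from frechet_derivative_path[OF this]
  have "((\<lambda>x. wave ((e, t), ?w + x *\<^sub>R b)) has_vector_derivative
    fderiv wave ((e, t), ?w) (0, b)) (at 0)" by simp
  from vector_derivative_unique_at[OF this D[unfolded has_real_derivative_iff_has_vector_derivative]]
  show ?thesis using N(1) by (simp add: field_simps)
qed

section \<open>Immersivity at the folds\<close>

definition zb_slope :: "real \<Rightarrow> real \<Rightarrow> real \<Rightarrow> real" where
  "zb_slope s1 s2 u = s2 * (sin u / 2 + 4 / 5 - 8 / 5 * (cos u)\<^sup>2) - \<eta> * s1 * cos u"

lemma zb_has_derivative_phase: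
  assumes "(A1 has_real_derivative 0) (at x)" "(A2 has_real_derivative 0) (at x)" "(V has_real_derivative y) (at x)"
  shows "((\<lambda>x. zb \<eta> (A1 x) (A2 x) (V x)) has_real_derivative zb_slope (A1 x) (A2 x) (V x) * y) (at x)"
proof -
  have B: "((\<lambda>x. zB (V x)) has_real_derivative (sin (V x) / 2 + 4 / 5 - 8 / 5 * (cos (V x))\<^sup>2) * y) (at x)"
    by (rule DERIV_chain2[OF zB_has_derivative assms(3)])
  show ?thesis
    unfolding zb_def
    by (rule DERIV_cong[OF DERIV_diff[OF DERIV_mult[OF assms(2) B]
      DERIV_mult[OF DERIV_cmult[OF assms(1), of \<eta>] DERIV_fun_sin[OF assms(3)]]]])
      (simp add: zb_slope_def algebra_simps)
qed

lemma slope_factor_has_derivative_phase: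
  assumes "(A1 has_real_derivative 0) (at x)" "(A2 has_real_derivative 0) (at x)" "(V has_real_derivative y) (at x)"
  shows "((\<lambda>x. slope_factor (A1 x) (A2 x) (V x)) has_real_derivative
    (\<eta> * (- sin (V x) - 8 * A1 x * cos (V x) * sin (V x)) - 4 * zb_slope (A1 x) (A2 x) (V x) * sin (V x)
      - 4 * zb \<eta> (A1 x) (A2 x) (V x) * cos (V x)) * y) (at x)"
proof -
  have "((\<lambda>x. \<eta> * (cos (V x) + 4 * A1 x * (cos (V x))\<^sup>2)) has_real_derivative
     \<eta> * (- sin (V x) - 8 * A1 x * cos (V x) * sin (V x)) * y) (at x)"
    using assms by (auto intro!: derivative_eq_intros simp: algebra_simps)
  moreover have "((\<lambda>x. 4 * zb \<eta> (A1 x) (A2 x) (V x) * sin (V x)) has_real_derivative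
     (4 * zb_slope (A1 x) (A2 x) (V x) * sin (V x) + 4 * zb \<eta> (A1 x) (A2 x) (V x) * cos (V x)) * y) (at x)"
    using assms zb_has_derivative_phase[OF assms] by (auto intro!: derivative_eq_intros simp: algebra_simps)
  ultimately show ?thesis
    unfolding slope_factor_def by (rule DERIV_cong[OF DERIV_diff]) (simp add: algebra_simps)
qed

text \<open>At a fold of the front (\<open>4 * s1 * cos u = - 1\<close>) the slope varies monotonically in the phase, so
  that the fold is an immersed cusp.\<close>

lemma fold_nondegenerate:
  assumes fold: "4 * S1 t w * cos u = - 1"
  shows "zb_slope (S1 t w) (S2 t w) u +
    ((\<eta> * (- sin u - 8 * S1 t w * cos u * sin u) - 4 * zb_slope (S1 t w) (S2 t w) u * sin u
      - 4 * zb \<eta> (S1 t w) (S2 t w) u * cos u) * (lam t * fderiv \<sigma>1 w b) +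
     zB u * (1 + 4 * cos u) * (mu t * fderiv \<sigma>2 w b)) / N > 0"
    (is "_ + (?sf * ?G1 + _ * ?G2) / N > 0")
proof (cases "S2 t w = 0")
  case False
  then have s1: "S1 t w = 1" by (rule S_full)
  have "\<sigma>1 w = 1" using False full by auto
  \<comment> \<open>\<open>\<sigma>1\<close> attains its maximum 1 here, so its gradient
    vanishes.\<close>
  then have "fderiv \<sigma>1 w = (\<lambda>v. 0)"
    using differential_zero_maxmin[OF UNIV_I[of w] open_UNIV smooth_on_has_derivative[OF smooth(1)]] bounds(2) by simp
  then have G: "?G1 = 0" by simp
  have c: "cos u = - 1 / 4" using fold s1 by simp
  have "S2 t w * (sin u / 2 + 4 / 5 - 8 / 5 * (cos u)\<^sup>2) \<ge> 0"
  proof (rule mult_nonneg_nonneg[OF S_bounds(3)])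
    have "8 / 5 * (cos u)\<^sup>2 = 1 / 10" by (simp add: c power2_eq_square)
    then show "0 \<le> sin u / 2 + 4 / 5 - 8 / 5 * (cos u)\<^sup>2"
      using sin_ge_minus_one[of u] by linarith
  qed
  then have "zb_slope (S1 t w) (S2 t w) u > 0" using \<eta> unfolding zb_slope_def s1 c by simp
  then show ?thesis unfolding G by (simp add: c)
next
  case True
  \<comment> \<open>Either the time factor is 0, or \<open>\<sigma>2\<close> attains its minimum 0
    and has no gradient.\<close>
  have G2: "?G2 = 0"
  proof (cases "mu t = 0")
    case False
    then have "\<sigma>2 w = 0" using True by simp
    then have "fderiv \<sigma>2 w = (\<lambda>v. 0)"
      using differential_zero_maxmin[OF UNIV_I[of w] open_UNIV smooth_on_has_derivative[OF smooth(2)]] bounds(3) by simp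
    then show ?thesis by simp
  qed simp
  have z: "zb_slope (S1 t w) (S2 t w) u = \<eta> / 4"
    using arg_cong[OF fold, of "\<lambda>x. \<eta> * x"] unfolding zb_slope_def True by (simp add: algebra_simps)
  have f: "S1 t w * cos u = - 1 / 4" using fold by simp
  have "\<eta> * (- sin u - 8 * S1 t w * cos u * sin u) = \<eta> * (- sin u - 8 * (S1 t w * cos u) * sin u)"
    "4 * zb \<eta> (S1 t w) (S2 t w) u * cos u = - 4 * \<eta> * (S1 t w * cos u) * sin u"
    unfolding zb_def True by (simp_all add: algebra_simps)
  then have sf: "?sf = - \<eta> * sin u" unfolding z f by (simp add: algebra_simps)
  \<comment> \<open>The bound on \<open>N\<close> makes the gradient term at most
    \<open>\<eta> / 8\<close>, half of the main term \<open>\<eta> / 4\<close>.\<close>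
  have "\<bar>?G1\<bar> \<le> 1 * (N / 8)"
    unfolding abs_mult using bounds(5,6)[of t] N(2)[of w] by (intro mult_mono) auto
  then have "\<bar>sin u\<bar> * \<bar>?G1\<bar> \<le> 1 * (N / 8)" by (intro mult_mono) auto
  then have "\<bar>sin u * ?G1\<bar> \<le> N / 8" by (simp add: abs_mult)
  then have "sin u * ?G1 < N / 4" using N(1) by (auto simp: abs_le_iff)
  then have "\<eta> * (sin u * ?G1) < \<eta> * (N / 4)" using \<eta> by (intro mult_strict_left_mono) auto
  then have "\<eta> / 4 - \<eta> * (sin u * ?G1) / N > 0" using N(1) by (simp add: field_simps)
  then show ?thesis unfolding sf unfolding G2 z by (simp add: mult.assoc)
qed

text \<open>A direction \<open>v\<close> that leaves the foot point stationary is a multiple of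
  \<open>b\<close>, and it is 0 unless the phase is at a fold. There the amplitudes, their gradients
  and the external slope \<open>g\<close> are stationary as functions of the foot point; only the
  phase moves, and the slope then changes at the nonzero rate of
  \<open>fold_nondegenerate\<close>.\<close>

lemma zigzag_immersive:
  assumes g: "(g has_derivative g') (at (base (e, t)))" and c: "c \<noteq> 0"
    and base0: "fderiv base (e, t) (v, 0) = 0"
    and slope0: "((\<lambda>x. c * (g (base (e + x *\<^sub>R v, t)) +
        fderiv wave ((e + x *\<^sub>R v, t), base (e + x *\<^sub>R v, t)) (0, b))) has_real_derivative 0) (at 0)"
  shows "v = 0"
proof -
  define q where "q x = base (e + x *\<^sub>R v, t)" for x :: real
  define u where "u x = phase (e + x *\<^sub>R v, t)" for x :: real
  define r where "r x = shift (e + x *\<^sub>R v, t)" for x :: real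
  have q0: "q 0 = base (e, t)" and u0: "u 0 = phase (e, t)" by (simp_all add: q_def u_def)
  have "(base has_derivative fderiv base (e, t)) (at ((e, t) + 0 *\<^sub>R (v, 0)))"
    using smooth_on_has_derivative[OF smooth_on_base[OF open_UNIV]] by simp
  from frechet_derivative_path[OF this] have dq: "(q has_vector_derivative 0) (at 0)"
    by (simp add: q_def[abs_def] base0)
  have const: "((\<lambda>x. f (q x)) has_real_derivative 0) (at 0)" if "(f has_derivative f') (at (base (e, t)))" for f :: "'e \<Rightarrow> real" and f'
  proof -
    have "(f has_derivative f') (at (q 0))" using that q0 by simp
    from vector_derivative_diff_chain_within[OF dq has_derivative_at_withinI[OF this]]
    have "((\<lambda>x. f (q x)) has_vector_derivative f' 0) (at 0)" by (simp add: o_def)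
    then show ?thesis
      using linear_0[OF has_derivative_linear[OF that]] by (simp add: has_real_derivative_iff_has_vector_derivative)
  qed
  have constS: "((\<lambda>x. \<sigma> (q x)) has_real_derivative 0) (at 0)"
      "((\<lambda>x. fderiv \<sigma> (q x) b) has_real_derivative 0) (at 0)"
    if "smooth_on UNIV \<sigma>" for \<sigma> :: "'e \<Rightarrow> real"
    using const[OF smooth_on_has_derivative[OF that UNIV_I]]
      const[OF smooth_on_has_derivative[OF smooth_on_frechet_derivative[OF that] UNIV_I]] by simp_all
  have dS1: "((\<lambda>x. S1 t (q x)) has_real_derivative 0) (at 0)"
    and dS2: "((\<lambda>x. S2 t (q x)) has_real_derivative 0) (at 0)"
    and dG1: "((\<lambda>x. lam t * fderiv \<sigma>1 (q x) b) has_real_derivative 0) (at 0)"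
    and dG2: "((\<lambda>x. mu t * fderiv \<sigma>2 (q x) b) has_real_derivative 0) (at 0)"
    using DERIV_cmult[OF constS(1)[OF smooth(1)], of "lam t"] DERIV_cmult[OF constS(1)[OF smooth(2)], of "mu t"]
      DERIV_cmult[OF constS(2)[OF smooth(1)], of "lam t"] DERIV_cmult[OF constS(2)[OF smooth(2)], of "mu t"] by simp_all
  let ?y = "N * (v \<bullet> b)"
  have du: "(u has_real_derivative ?y) (at 0)"
    unfolding u_def phase_def by (auto intro!: derivative_eq_intros simp: inner_add_left)
  have "(shift has_derivative fderiv shift (e, t)) (at ((e, t) + 0 *\<^sub>R (v, 0)))"
    using smooth_on_has_derivative[OF shift(1)] by simp
  from frechet_derivative_path[OF this] obtain r' where dr: "(r has_real_derivative r') (at 0)"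
    by (auto simp: r_def[abs_def] has_real_derivative_iff_has_vector_derivative)
  have "((\<lambda>x. (e + x *\<^sub>R v) + r x *\<^sub>R b) has_vector_derivative v + r' *\<^sub>R b) (at 0)"
    using dr by (auto intro!: derivative_eq_intros simp: has_real_derivative_iff_has_vector_derivative)
  moreover have "q = (\<lambda>x. (e + x *\<^sub>R v) + r x *\<^sub>R b)" by (simp add: q_def r_def base_def fun_eq_iff)
  ultimately have "v + r' *\<^sub>R b = 0" using vector_derivative_unique_at[OF _ dq] by simp
  then have v: "v = - r' *\<^sub>R b" by (simp add: eq_neg_iff_add_eq_0)
  then have vb: "v \<bullet> b = - r'" by (simp add: b)
  from DERIV_mult[OF DERIV_cmult[OF dS1, of 4] DERIV_fun_sin[OF du]]
  have "((\<lambda>x. za (S1 t (q x)) (u x)) has_real_derivative 4 * S1 t (q 0) * cos (u 0) * ?y) (at 0)"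
    by (simp add: za_def mult_ac)
  moreover have "(\<lambda>x. za (S1 t (q x)) (u x)) = (\<lambda>x. N * r x)"
    using shift_eq[of "(e + _ *\<^sub>R v, t)"] by (simp add: q_def u_def r_def fun_eq_iff)
  ultimately have "N * r' = 4 * S1 t (q 0) * cos (u 0) * ?y"
    using DERIV_unique DERIV_cmult[OF dr, of N] by fastforce
  then have "N * (r' * (1 + 4 * S1 t (q 0) * cos (u 0))) = 0" unfolding vb by (simp add: algebra_simps)
  then have fold: "r' = 0 \<or> 4 * S1 t (q 0) * cos (u 0) = - 1"
    using N(1) unfolding mult_eq_0_iff by linarith
  show ?thesis
  proof (rule ccontr)
    assume "v \<noteq> 0"
    then have "r' \<noteq> 0" using v by auto
    then have f: "4 * S1 t (q 0) * cos (u 0) = - 1" using fold by blast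
    let ?R = "zb_slope (S1 t (q 0)) (S2 t (q 0)) (u 0) +
     ((\<eta> * (- sin (u 0) - 8 * S1 t (q 0) * cos (u 0) * sin (u 0)) - 4 * zb_slope (S1 t (q 0)) (S2 t (q 0)) (u 0) * sin (u 0)
      - 4 * zb \<eta> (S1 t (q 0)) (S2 t (q 0)) (u 0) * cos (u 0)) * (lam t * fderiv \<sigma>1 (q 0) b) +
     zB (u 0) * (1 + 4 * cos (u 0)) * (mu t * fderiv \<sigma>2 (q 0) b)) / N"
    have alg: "c * (0 + (Z * y + ((F * y * G1 + 0 * s) + (B * y * G2 + 0 * k)) / N)) = c * ((Z + (F * G1 + B * G2) / N) * y)"
      for Z y F G1 s B G2 k :: real
      by (simp add: add_divide_distrib distrib_left distrib_right mult_ac)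
    have D: "((\<lambda>x. c * (g (q x) + (zb \<eta> (S1 t (q x)) (S2 t (q x)) (u x) +
       (slope_factor (S1 t (q x)) (S2 t (q x)) (u x) * (lam t * fderiv \<sigma>1 (q x) b) +
        zC (u x) * (mu t * fderiv \<sigma>2 (q x) b)) / N))) has_real_derivative c * (?R * ?y)) (at 0)"
      by (rule DERIV_cong[OF _ alg[where s = "slope_factor (S1 t (q 0)) (S2 t (q 0)) (u 0)" and k = "zC (u 0)"]])
        (intro DERIV_cmult DERIV_add DERIV_cdivide const[OF g] zb_has_derivative_phase[OF dS1 dS2 du]
          DERIV_mult[OF slope_factor_has_derivative_phase[OF dS1 dS2 du] dG1]
          DERIV_mult[OF DERIV_chain2[OF zC_has_derivative du] dG2])
    have eq: "(\<lambda>x. c * (g (q x) + (zb \<eta> (S1 t (q x)) (S2 t (q x)) (u x) +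
       (slope_factor (S1 t (q x)) (S2 t (q x)) (u x) * (lam t * fderiv \<sigma>1 (q x) b) +
        zC (u x) * (mu t * fderiv \<sigma>2 (q x) b)) / N))) =
      (\<lambda>x. c * (g (base (e + x *\<^sub>R v, t)) +
        fderiv wave ((e + x *\<^sub>R v, t), base (e + x *\<^sub>R v, t)) (0, b)))"
      unfolding wave_derivative_target q_def u_def ..
    have "c * (?R * ?y) = 0" by (rule DERIV_unique[OF D[unfolded eq] slope0])
    moreover have "?R > 0" by (rule fold_nondegenerate[OF f])
    moreover have "?y \<noteq> 0" using \<open>r' \<noteq> 0\<close> vb N(1) by simp
    ultimately show False using c by simp
  qed
qed

lemma abs_slope_factor_le: "\<bar>slope_factor (S1 t w) (S2 t w) u\<bar> \<le> 17"
proof -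
  let ?z = "zb \<eta> (S1 t w) (S2 t w) u"
  note s = S_bounds[of t w]
  have "\<bar>S2 t w * zB u\<bar> \<le> 1 * 2" unfolding abs_mult[of "S2 t w"] using s zB_bounds[of u] by (intro mult_mono) auto
  moreover have "\<bar>\<eta> * S1 t w * sin u\<bar> \<le> 1 * 1 * 1"
    unfolding abs_mult[of _ "sin u"] abs_mult[of \<eta> "S1 t w"] using s \<eta> by (intro mult_mono) auto
  ultimately have z: "\<bar>?z\<bar> \<le> 3" unfolding zb_def by linarith
  have "\<bar>?z * sin u\<bar> \<le> 3 * 1" unfolding abs_mult[of ?z] using z by (intro mult_mono) auto
  moreover have "\<bar>S1 t w * (cos u)\<^sup>2\<bar> \<le> 1 * 1"
    unfolding abs_mult[of "S1 t w"] using s by (intro mult_mono) (auto simp: abs_square_le_1)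
  then have "\<bar>cos u + 4 * (S1 t w * (cos u)\<^sup>2)\<bar> \<le> 5" using abs_cos_le_one[of u] by linarith
  then have "\<bar>cos u + 4 * S1 t w * (cos u)\<^sup>2\<bar> \<le> 5" by (simp add: mult.assoc)
  then have "\<bar>\<eta> * (cos u + 4 * S1 t w * (cos u)\<^sup>2)\<bar> \<le> 1 * 5"
    unfolding abs_mult[of \<eta>] using \<eta> by (intro mult_mono) auto
  ultimately show ?thesis unfolding slope_factor_def by (simp add: mult.assoc)
qed

text \<open>The gain comes from \<open>zb_ge\<close> and grows with the speed. The loss
  \<open>24 * D\<close> does not: it is 17 from \<open>slope_factor\<close> plus 7 from
  \<open>zC\<close>, times the rate of switching.\<close>

lemma wave_derivative_time_ge:
  assumes sp: "0 \<le> sp" and D: "\<And>t. \<bar>deriv lam t\<bar> \<le> D" "\<And>t. \<bar>deriv mu t\<bar> \<le> D"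
  shows "(sp * (S2 t (base (e, t)) / 10 - \<eta>) - 24 * D) / N \<le> fderiv wave ((e, t), base (e, t)) ((0, 1), 0)"
proof -
  let ?w = "base (e, t)" let ?u = "phase (e, t)"
  have "S2 t ?w / 10 - \<eta> \<le> zb \<eta> (S1 t ?w) (S2 t ?w) ?u" using S_bounds \<eta> by (intro zb_ge) auto
  then have 1: "sp * (S2 t ?w / 10 - \<eta>) \<le> zb \<eta> (S1 t ?w) (S2 t ?w) ?u * sp"
    unfolding mult.commute[of _ sp] by (rule mult_left_mono[OF _ sp])
  have "\<bar>deriv lam t\<bar> * \<bar>\<sigma>1 ?w\<bar> \<le> D * 1" "\<bar>deriv mu t\<bar> * \<bar>\<sigma>2 ?w\<bar> \<le> D * 1"
    by (rule mult_mono; use D[of t] bounds(1-4)[of ?w] in auto)+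
  then have d: "\<bar>deriv lam t * \<sigma>1 ?w\<bar> \<le> D" "\<bar>deriv mu t * \<sigma>2 ?w\<bar> \<le> D" by (simp_all add: abs_mult)
  have "\<bar>slope_factor (S1 t ?w) (S2 t ?w) ?u * (deriv lam t * \<sigma>1 ?w)\<bar> \<le> 17 * D"
    unfolding abs_mult[of "slope_factor _ _ _"] using abs_slope_factor_le d by (intro mult_mono) auto
  moreover have "\<bar>zC ?u * (deriv mu t * \<sigma>2 ?w)\<bar> \<le> 7 * D"
    unfolding abs_mult[of "zC _"] using abs_zC_le d by (intro mult_mono) auto
  ultimately show ?thesis
    unfolding wave_derivative_parameter using 1 N(1) by (intro divide_right_mono) (auto simp: abs_le_iff)
qed

end

section \<open>Zigzags on a moving graph in one chart\<close>

lemma linear_inj_if_kernel_trivial: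
  fixes L :: "'e::real_vector \<Rightarrow> 'f::real_vector"
  assumes "linear L" "\<And>v. L v = 0 \<Longrightarrow> v = 0"
  shows "inj L"
  using assms linear_injective_0 by blast

text \<open>The zigzags ride on the graph of \<open>Z\<close>. As \<open>Z\<close> sees only time
  and the foot point, it leaves the Legendrian condition and the analysis of the folds intact and
  enters positivity through its time derivative. \<open>base_in\<close> keeps the foot points where
  \<open>Z\<close> is smooth.\<close>

locale zigzag_jet = zigzag "axis k 1 :: real^'n" \<sigma>1 \<sigma>2 lam mu \<eta> N sp
  for k and \<sigma>1 \<sigma>2 :: "real^'n \<Rightarrow> real" and lam mu \<eta> N sp +
  fixes \<Omega> :: "(real^'n) set" and Z :: "real \<times> (real^'n) \<Rightarrow> real" and \<epsilon> :: real
  assumes \<Omega>: "open \<Omega>" and Z: "smooth_on (UNIV \<times> \<Omega>) Z" and \<epsilon>: "0 < \<epsilon>"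
    and base_in: "\<And>e t. e \<in> \<Omega> \<Longrightarrow> base (e, t) \<in> \<Omega>"
begin

definition family :: "((real^'n) \<times> real) \<times> (real^'n) \<Rightarrow> real" where
  "family z = \<epsilon> * (Z (snd (fst z), snd z) + wave z)"

lemma open_sets: "open (UNIV \<times> \<Omega>)" "open (\<Omega> \<times> UNIV)"
  using \<Omega> by (simp_all add: open_Times)

lemma smooth_on_family: "smooth_on (UNIV \<times> \<Omega>) family"
proof -
  have o: "open (UNIV \<times> \<Omega> :: (((real^'n) \<times> real) \<times> (real^'n)) set)" using \<Omega> by (simp add: open_Times)
  have "smooth_on (UNIV \<times> \<Omega> :: (((real^'n) \<times> real) \<times> (real^'n)) set) (\<lambda>z. Z (snd (fst z), snd z))"
    by (rule smooth_on_compose[OF o open_sets(1) _ _ Z]) (auto intro!: smooth_on_intros o)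
  then show ?thesis
    unfolding family_def[abs_def]
    by (intro smooth_on_intros o smooth_on_subset[OF smooth_on_wave] subset_UNIV)
qed

lemma family_derivative:
  assumes "w \<in> \<Omega>"
  shows "fderiv family (\<omega>, w) v =
    \<epsilon> * (fderiv Z (snd \<omega>, w) (snd (fst v), snd v) + fderiv wave (\<omega>, w) v)"
proof -
  have "((\<lambda>z. (snd (fst z), snd z)) has_derivative (\<lambda>v. (snd (fst v), snd v))) (at (\<omega>, w))"
    by (intro has_derivative_Pair has_derivative_snd has_derivative_fst has_derivative_ident)
  moreover have "(Z has_derivative fderiv Z (snd \<omega>, w)) (at (snd (fst (\<omega>, w)), snd (\<omega>, w)))"
    using smooth_on_has_derivative[OF Z, of "(snd \<omega>, w)"] assms by simp
  ultimately have "((\<lambda>z. Z (snd (fst z), snd z)) has_derivative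
      (\<lambda>v. fderiv Z (snd \<omega>, w) (snd (fst v), snd v))) (at (\<omega>, w))"
    by (rule has_derivative_compose)
  from has_derivative_mult_right[OF has_derivative_add[OF this smooth_on_has_derivative[OF smooth_on_wave UNIV_I]], of \<epsilon>]
  have "(family has_derivative (\<lambda>v. \<epsilon> * (fderiv Z (snd \<omega>, w) (snd (fst v), snd v)
      + fderiv wave (\<omega>, w) v))) (at (\<omega>, w))"
    unfolding family_def[abs_def] .
  from fun_cong[OF frechet_derivative_at[OF this]] show ?thesis by simp
qed

lemma Z_linear: "w \<in> \<Omega> \<Longrightarrow> linear (fderiv Z (t, w))"
  using has_derivative_linear[OF smooth_on_has_derivative[OF Z, of "(t, w)"]] by simp

lemma jet_map_smooth: "smooth_on (\<Omega> \<times> UNIV) (jet_map base family)"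
  by (rule smooth_on_jet_map(2)[OF open_sets(2) smooth_on_base[OF open_sets(2)] _ smooth_on_family])
     (use \<Omega> base_in in \<open>auto simp: open_Times\<close>)

lemma jet_map_conditions:
  assumes e: "e \<in> \<Omega>"
    and pos: "fderiv Z (t, base (e, t)) (1, 0) +
      fderiv wave ((e, t), base (e, t)) ((0, 1), 0) > 0"
  shows "contact_form (jet_map base family (e, t)) (fderiv (jet_map base family) (e, t) (v, 0)) = 0"
    "contact_form (jet_map base family (e, t)) (fderiv (jet_map base family) (e, t) (0, 1)) \<noteq> 0"
    "inj (\<lambda>v. fderiv (jet_map base family) (e, t) (v, 0))"
proof -
  let ?D = "fderiv (jet_map base family) (e, t)"
  have o: "open (UNIV \<times> \<Omega> :: (((real^'n) \<times> real) \<times> (real^'n)) set)" using \<Omega> by (simp add: open_Times)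
  have in_T: "\<forall>\<omega>\<in>\<Omega> \<times> UNIV. (\<omega>, base \<omega>) \<in> UNIV \<times> \<Omega>" using base_in by auto
  have et: "(e, t) \<in> \<Omega> \<times> UNIV" using e by simp
  note D = jet_map_derivative[OF open_sets(2) smooth_on_base[OF open_sets(2)] o smooth_on_family in_T et]
  note F = family_derivative[OF base_in[OF e, of t], of "(e, t)"]
  show "contact_form (jet_map base family (e, t)) (?D (v, 0)) = 0"
    unfolding D(1) F using linear_0[OF Z_linear[OF base_in[OF e]]] wave_derivative_parameter[of e t v 0]
    by (simp add: zero_prod_def)
  show "contact_form (jet_map base family (e, t)) (?D (0, 1)) \<noteq> 0"
    unfolding D(1) F using pos \<epsilon> by simp
  have dJ: "(jet_map base family has_derivative ?D) (at (e, t))"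
    by (rule smooth_on_has_derivative[OF jet_map_smooth et])
  have "linear (\<lambda>v. ?D (v, 0))"
    by (rule bounded_linear.linear[OF bounded_linear_compose[OF has_derivative_bounded_linear[OF dJ]
          bounded_linear_Pair[OF bounded_linear_ident bounded_linear_zero]]])
  then show "inj (\<lambda>v. ?D (v, 0))"
  proof (rule linear_inj_if_kernel_trivial)
    fix v assume v: "?D (v, 0) = 0"
    let ?P = "\<lambda>\<omega>. fderiv family (\<omega>, base \<omega>) (0, axis k 1)"
    let ?g = "\<lambda>w. fderiv Z (t, w) (0, axis k 1)"
    have b0: "fderiv base (e, t) (v, 0) = 0" using D(2)[of "(v, 0)"] v by simp
    have P0: "fderiv ?P (e, t) (v, 0) = 0" using D(3)[of "(v, 0)" k] v by simp
    have "smooth_on (\<Omega> \<times> UNIV) ?P"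
      by (rule smooth_on_jet_map(1)[OF open_sets(2) smooth_on_base[OF open_sets(2)] o smooth_on_family in_T])
    then have "(?P has_derivative fderiv ?P (e, t)) (at ((e, t) + 0 *\<^sub>R (v, 0)))"
      using smooth_on_has_derivative[OF _ et] by simp
    from frechet_derivative_path[OF this]
    have P': "((\<lambda>x. ?P (e + x *\<^sub>R v, t)) has_vector_derivative 0) (at 0)" by (simp add: P0)
    have "continuous_on UNIV (\<lambda>x::real. e + x *\<^sub>R v)" by (intro continuous_intros)
    then have op: "open {x::real. e + x *\<^sub>R v \<in> \<Omega>}" using open_vimage[OF \<Omega>] by (simp add: vimage_def)
    have "((\<lambda>x. \<epsilon> * (?g (base (e + x *\<^sub>R v, t)) +
        fderiv wave ((e + x *\<^sub>R v, t), base (e + x *\<^sub>R v, t)) (0, axis k 1))) has_vector_derivative 0) (at 0)"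
      by (rule has_vector_derivative_transform_within_open[OF P' op]) (use e base_in in \<open>simp_all add: family_derivative\<close>)
    then have slope0: "((\<lambda>x. \<epsilon> * (?g (base (e + x *\<^sub>R v, t)) +
        fderiv wave ((e + x *\<^sub>R v, t), base (e + x *\<^sub>R v, t)) (0, axis k 1))) has_real_derivative 0) (at 0)"
      by (simp add: has_real_derivative_iff_has_vector_derivative)
    have "smooth_on \<Omega> ?g"
      by (rule smooth_on_compose[OF \<Omega> open_sets(1) _ _ smooth_on_frechet_derivative[OF Z]]) (auto intro!: smooth_on_intros \<Omega>)
    from zigzag_immersive[OF smooth_on_has_derivative[OF this base_in[OF e]] _ b0 slope0] \<epsilon>
    show "v = 0" by simp
  qed
qed

end

text \<open>In one period the pattern moves by a whole number \<open>n\<close> of waves; uniqueness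
  of the shift does the rest.\<close>

lemma (in zigzag) base_wave_periodic:
  assumes "\<And>t. lam (t + 1) = lam t" "\<And>t. mu (t + 1) = mu t" "sp = 2 * pi * real n"
  shows "base (e, t + 1) = base (e, t)" "wave ((e, t + 1), w) = wave ((e, t), w)"
proof -
  have p: "phase (e, t + 1) = phase (e, t) + 2 * pi * real n" unfolding phase_def by (simp add: assms algebra_simps)
  have sc: "sin (phase (e, t + 1)) = sin (phase (e, t))" "cos (phase (e, t + 1)) = cos (phase (e, t))"
    unfolding p using sin.plus_of_nat[of "phase (e, t)" n] cos.plus_of_nat[of "phase (e, t)" n]
    by (simp_all add: mult_ac)
  have "shift (e, t) = shift (e, t + 1)"
    using shift(2)[of "shift (e, t)" "(e, t + 1)"] shift(2)[of "shift (e, t)" "(e, t)"]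
    by (simp add: za_def sc assms(1,2))
  then show "base (e, t + 1) = base (e, t)" unfolding base_def by simp
  show "wave ((e, t + 1), w) = wave ((e, t), w)"
    unfolding wave_def by (simp add: zc_def zb_def za_def zB_def zC_def sc assms(1,2))
qed

text \<open>Without zigzags the family does not depend on the space parameter, so its envelope is
  the graph itself and the foot point is the parameter.\<close>

lemma jet_map_still:
  fixes Z :: "real \<times> (real^'n) \<Rightarrow> real" and \<epsilon> :: real
  defines "h \<equiv> \<lambda>z. \<epsilon> * Z (snd (fst z), snd z)"
  assumes \<Omega>: "open \<Omega>" and Z: "smooth_on (UNIV \<times> \<Omega>) Z"
  shows "smooth_on (UNIV \<times> \<Omega>) h" "smooth_on (\<Omega> \<times> UNIV) (jet_map fst h)"
    and "e \<in> \<Omega> \<Longrightarrow> contact_form (jet_map fst h (e, t)) (fderiv (jet_map fst h) (e, t) (v, 0)) = 0"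
    "e \<in> \<Omega> \<Longrightarrow> contact_form (jet_map fst h (e, t)) (fderiv (jet_map fst h) (e, t) (0, 1)) =
      \<epsilon> * fderiv Z (t, e) (1, 0)"
    "e \<in> \<Omega> \<Longrightarrow> inj (\<lambda>v. fderiv (jet_map fst h) (e, t) (v, 0))"
proof -
  have o: "open (UNIV \<times> \<Omega> :: (((real^'n) \<times> real) \<times> (real^'n)) set)" "open (UNIV \<times> \<Omega> :: (real \<times> (real^'n)) set)"
    "open (\<Omega> \<times> UNIV :: ((real^'n) \<times> real) set)" using \<Omega> by (simp_all add: open_Times)
  have sZ: "smooth_on (UNIV \<times> \<Omega> :: (((real^'n) \<times> real) \<times> (real^'n)) set) (\<lambda>z. Z (snd (fst z), snd z))"
    by (rule smooth_on_compose[OF o(1,2) _ _ Z]) (auto intro!: smooth_on_intros o)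
  show h: "smooth_on (UNIV \<times> \<Omega>) h" unfolding h_def by (intro smooth_on_mult smooth_on_const o sZ)
  have f: "smooth_on (\<Omega> \<times> UNIV) (fst :: (real^'n) \<times> real \<Rightarrow> real^'n)"
    by (rule smooth_on_bounded_linear[OF bounded_linear_fst o(3)])
  have in_T: "\<forall>\<omega>\<in>\<Omega> \<times> (UNIV :: real set). (\<omega>, fst \<omega>) \<in> UNIV \<times> \<Omega>" by auto
  show J: "smooth_on (\<Omega> \<times> UNIV) (jet_map fst h)" by (rule smooth_on_jet_map(2)[OF o(3) f o(1) h in_T])
  assume e: "e \<in> \<Omega>"
  then have et: "(e, t) \<in> \<Omega> \<times> UNIV" by simp
  let ?D = "fderiv (jet_map fst h) (e, t)"
  note D = jet_map_derivative[OF o(3) f o(1) h in_T et]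
  have "((\<lambda>z. (snd (fst z), snd z)) has_derivative (\<lambda>v. (snd (fst v), snd v))) (at ((e, t), e))"
    by (intro has_derivative_Pair has_derivative_snd has_derivative_fst has_derivative_ident)
  moreover have dZ: "(Z has_derivative fderiv Z (t, e)) (at (t, e))"
    by (rule smooth_on_has_derivative[OF Z]) (use e in simp)
  ultimately have "((\<lambda>z. Z (snd (fst z), snd z)) has_derivative
      (\<lambda>v. fderiv Z (t, e) (snd (fst v), snd v))) (at ((e, t), e))"
    by (intro has_derivative_compose[of "\<lambda>z. (snd (fst z), snd z)" _ "((e, t), e)" UNIV Z]) simp_all
  from has_derivative_mult_right[OF this, of \<epsilon>]
  have "(h has_derivative (\<lambda>v. \<epsilon> * fderiv Z (t, e) (snd (fst v), snd v))) (at ((e, t), e))"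
    unfolding h_def .
  from fun_cong[OF frechet_derivative_at[OF this]]
  have F: "fderiv h ((e, t), fst (e, t)) v = \<epsilon> * fderiv Z (t, e) (snd (fst v), snd v)" for v
    by simp
  show "contact_form (jet_map fst h (e, t)) (?D (v, 0)) = 0"
    unfolding D(1) F using linear_0[OF has_derivative_linear[OF dZ]] by (simp add: zero_prod_def)
  show "contact_form (jet_map fst h (e, t)) (?D (0, 1)) = \<epsilon> * fderiv Z (t, e) (1, 0)"
    unfolding D(1) F by simp
  have "fderiv fst (e, t) = fst"
    by (rule frechet_derivative_at[symmetric]) (rule bounded_linear_imp_has_derivative[OF bounded_linear_fst])
  then have "fst (?D (v, 0)) = v" for v unfolding D(2) by simp
  then show "inj (\<lambda>v. ?D (v, 0))" by (intro inj_on_inverseI[where g = fst])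
qed


section \<open>Periodic pulses\<close>

lemma periodic_plus_nat:
  fixes f :: "real \<Rightarrow> 'b"
  assumes "\<And>t. f (t + 1) = f t"
  shows "f (t + real n) = f t"
proof (induction n)
  case (Suc n)
  have "f (t + real (Suc n)) = f ((t + real n) + 1)" by (simp add: algebra_simps)
  then show ?case using assms Suc by simp
qed simp

lemma periodic_frac:
  fixes f :: "real \<Rightarrow> 'b"
  assumes "\<And>t. f (t + 1) = f t"
  shows "f (frac t) = f t"
proof (cases "0 \<le> \<lfloor>t\<rfloor>")
  case True
  then have "frac t + real (nat \<lfloor>t\<rfloor>) = t" by (simp add: frac_def)
  then show ?thesis using periodic_plus_nat[of f "frac t" "nat \<lfloor>t\<rfloor>", OF assms] by simp
next
  case False
  then have "t + real (nat (- \<lfloor>t\<rfloor>)) = frac t" by (simp add: frac_def)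
  then show ?thesis using periodic_plus_nat[of f t "nat (- \<lfloor>t\<rfloor>)", OF assms] by simp
qed

lemma periodic_bounded:
  fixes f :: "real \<Rightarrow> real"
  assumes "\<And>t. f (t + 1) = f t" "continuous_on UNIV f"
  obtains D where "\<And>t. \<bar>f t\<bar> \<le> D"
proof -
  have "compact (f ` {0..1})" using assms(2) by (intro compact_continuous_image) (auto intro: continuous_on_subset)
  then obtain D where D: "\<And>x. x \<in> f ` {0..1} \<Longrightarrow> norm x \<le> D" using compact_imp_bounded bounded_iff by metis
  have "\<bar>f t\<bar> \<le> D" for t
  proof -
    have "frac t \<in> {0..1}" using frac_lt_1[of t] by (simp add: less_imp_le)
    from D[OF imageI[OF this, of f]] show ?thesis by (simp add: periodic_frac[of f, OF assms(1)])
  qed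
  then show ?thesis by (rule that)
qed

lemma periodic_deriv:
  fixes f :: "real \<Rightarrow> real"
  assumes "smooth_on UNIV f" "\<And>t. f (t + 1) = f t"
  shows "deriv f (t + 1) = deriv f t"
proof -
  have "(f has_real_derivative deriv f (t + 1)) (at (t + 1))" by (rule smooth_on_deriv(1)[OF assms(1)])
  then have "((\<lambda>x. f (x + 1)) has_real_derivative deriv f (t + 1)) (at t)" by (simp add: DERIV_shift)
  then have "(f has_real_derivative deriv f (t + 1)) (at t)" by (simp add: assms(2))
  then show ?thesis by (rule DERIV_imp_deriv[symmetric])
qed

text \<open>\<open>M\<close> is the integral of \<open>f\<close> over a period; subtracting it
  removes the drift of the primitive. It is positive because \<open>f\<close> is nonnegative and
  positive at 0.\<close>

lemma periodic_primitive:
  fixes f :: "real \<Rightarrow> real"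
  assumes f: "smooth_on UNIV f" "\<And>t. f (t + 1) = f t" "\<And>t. 0 \<le> f t" "0 < f 0"
  obtains Y M where "0 < M" "smooth_on UNIV Y" "\<And>t. Y (t + 1) = Y t"
    "\<And>t. (Y has_real_derivative (f t - M)) (at t)"
proof -
  define F where "F x = (LBINT y=0..ereal x. f y)" for x
  have cont: "continuous_on S f" for S using smooth_on_continuous_on[OF f(1)] continuous_on_subset by blast
  have dF: "(F has_real_derivative f x) (at x)" for x
  proof -
    let ?a = "- \<bar>x\<bar> - 1" and ?b = "\<bar>x\<bar> + 1"
    have "((\<lambda>u. LBINT y=ereal 0..ereal u. f y) has_vector_derivative f x) (at x within {?a..?b})"
      by (rule interval_integral_FTC2) (auto intro: cont)
    moreover have "at x within {?a..?b} = at x"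
      by (rule at_within_interior) auto
    ultimately show ?thesis
      by (simp add: F_def[abs_def] has_real_derivative_iff_has_vector_derivative zero_ereal_def)
  qed
  define M where "M = F 1 - F 0"
  have dd: "((\<lambda>x. F (x + 1) - F x) has_real_derivative 0) (at x)" for x
  proof -
    have "((\<lambda>x. F (x + 1)) has_real_derivative f (x + 1)) (at x)" using dF[of "x + 1"] by (simp add: DERIV_shift)
    from DERIV_diff[OF this dF[of x]] show ?thesis by (simp add: f(2))
  qed
  have per: "F (x + 1) - F x = M" for x
    using DERIV_isconst_all[of "\<lambda>x. F (x + 1) - F x" x 0] dd by (simp add: M_def)
  have "M > 0"
  proof -
    obtain d where d: "d > 0" "\<And>h. h > 0 \<Longrightarrow> h < d \<Longrightarrow> F 0 < F (0 + h)"
      using DERIV_pos_inc_right[OF dF f(4)] by blast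
    let ?h = "min (d / 2) 1"
    have "F 0 < F ?h" using d(2)[of ?h] d(1) by simp
    also have "F ?h \<le> F 1"
    proof (rule DERIV_nonneg_imp_nondecreasing[where f = F])
      show "\<exists>y. (F has_real_derivative y) (at x) \<and> 0 \<le> y" for x using dF f(3) by blast
    qed simp
    finally show ?thesis by (simp add: M_def)
  qed
  define Y where "Y x = F x - M * x" for x
  have dY: "(Y has_real_derivative (f t - M)) (at t)" for t
    unfolding Y_def using dF by (auto intro!: derivative_eq_intros)
  have "smooth_on UNIV Y"
    by (rule smooth_on_real_primitive[OF open_UNIV dY]) (intro smooth_on_intros f(1) open_UNIV)
  moreover have "Y (t + 1) = Y t" for t using per[of t] by (simp add: Y_def algebra_simps)
  ultimately show ?thesis using that \<open>M > 0\<close> dY by blast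
qed

text \<open>The squared sine of \<open>pi * t\<close> has period 1 and measures the distance to the
  integers smoothly. The threshold 3 is used for the first amplitude and 2 for the second: the
  difference 1 is the length of the step, so the first pulse is full as long as the second is
  on.\<close>

definition pulse :: "real \<Rightarrow> real \<Rightarrow> real \<Rightarrow> real" where
  "pulse \<kappa> a t = smooth_step (a - 4 * (sin (pi * t) / \<kappa>)\<^sup>2)"

lemma smooth_on_pulse: "smooth_on UNIV (pulse \<kappa> a)"
  unfolding pulse_def[abs_def] divide_inverse
  by (intro smooth_on_compose_UNIV[OF smooth_on_smooth_step] smooth_on_intros open_UNIV)

lemma pulse_periodic: "pulse \<kappa> a (t + 1) = pulse \<kappa> a t"
  by (simp add: pulse_def distrib_left)

lemma pulse_bounds: "0 \<le> pulse \<kappa> a t" "pulse \<kappa> a t \<le> 1"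
  by (simp_all add: pulse_def smooth_step_nonneg smooth_step_le_1)

lemma pulse_full: "pulse \<kappa> 2 t \<noteq> 0 \<Longrightarrow> pulse \<kappa> 3 t = 1"
  using smooth_step_le_0[of "2 - 4 * (sin (pi * t) / \<kappa>)\<^sup>2"] smooth_step_ge_1[of "3 - 4 * (sin (pi * t) / \<kappa>)\<^sup>2"]
  unfolding pulse_def by linarith

lemma pulse_0: "pulse \<kappa> 2 0 = 1"
  by (simp add: pulse_def smooth_step_ge_1)

text \<open>\<open>4 * (7 / 8)\<^sup>2\<close> exceeds the threshold 3. The gap between 7 / 8 and 1
  gives every time outside \<open>active\<close> a neighbourhood on which the pulse
  vanishes.\<close>

lemma pulse_eq_0:
  assumes "0 < \<kappa>" "\<bar>sin (pi * t)\<bar> \<ge> 7 / 8 * \<kappa>"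
  shows "pulse \<kappa> 3 t = 0"
proof -
  have "\<bar>sin (pi * t) / \<kappa>\<bar> \<ge> 7 / 8" using assms by (simp add: field_simps)
  then have "(7 / 8)\<^sup>2 \<le> (sin (pi * t) / \<kappa>)\<^sup>2" by (intro abs_le_square_iff[THEN iffD1]) simp
  moreover have "(7 / 8 :: real)\<^sup>2 = 49 / 64" by (simp add: power2_eq_square)
  ultimately show ?thesis unfolding pulse_def by (intro smooth_step_le_0) linarith
qed

text \<open>The link between the two descriptions of the loop: jets of functions on the manifold,
  which make sense globally, and \<open>jet_map\<close> of a family, for which the contact form is
  computed.\<close>

lemma jet1_jet_map:
  fixes A :: "('a, real^'n) atlas" and h :: "'w::euclidean_space \<times> (real^'n) \<Rightarrow> real"
  assumes A: "smooth_atlas A" "(U, c) \<in> A" and h: "smooth_on (UNIV \<times> c ` U) h" and q: "q \<omega> \<in> c ` U"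
    and f: "\<And>y. y \<in> U \<Longrightarrow> f y = h (\<omega>, c y)"
  shows "jet1 A (inv_into U c (q \<omega>)) f \<in> J1 A"
    "jet_coords (U, c) (jet1 A (inv_into U c (q \<omega>)) f) = jet_map q h \<omega>"
proof -
  define x where "x = inv_into U c (q \<omega>)"
  have x: "x \<in> U" "c x = q \<omega>" unfolding x_def by (simp_all add: chart_inverse[OF A] q)
  have o: "open (c ` U)" by (rule smooth_atlasD(2)[OF A A(2)])
  have o2: "open ((UNIV :: 'w set) \<times> c ` U)" using o by (simp add: open_Times)
  have s: "smooth_on (c ` U) (\<lambda>e. h (\<omega>, e))"
    by (rule smooth_on_compose[OF o o2 _ _ h]) (auto intro!: smooth_on_intros o)
  have n: "smooth_near A x f" by (rule smooth_nearI[OF A o s]) (use x q f in auto)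
  have "((\<lambda>e. (\<omega>, e)) has_derivative (\<lambda>v. (0, v))) (at (q \<omega>))"
    by (rule has_derivative_Pair[OF has_derivative_const has_derivative_ident])
  moreover have "(h has_derivative fderiv h (\<omega>, q \<omega>)) (at (\<omega>, q \<omega>))"
    by (rule smooth_on_has_derivative[OF h]) (use q in simp)
  ultimately have "((\<lambda>e. h (\<omega>, e)) has_derivative (\<lambda>v. fderiv h (\<omega>, q \<omega>) (0, v))) (at (q \<omega>))"
    by (rule has_derivative_compose)
  then have "((f \<circ> inv_into U c) has_derivative (\<lambda>v. fderiv h (\<omega>, q \<omega>) (0, v))) (at (q \<omega>))"
    by (rule has_derivative_transform_within_open[OF _ o q]) (auto simp: chart_inverse[OF A] f)
  note D = frechet_derivative_at[OF this, symmetric]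
  show "jet_coords (U, c) (jet1 A (inv_into U c (q \<omega>)) f) = jet_map q h \<omega>"
    unfolding x_def[symmetric] jet_coords_jet1[OF A(2) x(1) n] x(2) D jet_map_def using f[OF x(1)] x(2) by simp
  show "jet1 A (inv_into U c (q \<omega>)) f \<in> J1 A"
    unfolding x_def[symmetric] J1_def using n carrier_ofI[OF A(2) x(1)] by blast
qed

section \<open>Finite chart covers, time slots and cutoff functions\<close>

lemma finite_chart_cover:
  fixes A :: "('a, 'e::euclidean_space) atlas"
  assumes "closed_manifold A"
  shows "\<exists>(m::nat) U c y0 r. (\<forall>i<m. (U i, c i) \<in> A \<and> 0 < r i \<and> cball (y0 i) (3 * r i) \<subseteq> c i ` U i) \<and>
    (\<forall>x\<in>carrier_of A. \<exists>i<m. x \<in> U i \<and> dist (y0 i) (c i x) < r i)"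
proof -
  have A: "smooth_atlas A" and comp: "compact_space (atlas_topology A)" using assms by (simp_all add: closed_manifold_def)
  define P where "P = (\<lambda>(U, c, y, r). (U, c) \<in> A \<and> 0 < r \<and> cball y (3 * r) \<subseteq> c ` U)"
  define V :: "'a set \<times> ('a \<Rightarrow> 'e) \<times> 'e \<times> real \<Rightarrow> 'a set" where "V = (\<lambda>(U, c, y, r). U \<inter> c -` ball y r)"
  have "\<forall>W\<in>V ` Collect P. openin (atlas_topology A) W"
    unfolding P_def V_def by (auto intro: openin_atlas_topology_chart)
  moreover have "topspace (atlas_topology A) \<subseteq> \<Union>(V ` Collect P)"
  proof
    fix x assume "x \<in> topspace (atlas_topology A)"
    then obtain U c where U: "(U, c) \<in> A" "x \<in> U" unfolding topspace_atlas_topology by (rule carrier_ofE)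
    have "open (c ` U)" "c x \<in> c ` U" using smooth_atlasD(2)[OF A U(1) U(1)] U(2) by auto
    then obtain e where "e > 0" "cball (c x) e \<subseteq> c ` U" using open_contains_cball by blast
    \<comment> \<open>The balls of radius \<open>r\<close> cover, while those of radius
      \<open>3 * r\<close> make room for the supports of the cutoffs.\<close>
    then have "P (U, c, c x, e / 3)" "x \<in> V (U, c, c x, e / 3)" using U by (auto simp: P_def V_def)
    then show "x \<in> \<Union>(V ` Collect P)" by blast
  qed
  ultimately obtain F where F: "finite F" "F \<subseteq> V ` Collect P" "topspace (atlas_topology A) \<subseteq> \<Union>F"
    using comp unfolding compact_space_alt by meson
  obtain G where G: "G \<subseteq> Collect P" "finite G" "F = V ` G" using finite_subset_image[OF F(1,2)] by auto
  obtain g where g: "bij_betw g {0..<card G} G" using ex_bij_betw_nat_finite[OF G(2)] by blast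
  let ?m = "card G"
  have gP: "P (g i)" if "i < ?m" for i using g G(1) that by (auto simp: bij_betw_def)
  have "\<forall>i<?m. (fst (g i), fst (snd (g i))) \<in> A \<and> 0 < snd (snd (snd (g i))) \<and>
      cball (fst (snd (snd (g i)))) (3 * snd (snd (snd (g i)))) \<subseteq> fst (snd (g i)) ` fst (g i)"
    using gP by (simp add: P_def case_prod_beta')
  moreover have "\<forall>x\<in>carrier_of A. \<exists>i<?m. x \<in> fst (g i) \<and> dist (fst (snd (snd (g i)))) (fst (snd (g i)) x) < snd (snd (snd (g i)))"
  proof
    fix x assume "x \<in> carrier_of A"
    then obtain w where "w \<in> G" "x \<in> V w" using F(3) G(3) unfolding topspace_atlas_topology by blast
    moreover have "g ` {0..<?m} = G" using g by (rule bij_betw_imp_surj_on)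
    ultimately obtain i where "i < ?m" "x \<in> V (g i)" by force
    then show "\<exists>i<?m. x \<in> fst (g i) \<and> dist (fst (snd (snd (g i)))) (fst (snd (g i)) x) < snd (snd (snd (g i)))"
      by (auto simp: V_def case_prod_beta')
  qed
  ultimately show ?thesis
    by (intro exI[of _ ?m] exI[of _ "\<lambda>i. fst (g i)"] exI[of _ "\<lambda>i. fst (snd (g i))"]
        exI[of _ "\<lambda>i. fst (snd (snd (g i)))"] exI[of _ "\<lambda>i. snd (snd (snd (g i)))"] conjI)
qed

definition slot :: "nat \<Rightarrow> nat \<Rightarrow> real" where
  "slot m i = real (i + 1) / real (m + 2)"

text \<open>\<kappa> is half of the smallest sine belonging to a difference of slots. By the
  addition formula, two sines of modulus below \<kappa> at the same time would force the sine of the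
  difference below \<open>2 * \<kappa>\<close>.\<close>

lemma time_slots:
  obtains \<kappa> where "0 < \<kappa>" "\<And>i. i < m \<Longrightarrow> \<kappa> \<le> \<bar>sin (pi * (0 - slot m i))\<bar>"
    "\<And>i j t. i < m \<Longrightarrow> j < m \<Longrightarrow> \<bar>sin (pi * (t - slot m i))\<bar> < \<kappa> \<Longrightarrow> \<bar>sin (pi * (t - slot m j))\<bar> < \<kappa> \<Longrightarrow> i = j"
proof -
  let ?f = "\<lambda>l::nat. sin (pi * (real l / real (m + 2))) / 2"
  have pos: "0 < ?f l" if "l \<in> {1..m + 1}" for l
  proof -
    let ?x = "real l / real (m + 2)"
    have x: "?x < 1" "0 < ?x" using that by auto
    have "0 < pi * ?x" "pi * ?x < pi * 1"
      by (rule mult_pos_pos[OF pi_gt_zero x(2)], rule mult_strict_left_mono[OF x(1) pi_gt_zero])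
    then have "0 < sin (pi * ?x)" by (intro sin_gt_zero) simp_all
    then show ?thesis by (rule half_gt_zero)
  qed
  \<comment> \<open>The index set is nonempty even for \<open>m = 0\<close>, the cover of an empty
    manifold, so that the minimum makes sense.\<close>
  define \<kappa> where "\<kappa> = Min (?f ` {1..m + 1})"
  have \<kappa>0: "0 < \<kappa>" unfolding \<kappa>_def using pos by (subst Min_gr_iff) auto
  have \<kappa>: "2 * \<kappa> \<le> sin (pi * (real l / real (m + 2)))" if "l \<in> {1..m + 1}" for l
    using Min_le[of "?f ` {1..m + 1}" "?f l"] that unfolding \<kappa>_def by auto
  have disj: False if "j < i" "i < m" "\<bar>sin (pi * (t - slot m i))\<bar> < \<kappa>" "\<bar>sin (pi * (t - slot m j))\<bar> < \<kappa>" for i j t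
  proof -
    let ?a = "pi * (t - slot m j)" and ?b = "pi * (t - slot m i)"
    have "slot m i - slot m j = real (i - j) / real (m + 2)"
      using that(1) unfolding slot_def diff_divide_distrib[symmetric] by (simp add: of_nat_diff)
    then have eq: "?a - ?b = pi * (real (i - j) / real (m + 2))"
      unfolding right_diff_distrib[symmetric] by simp
    have "2 * \<kappa> \<le> sin (?a - ?b)" unfolding eq by (rule \<kappa>) (use that(1,2) in auto)
    also have "\<dots> = sin ?a * cos ?b - cos ?a * sin ?b" by (rule sin_diff)
    also have "\<dots> \<le> \<bar>sin ?a\<bar> * 1 + 1 * \<bar>sin ?b\<bar>"
    proof -
      have "\<bar>sin ?a\<bar> * \<bar>cos ?b\<bar> \<le> \<bar>sin ?a\<bar> * 1" "\<bar>cos ?a\<bar> * \<bar>sin ?b\<bar> \<le> 1 * \<bar>sin ?b\<bar>"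
        by (intro mult_left_mono mult_right_mono; simp)+
      then show ?thesis unfolding abs_mult[symmetric] by linarith
    qed
    finally show False using that(3,4) by linarith
  qed
  show ?thesis
  proof (rule that[OF \<kappa>0])
    fix i assume "i < m"
    then have "2 * \<kappa> \<le> sin (pi * slot m i)" using \<kappa>[of "i + 1"] by (simp add: slot_def)
    moreover have "sin (pi * (0 - slot m i)) = - sin (pi * slot m i)" by simp
    ultimately show "\<kappa> \<le> \<bar>sin (pi * (0 - slot m i))\<bar>" using \<kappa>0 by linarith
  next
    fix i j t assume "i < m" "j < m" "\<bar>sin (pi * (t - slot m i))\<bar> < \<kappa>" "\<bar>sin (pi * (t - slot m j))\<bar> < \<kappa>"
    then show "i = j" using disj[of i j t] disj[of j i t] by (cases i j rule: linorder_cases) auto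
  qed
qed

text \<open>The squared distance keeps the function smooth at the centre. Threshold 3 gives 1 on the
  ball of radius \<open>r\<close>; threshold 5 gives 1 wherever the former is nonzero, and its
  support still lies in the ball of radius \<open>3 * r\<close>.\<close>

definition bump :: "'e::euclidean_space \<Rightarrow> real \<Rightarrow> real \<Rightarrow> 'e \<Rightarrow> real" where
  "bump y r a w = smooth_step (a - ((w - y) \<bullet> (w - y)) / r\<^sup>2)"

lemma smooth_on_bump: "smooth_on UNIV (bump y r a)"
  unfolding bump_def[abs_def] divide_inverse
  by (intro smooth_on_compose_UNIV[OF smooth_on_smooth_step] smooth_on_intros open_UNIV)

lemma bump_bounds: "0 \<le> bump y r a w" "bump y r a w \<le> 1"
  by (simp_all add: bump_def smooth_step_nonneg smooth_step_le_1)

lemma bump_full: "bump y r 3 w \<noteq> 0 \<Longrightarrow> bump y r 5 w = 1"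
  using smooth_step_le_0[of "3 - ((w - y) \<bullet> (w - y)) / r\<^sup>2"] smooth_step_ge_1[of "5 - ((w - y) \<bullet> (w - y)) / r\<^sup>2"]
  unfolding bump_def by linarith

lemma bump_eq_1:
  assumes "0 < r" "dist y w < r"
  shows "bump y r 3 w = 1"
proof -
  have "(w - y) \<bullet> (w - y) \<le> r\<^sup>2"
    using assms by (simp add: dist_norm norm_minus_commute power_mono flip: power2_norm_eq_inner)
  then have "((w - y) \<bullet> (w - y)) / r\<^sup>2 \<le> 1" using assms(1) by simp
  then show ?thesis unfolding bump_def by (intro smooth_step_ge_1) linarith
qed

lemma bump_eq_0:
  assumes "0 < r" "w \<notin> cball y (3 * r)" "a \<le> 9"
  shows "bump y r a w = 0"
proof -
  have "(3 * r)\<^sup>2 \<le> (norm (w - y))\<^sup>2"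
    using assms(1,2) by (intro power_mono) (auto simp: dist_norm norm_minus_commute)
  then have "9 * r\<^sup>2 \<le> (w - y) \<bullet> (w - y)" by (simp add: power2_norm_eq_inner power_mult_distrib)
  then have "9 \<le> ((w - y) \<bullet> (w - y)) / r\<^sup>2" using assms(1) by (simp add: field_simps)
  then show ?thesis unfolding bump_def using assms(3) by (intro smooth_step_le_0) linarith
qed

text \<open>Off the closed ball the function is at its minimum 0 and has no derivative to bound; on
  the ball compactness applies.\<close>

lemma bump_derivative_bounded:
  assumes "0 < r"
  obtains C where "\<And>w. \<bar>fderiv (bump y r 5) w v\<bar> \<le> C"
proof -
  let ?g = "\<lambda>w. fderiv (bump y r 5) w v"
  have "continuous_on (cball y (3 * r)) ?g"
    using smooth_on_continuous_on[OF smooth_on_frechet_derivative[OF smooth_on_bump]] continuous_on_subset by blast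
  then have "compact (?g ` cball y (3 * r))" by (intro compact_continuous_image compact_cball)
  then obtain C where C: "\<And>x. x \<in> ?g ` cball y (3 * r) \<Longrightarrow> norm x \<le> C" using compact_imp_bounded bounded_iff by metis
  have "\<bar>?g w\<bar> \<le> max C 0" for w
  proof (cases "w \<in> cball y (3 * r)")
    case True
    then show ?thesis using C[OF imageI[OF True]] by simp
  next
    case False
    then have "bump y r 5 w = 0" using bump_eq_0[OF assms False] by simp
    then have "fderiv (bump y r 5) w = (\<lambda>v. 0)"
      by (intro differential_zero_maxmin[OF UNIV_I open_UNIV smooth_on_has_derivative[OF smooth_on_bump UNIV_I]])
         (simp add: bump_bounds(1))
    then show ?thesis by simp
  qed
  then show ?thesis by (rule that)
qed

section \<open>The loop\<close>

text \<open>\<open>turns\<close> is the condition that the net gain \<open>speed * (M / 20)\<close>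
  beats the switching cost \<open>24 * D\<close>. The zigzags of every chart run in the same
  coordinate direction \<open>k\<close>.\<close>

locale zigzag_loop =
  fixes A :: "('a, real^'n) atlas" and m :: nat and U :: "nat \<Rightarrow> 'a set" and c :: "nat \<Rightarrow> 'a \<Rightarrow> real^'n"
    and y0 :: "nat \<Rightarrow> real^'n" and r :: "nat \<Rightarrow> real" and \<kappa> :: real and Y :: "real \<Rightarrow> real" and M D :: real
    and turns :: nat and N \<epsilon> :: real and k :: 'n
  assumes A: "smooth_atlas A" and Hausdorff: "Hausdorff_space (atlas_topology A)"
    and charts: "\<And>i. i < m \<Longrightarrow> (U i, c i) \<in> A" "\<And>i. i < m \<Longrightarrow> 0 < r i"
      "\<And>i. i < m \<Longrightarrow> cball (y0 i) (3 * r i) \<subseteq> c i ` U i"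
      "\<And>x. x \<in> carrier_of A \<Longrightarrow> \<exists>i<m. x \<in> U i \<and> dist (y0 i) (c i x) < r i"
    and \<kappa>: "0 < \<kappa>" "\<And>i. i < m \<Longrightarrow> \<kappa> \<le> \<bar>sin (pi * (0 - slot m i))\<bar>"
      "\<And>i j t. i < m \<Longrightarrow> j < m \<Longrightarrow> \<bar>sin (pi * (t - slot m i))\<bar> < \<kappa> \<Longrightarrow> \<bar>sin (pi * (t - slot m j))\<bar> < \<kappa> \<Longrightarrow> i = j"
    and Y: "0 < M" "smooth_on UNIV Y" "\<And>t. Y (t + 1) = Y t" "\<And>t. (Y has_real_derivative (pulse \<kappa> 2 t - M)) (at t)"
    and D: "\<And>t. \<bar>deriv (pulse \<kappa> 3) t\<bar> \<le> D" "\<And>t. \<bar>deriv (pulse \<kappa> 2) t\<bar> \<le> D"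
    and turns: "24 * D < 2 * pi * real turns * (M / 20)"
    and N: "0 < N" "\<And>i w. i < m \<Longrightarrow> 8 * \<bar>fderiv (bump (y0 i) (r i) 5) w (axis k 1)\<bar> \<le> N"
    and \<epsilon>: "0 < \<epsilon>"
begin

definition "lam i t = pulse \<kappa> 3 (t - slot m i)"
definition "mu i t = pulse \<kappa> 2 (t - slot m i)"
text \<open>An open set slightly larger than the support of \<open>lam i\<close>: at a time inside
  it the formula with zigzags is valid nearby, and at a time outside it \<open>lam i\<close>
  vanishes nearby.\<close>

definition "active i = {t. \<bar>sin (pi * (t - slot m i))\<bar> < \<kappa>}"
abbreviation "speed \<equiv> 2 * pi * real turns"

text \<open>By periodicity of \<open>Y\<close> and the mean value theorem, \<open>M\<close> is a
  value of the pulse. Hence \<open>M / 20\<close> is admissible as \<eta>.\<close>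

lemma M_le_1: "M \<le> 1"
proof -
  obtain z where "Y 1 - Y 0 = (1 - 0) * (pulse \<kappa> 2 z - M)"
    using MVT2[of 0 1 Y "\<lambda>t. pulse \<kappa> 2 t - M"] Y(4) by auto
  then show ?thesis using Y(3)[of 0] pulse_bounds[of \<kappa> 2 z] by simp
qed

lemma smooth_on_lam_mu: "smooth_on UNIV (lam i)" "smooth_on UNIV (mu i)"
  unfolding lam_def[abs_def] mu_def[abs_def]
  by (intro smooth_on_compose_UNIV[OF smooth_on_pulse] smooth_on_intros open_UNIV)+

lemma lam_mu_periodic: "lam i (t + 1) = lam i t" "mu i (t + 1) = mu i t"
  using pulse_periodic[of \<kappa> _ "t - slot m i"] by (simp_all add: lam_def mu_def algebra_simps)

lemma lam_mu_deriv_bound: "\<bar>deriv (lam i) t\<bar> \<le> D" "\<bar>deriv (mu i) t\<bar> \<le> D"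
proof -
  have "deriv (\<lambda>t. pulse \<kappa> a (t - slot m i)) t = deriv (pulse \<kappa> a) (t - slot m i)" for a
    using smooth_on_deriv(1)[OF smooth_on_pulse, of \<kappa> a "t - slot m i"] DERIV_shift[of "pulse \<kappa> a" _ t "- slot m i"]
    by (intro DERIV_imp_deriv) simp
  then show "\<bar>deriv (lam i) t\<bar> \<le> D" "\<bar>deriv (mu i) t\<bar> \<le> D"
    using D by (simp_all add: lam_def[abs_def] mu_def[abs_def])
qed

lemma open_active: "open (active i)"
  unfolding active_def by (intro open_Collect_less continuous_intros)

lemma active_unique: "i < m \<Longrightarrow> j < m \<Longrightarrow> t \<in> active i \<Longrightarrow> t \<in> active j \<Longrightarrow> i = j"
  using \<kappa>(3) unfolding active_def by blast

lemma zero_not_active: "i < m \<Longrightarrow> 0 \<notin> active i"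
  using \<kappa>(2)[of i] unfolding active_def by auto

lemma lam_eq_0_near:
  assumes "t \<notin> active i"
  obtains T where "open T" "t \<in> T" "\<And>s. s \<in> T \<Longrightarrow> lam i s = 0"
proof -
  have "open {s. 7 / 8 * \<kappa> < \<bar>sin (pi * (s - slot m i))\<bar>}"
    by (intro open_Collect_less continuous_intros)
  moreover have "t \<in> {s. 7 / 8 * \<kappa> < \<bar>sin (pi * (s - slot m i))\<bar>}" using assms \<kappa>(1) by (auto simp: active_def)
  moreover have "lam i s = 0" if "s \<in> {s. 7 / 8 * \<kappa> < \<bar>sin (pi * (s - slot m i))\<bar>}" for s
    unfolding lam_def using that by (intro pulse_eq_0 \<kappa>(1)) auto
  ultimately show ?thesis by (rule that)
qed

lemma lam_mu_inactive: "t \<notin> active i \<Longrightarrow> lam i t = 0" "lam i t = 0 \<Longrightarrow> mu i t = 0"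
  using lam_eq_0_near pulse_full[of \<kappa> "t - slot m i"] unfolding lam_def mu_def by (blast, fastforce)

abbreviation "\<sigma>1 i \<equiv> bump (y0 i) (r i) 5"
abbreviation "\<sigma>2 i \<equiv> bump (y0 i) (r i) 3"
definition "base i = zigzag.base (axis k 1) (\<sigma>1 i) (lam i) N speed"
definition "wave i = zigzag.wave (axis k 1) (\<sigma>1 i) (\<sigma>2 i) (lam i) (mu i) (M / 20) N speed"

lemma zigzag: "i < m \<Longrightarrow> zigzag (axis k 1) (\<sigma>1 i) (\<sigma>2 i) (lam i) (mu i) (M / 20) N"
  using Y(1) M_le_1 N smooth_on_lam_mu smooth_on_bump bump_bounds bump_full pulse_bounds pulse_full
  by unfold_locales (auto simp: inner_axis lam_def mu_def)

text \<open>Either the amplitude at the foot point is 0 and the point has not moved, or the foot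
  point lies in the ball supporting the cutoff.\<close>

lemma base_in_chart:
  assumes i: "i < m" and e: "e \<in> c i ` U i"
  shows "base i (e, t) \<in> c i ` U i"
proof (cases "\<sigma>1 i (base i (e, t)) = 0")
  case True
  then show ?thesis using zigzag.base_inactive(2)[OF zigzag[OF i], where t = t and e = e and sp = speed] e by (simp add: base_def)
next
  case False
  then have "base i (e, t) \<in> cball (y0 i) (3 * r i)" using bump_eq_0[OF charts(2)[OF i], of "base i (e, t)" "y0 i" 5] by auto
  then show ?thesis using charts(3)[OF i] by auto
qed

text \<open>The lift by \<open>height\<close> spends, in the time slot of the chart \<open>i\<close>, what the zigzags gain over the
  support of \<open>weight i\<close>.  It is periodic in time because \<open>Y\<close> is, and raises the front at the same rate,
  proportional to \<open>M\<close>, everywhere else, because the weights add up to 1.\<close>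

definition "plateau i x = (if x \<in> U i then \<sigma>2 i (c i x) else 0)"
definition "weight i x = plateau i x / (\<Sum>j<m. plateau j x)"
definition "height t x = - (speed / (10 * N)) * (\<Sum>i<m. (Y (t - slot m i) - Y (- slot m i)) * weight i x)"

lemma plateau_nonneg: "0 \<le> plateau i x"
  by (simp add: plateau_def bump_bounds)

lemma plateau_sum_ge_1:
  assumes "x \<in> carrier_of A"
  shows "1 \<le> (\<Sum>j<m. plateau j x)"
proof -
  obtain i where i: "i < m" "x \<in> U i" "dist (y0 i) (c i x) < r i" using charts(4)[OF assms] by blast
  then have "plateau i x = 1" using bump_eq_1[OF charts(2)[OF i(1)] i(3)] by (simp add: plateau_def)
  then show ?thesis using member_le_sum[of i "{..<m}" "\<lambda>j. plateau j x"] i(1) plateau_nonneg by simp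
qed

lemma weight_sum: "x \<in> carrier_of A \<Longrightarrow> (\<Sum>i<m. weight i x) = 1"
  using plateau_sum_ge_1[of x] by (simp add: weight_def flip: sum_divide_distrib)

text \<open>The denominator of the weight is at least 1. The upper bound ensures that the lowering
  never exceeds the gain, which is proportional to the cutoff.\<close>

lemma weight_bounds: "x \<in> carrier_of A \<Longrightarrow> 0 \<le> weight i x \<and> weight i x \<le> plateau i x"
  using plateau_sum_ge_1[of x] plateau_nonneg[of i x] mult_left_mono[of 1 "\<Sum>j<m. plateau j x" "plateau i x"]
  by (simp add: weight_def divide_simps)

lemma smooth_function_plateau: "i < m \<Longrightarrow> smooth_function A (plateau i)"
  unfolding plateau_def[abs_def]
  by (rule smooth_function_extend_by_0[OF A charts(1) Hausdorff smooth_on_bump compact_cball charts(3)])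
     (simp_all add: bump_eq_0[OF charts(2)])

definition "height_in V d z = height (fst z) (inv_into V d (snd z))"

lemma height_in_smooth:
  assumes V: "(V, d) \<in> A"
  shows "smooth_on (UNIV \<times> d ` V) (height_in V d)"
proof -
  let ?O = "(UNIV :: real set) \<times> d ` V"
  have o: "open (d ` V)" by (rule smooth_atlasD(2)[OF A V V])
  then have oo: "open ((UNIV :: real set) \<times> d ` V)" by (simp add: open_Times)
  have plateau: "smooth_on (d ` V) (\<lambda>w. plateau i (inv_into V d w))" if "i < m" for i
    using smooth_functionD[OF smooth_function_plateau[OF that] V] by (simp add: o_def)
  have W: "smooth_on (d ` V) (\<lambda>w. weight i (inv_into V d w))" if "i < m" for i
    unfolding weight_def
  proof (intro smooth_on_divide smooth_on_sum o plateau)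
    fix w assume "w \<in> d ` V"
    then have "inv_into V d w \<in> carrier_of A" using chart_inverse(2)[OF A V] carrier_ofI[OF V] by blast
    from plateau_sum_ge_1[OF this] show "(\<Sum>j<m. plateau j (inv_into V d w)) \<noteq> 0" by linarith
  qed (use that in auto)
  have w: "smooth_on ?O (\<lambda>z. weight i (inv_into V d (snd z)))" if "i < m" for i
    by (rule smooth_on_compose[OF oo o _ _ W[OF that], of snd]) (auto intro!: smooth_on_intros oo)
  have Y': "smooth_on ?O (\<lambda>z. Y (fst z - slot m i))" for i
    by (intro smooth_on_compose_UNIV[OF Y(2)] smooth_on_intros oo)
  show ?thesis
    unfolding height_in_def height_def
    by (intro smooth_on_mult smooth_on_const smooth_on_sum smooth_on_diff oo w Y') auto
qed

text \<open>The weights add up to 1, so the terms \<open>M * weight i x\<close> sum to the constant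
  lift. The factor \<open>speed / (10 * N)\<close> is the guaranteed rise of full zigzags apart from
  \<eta> and switching, 1 / 10 being the lower bound of \<open>zB\<close>.\<close>

lemma height_in_derivative:
  assumes V: "(V, d) \<in> A" and x: "x \<in> V"
  shows "fderiv (height_in V d) (t, d x) (1, 0) = (speed / (10 * N)) * (M - (\<Sum>i<m. mu i t * weight i x))"
proof -
  have "(height_in V d has_derivative fderiv (height_in V d) (t, d x)) (at ((t, d x) + 0 *\<^sub>R (1, 0)))"
    using smooth_on_has_derivative[OF height_in_smooth[OF V], of "(t, d x)"] x by simp
  from frechet_derivative_path[OF this]
  have 1: "((\<lambda>s. height (t + s) x) has_vector_derivative fderiv (height_in V d) (t, d x) (1, 0)) (at 0)"
    by (simp add: height_in_def chart_inverse[OF A V] x)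
  have dY: "((\<lambda>s. Y (t + s - slot m i) - Y (- slot m i)) has_real_derivative (mu i t - M)) (at 0)" for i
  proof -
    have "((\<lambda>s. t + s - slot m i) has_real_derivative 1) (at 0)" by (auto intro!: derivative_eq_intros)
    moreover have "(Y has_real_derivative (mu i t - M)) (at (t + 0 - slot m i))" using Y(4)[of "t - slot m i"] by (simp add: mu_def)
    ultimately have "((\<lambda>s. Y (t + s - slot m i)) has_real_derivative (mu i t - M) * 1) (at 0)" by (intro DERIV_chain2)
    then show ?thesis by (auto intro!: derivative_eq_intros)
  qed
  have "((\<lambda>s. height (t + s) x) has_real_derivative
      - (speed / (10 * N)) * (\<Sum>i<m. (mu i t - M) * weight i x)) (at 0)"
    unfolding height_def by (intro DERIV_cmult DERIV_sum DERIV_cmult_right dY)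
  from vector_derivative_unique_at[OF 1 this[unfolded has_real_derivative_iff_has_vector_derivative]]
  have "fderiv (height_in V d) (t, d x) (1, 0) = - (speed / (10 * N)) * (\<Sum>i<m. (mu i t - M) * weight i x)" .
  also have "(\<Sum>i<m. (mu i t - M) * weight i x) = (\<Sum>i<m. mu i t * weight i x) - M"
    using weight_sum[OF carrier_ofI[OF V x]]
    by (simp add: left_diff_distrib sum_subtractf flip: sum_distrib_left)
  finally show ?thesis by (simp add: right_diff_distrib)
qed

definition "still t x = jet1 A x (\<lambda>y. \<epsilon> * height t y)"
definition "moved i t x = jet1 A (inv_into (U i) (c i) (base i (c i x, t)))
  (\<lambda>y. \<epsilon> * (height t y + wave i ((c i x, t), c i y)))"
text \<open>At most one \<open>lam i t\<close> is nonzero, so \<open>THE\<close> selects the chart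
  whose zigzags are on. The cases fit together because \<open>moved\<close> agrees with
  \<open>still\<close> away from the support of the cutoff.\<close>

definition "loop t x = (if \<exists>i<m. lam i t \<noteq> 0 \<and> x \<in> U i
  then moved (THE i. i < m \<and> lam i t \<noteq> 0) t x else still t x)"

lemma moved_eq_still:
  assumes i: "i < m" "x \<in> U i" and off: "lam i t = 0 \<or> c i x \<notin> cball (y0 i) (3 * r i)"
  shows "moved i t x = still t x"
proof -
  have "lam i t * \<sigma>1 i (c i x) = 0" using off bump_eq_0[OF charts(2)[OF i(1)], of "c i x" "y0 i" 5] by auto
  then have "base i (c i x, t) = c i x" unfolding base_def using zigzag.base_inactive(1)[OF zigzag[OF i(1)], where t = t and e = "c i x" and sp = speed] by simp
  then have x: "inv_into (U i) (c i) (base i (c i x, t)) = x" by (simp add: chart_inverse[OF A charts(1)] i)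
  \<comment> \<open>Equality of jets needs equal functions near the point, so an open set is chosen
    on which the wave vanishes identically as a function of the target.\<close>
  let ?S = "if lam i t = 0 then UNIV else - cball (y0 i) (3 * r i)"
  have "same_1jet A x (\<lambda>y. \<epsilon> * (height t y + wave i ((c i x, t), c i y))) (\<lambda>y. \<epsilon> * height t y)"
  proof (rule same_1jet_locally_eq[OF A openin_atlas_topology_chart[OF charts(1)[OF i(1)], of ?S]])
    show "open ?S" by auto
    show "x \<in> U i \<inter> c i -` ?S" using i off by auto
    fix y assume "y \<in> U i \<inter> c i -` ?S"
    then have "lam i t * \<sigma>1 i (c i y) = 0" using bump_eq_0[OF charts(2)[OF i(1)], of "c i y" "y0 i" 5] by (auto split: if_splits)
    then show "\<epsilon> * (height t y + wave i ((c i x, t), c i y)) = \<epsilon> * height t y"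
      unfolding wave_def using zigzag.wave_inactive[OF zigzag[OF i(1)], where \<omega> = "(c i x, t)" and w = "c i y" and sp = speed] by simp
  qed
  from jet1_eqI[OF this] show ?thesis unfolding moved_def still_def x .
qed

lemma loop_moved:
  assumes i: "i < m" "x \<in> U i" "t \<in> active i"
  shows "loop t x = moved i t x"
proof (cases "lam i t = 0")
  case False
  have "(THE i. i < m \<and> lam i t \<noteq> 0) = i"
    by (rule the_equality) (use i False active_unique lam_mu_inactive(1) in blast)+
  then show ?thesis using False i by (auto simp: loop_def)
next
  case True
  have "\<not> (\<exists>j<m. lam j t \<noteq> 0 \<and> x \<in> U j)" using True i active_unique lam_mu_inactive(1) by blast
  then have "loop t x = still t x" unfolding loop_def by (rule if_not_P)
  then show ?thesis using moved_eq_still[OF i(1,2)] True by simp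
qed

lemma loop_still:
  assumes "\<And>i. i < m \<Longrightarrow> x \<in> U i \<Longrightarrow> lam i t = 0 \<or> c i x \<notin> cball (y0 i) (3 * r i)"
  shows "loop t x = still t x"
proof (cases "\<exists>i<m. lam i t \<noteq> 0 \<and> x \<in> U i")
  case True
  then obtain i where i: "i < m" "lam i t \<noteq> 0" "x \<in> U i" by blast
  then have "loop t x = moved i t x" using loop_moved lam_mu_inactive(1) by blast
  then show ?thesis using moved_eq_still[OF i(1,3)] assms[OF i(1,3)] by simp
next
  case False
  then show ?thesis unfolding loop_def by (rule if_not_P)
qed

end

text \<open>Slope and value are linear in the family, so multiplying it by \<epsilon> is the contact
  scaling and does not move the foot point.\<close>

lemma jet_map_scale:
  fixes q :: "'w::euclidean_space \<Rightarrow> real^'n"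
  assumes "smooth_on T F" "(\<omega>, q \<omega>) \<in> T"
  shows "jet_map q (\<lambda>z. \<epsilon> * F z) \<omega> = (q \<omega>, \<epsilon> *\<^sub>R snd (jet_map q F \<omega>))"
proof -
  have "((\<lambda>z. \<epsilon> * F z) has_derivative (\<lambda>v. \<epsilon> * fderiv F (\<omega>, q \<omega>) v)) (at (\<omega>, q \<omega>))"
    by (rule has_derivative_mult_right[OF smooth_on_has_derivative[OF assms]])
  note D = frechet_derivative_at[OF this, symmetric]
  show ?thesis unfolding jet_map_def D by (simp add: vec_eq_iff)
qed

section \<open>The loop in jet coordinates and its positivity\<close>

context zigzag_loop
begin

text \<open>The scale is left free: \<epsilon> itself serves for the loop, and 1 for bounds that
  must be known before \<epsilon> is chosen.\<close>

lemma zigzag_jet: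
  assumes i: "i < m" and e: "0 < \<epsilon>'"
  shows "zigzag_jet k (\<sigma>1 i) (\<sigma>2 i) (lam i) (mu i) (M / 20) N speed (c i ` U i) (height_in (U i) (c i)) \<epsilon>'"
proof -
  have "zigzag_jet_axioms k (\<sigma>1 i) (lam i) N speed (c i ` U i) (height_in (U i) (c i)) \<epsilon>'"
    by unfold_locales
      (use smooth_atlasD(2)[OF A charts(1)[OF i] charts(1)[OF i]] height_in_smooth[OF charts(1)[OF i]] e base_in_chart[OF i]
       in \<open>simp_all add: base_def\<close>)
  then show ?thesis unfolding zigzag_jet_def using zigzag[OF i] by blast
qed

definition "profile i z = height_in (U i) (c i) (snd (fst z), snd z) + wave i z"
definition "level V d z = height_in V d (snd (fst z :: (real^'n) \<times> real), snd z)"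

lemma family_eq: "zigzag_jet.family k (\<sigma>1 i) (\<sigma>2 i) (lam i) (mu i) (M / 20) N speed (height_in (U i) (c i)) \<epsilon>' = (\<lambda>z. \<epsilon>' * profile i z)"
  if "i < m" "0 < \<epsilon>'"
  by (rule ext) (simp add: zigzag_jet.family_def[OF zigzag_jet[OF that]] profile_def wave_def)

lemma smooth_on_profile: "i < m \<Longrightarrow> smooth_on (UNIV \<times> c i ` U i) (\<lambda>z. \<epsilon>' * profile i z)" if "0 < \<epsilon>'"
  using zigzag_jet.smooth_on_family[OF zigzag_jet[OF _ that]] by (simp add: family_eq that)

lemma smooth_on_level: "(V, d) \<in> A \<Longrightarrow> smooth_on (UNIV \<times> d ` V) (\<lambda>z. \<epsilon>' * level V d z)"
  unfolding level_def by (rule jet_map_still(1)[OF smooth_atlasD(2)[OF A] height_in_smooth])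

lemma jet_coords_moved:
  assumes i: "i < m" "x \<in> U i"
  shows "moved i t x \<in> J1 A" "fst (moved i t x) \<in> U i"
    "jet_coords (U i, c i) (moved i t x) = jet_map (base i) (\<lambda>z. \<epsilon> * profile i z) (c i x, t)"
proof -
  note i' = charts(1)[OF i(1)]
  have b: "base i (c i x, t) \<in> c i ` U i" using base_in_chart[OF i(1)] i(2) by blast
  have f: "\<epsilon> * (height t y + wave i ((c i x, t), c i y)) = \<epsilon> * profile i ((c i x, t), c i y)" if "y \<in> U i" for y
    by (simp add: profile_def height_in_def chart_inverse[OF A i'] that)
  note J = jet1_jet_map[where A = A and U = "U i" and c = "c i" and q = "base i" and \<omega> = "(c i x, t)" and
      h = "\<lambda>z. \<epsilon> * profile i z" and f = "\<lambda>y. \<epsilon> * (height t y + wave i ((c i x, t), c i y))",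
      OF A i' smooth_on_profile[OF \<epsilon> i(1)] b f]
  show "moved i t x \<in> J1 A"
    "jet_coords (U i, c i) (moved i t x) = jet_map (base i) (\<lambda>z. \<epsilon> * profile i z) (c i x, t)"
    unfolding moved_def by (rule J; assumption)+
  show "fst (moved i t x) \<in> U i" unfolding moved_def using b by (simp add: chart_inverse[OF A i'])
qed

lemma jet_coords_still:
  assumes V: "(V, d) \<in> A" "x \<in> V"
  shows "still t x \<in> J1 A" "fst (still t x) = x"
    "jet_coords (V, d) (still t x) = jet_map fst (\<lambda>z. \<epsilon> * level V d z) (d x, t)"
proof -
  have b: "fst (d x, t) \<in> d ` V" using V(2) by simp
  have f: "\<epsilon> * height t y = \<epsilon> * level V d ((d x, t), d y)" if "y \<in> V" for y
    by (simp add: level_def height_in_def chart_inverse[OF A V(1)] that)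
  have x: "inv_into V d (fst (d x, t)) = x" using V(2) by (simp add: chart_inverse[OF A V(1)])
  note J = jet1_jet_map[where A = A and U = V and c = d and q = fst and \<omega> = "(d x, t)" and
      h = "\<lambda>z. \<epsilon> * level V d z" and f = "\<lambda>y. \<epsilon> * height t y",
      OF A V(1) smooth_on_level[OF V(1)] b f, unfolded x]
  show "still t x \<in> J1 A" "jet_coords (V, d) (still t x) = jet_map fst (\<lambda>z. \<epsilon> * level V d z) (d x, t)"
    unfolding still_def by (rule J; assumption)+
  show "fst (still t x) = x" by (simp add: still_def)
qed

lemma speed_bound: "24 * D < speed * (M / 20)" "0 \<le> D" "0 < speed"
proof -
  show "24 * D < speed * (M / 20)" by (rule turns)
  show "0 \<le> D" using D(1)[of 0] by linarith
  then have "0 < speed * (M / 20)" using turns by linarith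
  then show "0 < speed" using Y(1) by (simp add: zero_less_mult_iff)
qed

lemma positive_at_moved:
  assumes i: "i < m" "x \<in> U i" "t \<in> active i"
  shows "positive_at A loop x t"
proof -
  note i' = charts(1)[OF i(1)]
  let ?e = "c i x" and ?J = "jet_map (base i) (\<lambda>z. \<epsilon> * profile i z)" and ?S = "c i ` U i \<times> active i"
  have e: "?e \<in> c i ` U i" using i(2) by blast
  note b = base_in_chart[OF i(1) e, of t]
  \<comment> \<open>The height and the cutoff in the estimate of the wave are both taken at the foot
    point, so the two rates are compared at \<open>y\<close> and not at \<open>x\<close>.\<close>
  define y where "y = inv_into (U i) (c i) (base i (?e, t))"
  have y: "y \<in> U i" "c i y = base i (?e, t)" unfolding y_def using b by (simp_all add: chart_inverse[OF A i'])
  have yc: "y \<in> carrier_of A" by (rule carrier_ofI[OF i' y(1)])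
  have "(\<Sum>j<m. mu j t * weight j y) = (\<Sum>j\<in>{i}. mu j t * weight j y)"
  proof (rule sum.mono_neutral_right)
    show "\<forall>j\<in>{..<m} - {i}. mu j t * weight j y = 0"
      using active_unique[OF _ i(1) _ i(3)] lam_mu_inactive by (metis DiffE insertI1 lessThan_iff mult_zero_left)
  qed (use i in auto)
  moreover have "mu i t * weight i y \<le> mu i t * \<sigma>2 i (base i (?e, t))"
  proof (rule mult_left_mono)
    show "weight i y \<le> \<sigma>2 i (base i (?e, t))" using weight_bounds[OF yc, of i] y by (simp add: plateau_def)
    show "0 \<le> mu i t" by (simp add: mu_def pulse_bounds)
  qed
  ultimately have s: "(\<Sum>j<m. mu j t * weight j y) \<le> mu i t * \<sigma>2 i (base i (?e, t))" by simp
  let ?s = "mu i t * \<sigma>2 i (base i (?e, t))"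
  have "(speed * (?s / 10 - M / 20) - 24 * D) / N \<le> fderiv (wave i) ((?e, t), base i (?e, t)) ((0, 1), 0)"
    unfolding wave_def base_def
    by (rule zigzag.wave_derivative_time_ge[OF zigzag[OF i(1)]]) (use speed_bound(3) lam_mu_deriv_bound in auto)
  moreover have "fderiv (height_in (U i) (c i)) (t, base i (?e, t)) (1, 0) \<ge> speed / (10 * N) * (M - ?s)"
    unfolding y(2)[symmetric] height_in_derivative[OF i' y(1)] using s N(1) speed_bound(3)
    by (intro mult_left_mono) (auto simp: y(2))
  \<comment> \<open>The gain of the zigzags cancels the lowering of the height, both being
    \<open>speed * ?s / (10 * N)\<close>; from \<open>M / 10 - M / 20\<close> there remains
    \<open>M / 20\<close>.\<close>
  moreover have "speed / (10 * N) * (M - ?s) + (speed * (?s / 10 - M / 20) - 24 * D) / N = (speed * (M / 20) - 24 * D) / N"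
    using N(1) by (simp add: field_simps)
  moreover have "0 < (speed * (M / 20) - 24 * D) / N" using speed_bound(1) N(1) by simp
  ultimately have pos: "0 < fderiv (height_in (U i) (c i)) (t, base i (?e, t)) (1, 0) +
     fderiv (wave i) ((?e, t), base i (?e, t)) ((0, 1), 0)" by linarith
  note C = zigzag_jet.jet_map_conditions[OF zigzag_jet[OF i(1) \<epsilon>] e, of t, folded base_def wave_def,
      unfolded family_eq[OF i(1) \<epsilon>], OF pos]
  have sm: "smooth_on (c i ` U i \<times> UNIV) ?J"
    using zigzag_jet.jet_map_smooth[OF zigzag_jet[OF i(1) \<epsilon>], folded base_def, unfolded family_eq[OF i(1) \<epsilon>]] .
  show ?thesis
    unfolding positive_at_def
  proof (intro exI conjI)
    show "(U i, c i) \<in> A" "x \<in> U i" by (rule i', rule i(2))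
    show "(c i x, t) \<in> ?S" using i by simp
    show "open ?S" using smooth_atlasD(2)[OF A i' i'] open_active by (simp add: open_Times)
    show "?S \<subseteq> c i ` U i \<times> UNIV" by auto
    show "smooth_on ?S ?J" by (rule smooth_on_subset[OF sm]) auto
    show "\<forall>(e, s)\<in>?S. loop s (inv_into (U i) (c i) e) \<in> J1 A \<and> fst (loop s (inv_into (U i) (c i) e)) \<in> U i \<and>
        jet_coords (U i, c i) (loop s (inv_into (U i) (c i) e)) = ?J (e, s)"
    proof clarify
      fix z s assume z: "z \<in> U i" "s \<in> active i"
      show "loop s (inv_into (U i) (c i) (c i z)) \<in> J1 A \<and> fst (loop s (inv_into (U i) (c i) (c i z))) \<in> U i \<and>
        jet_coords (U i, c i) (loop s (inv_into (U i) (c i) (c i z))) = ?J (c i z, s)"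
        unfolding chart_inverse(1)[OF A i' z(1)] loop_moved[OF i(1) z] using jet_coords_moved[OF i(1) z(1)] by simp
    qed
    show "\<forall>v. contact_form (?J (c i x, t)) (fderiv ?J (c i x, t) (v, 0)) = 0"
      using C(1) by blast
  qed (use C(2,3) in auto)
qed

text \<open>For a chart containing \<open>x\<close>, the pulse vanishes at all nearby times; for any
  other chart, nearby points avoid the closed set carrying its cutoff. As there are finitely many
  charts, the loop is \<open>still\<close> around \<open>(x, t)\<close>. All terms
  \<open>mu i t * weight i x\<close> are 0, so the front rises at the full rate of the lift.\<close>

lemma positive_at_still:
  assumes x: "x \<in> carrier_of A" and off: "\<And>i. i < m \<Longrightarrow> x \<in> U i \<Longrightarrow> t \<notin> active i"
  shows "positive_at A loop x t"
proof -
  obtain V d where V: "(V, d) \<in> A" "x \<in> V" using carrier_ofE[OF x] .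
  have "\<exists>T. open T \<and> t \<in> T \<and> (x \<in> U i \<longrightarrow> (\<forall>s\<in>T. lam i s = 0))" if i: "i < m" for i
  proof (cases "x \<in> U i")
    case True
    show ?thesis by (rule lam_eq_0_near[OF off[OF i True]]) blast
  qed auto
  then obtain T where T: "\<And>i. i < m \<Longrightarrow> open (T i) \<and> t \<in> T i \<and> (x \<in> U i \<longrightarrow> (\<forall>s\<in>T i. lam i s = 0))" by metis
  define T0 where "T0 = (\<Inter>i<m. T i)"
  have T0: "open T0" "t \<in> T0" using T unfolding T0_def by auto
  define K where "K i = inv_into (U i) (c i) ` cball (y0 i) (3 * r i)" for i
  define W where "W i = (if x \<in> U i then carrier_of A else carrier_of A - K i)" for i
  have W: "openin (atlas_topology A) (W i)" "x \<in> W i" if "i < m" for i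
  proof -
    have "closedin (atlas_topology A) (K i)"
      unfolding K_def by (rule closedin_chart_image_compact[OF A charts(1)[OF that] Hausdorff compact_cball charts(3)[OF that]])
    then show "openin (atlas_topology A) (W i)"
      unfolding W_def topspace_atlas_topology[symmetric] by (auto simp: openin_diff)
    have "K i \<subseteq> U i" using charts(3)[OF that] chart_inverse(2)[OF A charts(1)[OF that]] unfolding K_def by blast
    then show "x \<in> W i" using x unfolding W_def by auto
  qed
  define W0 where "W0 = V \<inter> \<Inter>(W ` {..<m})"
  have W0: "openin (atlas_topology A) W0"
  proof (cases "m = 0")
    case False
    then have "openin (atlas_topology A) (\<Inter>(W ` {..<m}))" using W(1) by (intro openin_Inter) auto
    then show ?thesis unfolding W0_def using openin_atlas_topology_domain[OF V(1)] by (rule openin_Int[rotated])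
  next
    case True
    then show ?thesis unfolding W0_def using openin_atlas_topology_domain[OF V(1)] by simp
  qed
  have loop0: "loop s z = still s z" if "z \<in> W0" "s \<in> T0" for z s
  proof (rule loop_still)
    fix i assume i: "i < m" "z \<in> U i"
    show "lam i s = 0 \<or> c i z \<notin> cball (y0 i) (3 * r i)"
    proof (cases "x \<in> U i")
      case True
      then show ?thesis using T[OF i(1)] that i(1) unfolding T0_def by auto
    next
      case False
      then have "z \<notin> K i" using that(1) i(1) unfolding W0_def W_def by auto
      then have "c i z \<notin> cball (y0 i) (3 * r i)"
        using chart_inverse(1)[OF A charts(1)[OF i(1)] i(2)] unfolding K_def by (metis image_eqI)
      then show ?thesis by blast
    qed
  qed
  let ?O = "d ` (V \<inter> W0)" and ?J = "jet_map fst (\<lambda>z. \<epsilon> * level V d z)"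
  have op: "open ?O" by (rule open_chart_image[OF A V(1) W0])
  have dx: "d x \<in> d ` V" using V by blast
  note S = jet_map_still(2-5)[OF smooth_atlasD(2)[OF A V(1) V(1)] height_in_smooth[OF V(1)], folded level_def]
  have "mu i t * weight i x = 0" if "i < m" for i
  proof (cases "x \<in> U i")
    case True
    then have "mu i t = 0" using off[OF that] lam_mu_inactive by blast
    then show ?thesis by simp
  next
    case False
    then show ?thesis by (simp add: weight_def plateau_def)
  qed
  then have "(\<Sum>i<m. mu i t * weight i x) = 0" by (intro sum.neutral) simp
  then have hd: "fderiv (height_in V d) (t, d x) (1, 0) = speed / (10 * N) * M"
    using height_in_derivative[OF V, of t] by simp
  show ?thesis
    unfolding positive_at_def
  proof (intro exI conjI)
    show "(V, d) \<in> A" "x \<in> V" by (rule V)+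
    show "(d x, t) \<in> ?O \<times> T0" using V W(2) T0 by (auto simp: W0_def)
    show "open (?O \<times> T0)" using op T0 by (simp add: open_Times)
    show "?O \<times> T0 \<subseteq> d ` V \<times> UNIV" by auto
    show "smooth_on (?O \<times> T0) ?J" by (rule smooth_on_subset[OF S(1)]) auto
    show "\<forall>(e, s)\<in>?O \<times> T0. loop s (inv_into V d e) \<in> J1 A \<and> fst (loop s (inv_into V d e)) \<in> V \<and>
        jet_coords (V, d) (loop s (inv_into V d e)) = ?J (e, s)"
    proof clarify
      fix z s assume z: "z \<in> V" "z \<in> W0" "s \<in> T0"
      show "loop s (inv_into V d (d z)) \<in> J1 A \<and> fst (loop s (inv_into V d (d z))) \<in> V \<and>
        jet_coords (V, d) (loop s (inv_into V d (d z))) = ?J (d z, s)"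
        unfolding chart_inverse(1)[OF A V(1) z(1)] loop0[OF z(2,3)] using jet_coords_still[OF V(1) z(1)] z(1) by simp
    qed
    show "\<forall>v. contact_form (?J (d x, t)) (fderiv ?J (d x, t) (v, 0)) = 0"
      using S(2)[OF dx] by blast
    show "contact_form (?J (d x, t)) (fderiv ?J (d x, t) (0, 1)) \<noteq> 0"
    proof -
      have "0 < \<epsilon> * (speed / (10 * N) * M)"
        by (intro mult_pos_pos divide_pos_pos \<epsilon> speed_bound(3) N(1) Y(1)) simp
      then show ?thesis unfolding S(3)[OF dx] hd by linarith
    qed
    show "inj (\<lambda>v. fderiv ?J (d x, t) (v, 0))" by (rule S(4)[OF dx])
  qed
qed

lemma loop_periodic: "loop (t + 1) x = loop t x"
proof -
  have h: "height (t + 1) y = height t y" for y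
    using Y(3)[of "t - slot m _"] unfolding height_def by (simp add: algebra_simps)
  have b: "base i (e, t + 1) = base i (e, t)" "wave i ((e, t + 1), w) = wave i ((e, t), w)" if "i < m" for i e w
    unfolding base_def wave_def
    by (rule zigzag.base_wave_periodic[OF zigzag[OF that] lam_mu_periodic refl])+
  have m: "moved i (t + 1) x = moved i t x" if "i < m" for i unfolding moved_def by (simp add: h b[OF that])
  show ?thesis
  proof (cases "\<exists>i<m. lam i t \<noteq> 0 \<and> x \<in> U i")
    case True
    then obtain i where i: "i < m" "lam i t \<noteq> 0" "x \<in> U i" by blast
    have "(THE i. i < m \<and> lam i t \<noteq> 0) = i"
      by (rule the_equality) (use i active_unique lam_mu_inactive(1) in blast)+
    then show ?thesis using True m[OF i(1)] by (simp add: loop_def lam_mu_periodic)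
  next
    case False
    then have "\<not> (\<exists>i<m. lam i (t + 1) \<noteq> 0 \<and> x \<in> U i)" by (simp add: lam_mu_periodic)
    then have "loop (t + 1) x = still (t + 1) x" unfolding loop_def by (rule if_not_P)
    moreover have "loop t x = still t x" using False unfolding loop_def by (rule if_not_P)
    ultimately show ?thesis by (simp add: still_def h)
  qed
qed

lemma legendrian_positive_loop: "legendrian_loop A loop" "positive_loop A loop"
proof -
  have "positive_at A loop x t" if "x \<in> carrier_of A" for x t
    using positive_at_moved positive_at_still[OF that] by blast
  from positive_legendrian_loopI[OF A this loop_periodic] show "legendrian_loop A loop" "positive_loop A loop" by blast+
qed

lemma loop_starts: "starts_from_zero_section A loop"
proof -
  have "loop 0 x = zero_section A x" for x
  proof -
    \<comment> \<open>The constants \<open>Y (- slot m i)\<close> in \<open>height\<close> serve to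
      make it vanish at time 0.\<close>
    have "height 0 y = 0" for y by (simp add: height_def)
    moreover have "loop 0 x = still 0 x"
      by (rule loop_still) (use lam_mu_inactive(1) zero_not_active in blast)
    ultimately show ?thesis by (simp add: still_def zero_section_def)
  qed
  then show ?thesis unfolding starts_from_zero_section_def by blast
qed

end

section \<open>Closeness to the stationary loop\<close>

lemma jet_coords_zero_section:
  fixes A :: "('a, real^'n) atlas"
  assumes A: "smooth_atlas A" "(U, c) \<in> A" and x: "x \<in> U"
  shows "zero_section A x \<in> J1 A" "jet_coords (U, c) (zero_section A x) = (c x, 0, 0)"
proof -
  have n: "smooth_near A x (\<lambda>_. 0)" by (rule smooth_nearI[OF A open_UNIV smooth_on_const x]) auto
  show "zero_section A x \<in> J1 A" unfolding zero_section_def J1_def using n carrier_ofI[OF A(2) x] by blast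
  have "fderiv ((\<lambda>_. 0 :: real) \<circ> inv_into U c) (c x) = (\<lambda>_. 0)"
    by (simp add: o_def frechet_derivative_const)
  then show "jet_coords (U, c) (zero_section A x) = (c x, 0, 0)"
    unfolding zero_section_def jet_coords_jet1[OF A(2) x n] by (simp add: vec_eq_iff)
qed

text \<open>A tube lemma: over the compact set \<open>K \<times> {0..1}\<close>, the coordinates of
  the zero section form a compact set inside the open preimage of \<open>W\<close>, which therefore
  contains a neighbourhood of uniform radius.\<close>

lemma stationary_nbhd_in_chart:
  fixes A :: "('a, real^'n) atlas"
  assumes A: "smooth_atlas A" "(U, c) \<in> A" and W: "stationary_nbhd A W" and K: "compact K" "K \<subseteq> c ` U"
  obtains \<rho> where "0 < \<rho>" "\<And>e t w. e \<in> K \<Longrightarrow> t \<in> {0..1} \<Longrightarrow> fst w \<in> c ` U \<Longrightarrow> dist w (e, 0, 0) < \<rho> \<Longrightarrow>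
    ((inv_into U c e, t), inv_into (jets_over A U) (jet_coords (U, c)) w) \<in> W"
proof -
  let ?inv = "inv_into (jets_over A U) (jet_coords (U, c))"
  let ?L = "prod_topology (atlas_topology A) (top_of_set {0..1::real})"
  define X :: "((real^'n) \<times> real \<times> (real^'n) \<times> (real^'n) \<times> real) set"
    where "X = c ` U \<times> {0..1} \<times> c ` U \<times> UNIV"
  define F :: "_ \<Rightarrow> ('a \<times> real) \<times> 'a jet" where "F z = ((inv_into U c (fst z), fst (snd z)), ?inv (snd (snd z)))" for z
  have im: "jet_coords (U, c) ` jets_over A U = c ` U \<times> UNIV" by (rule jet_coords_image[OF A order_refl])
  have "continuous_map (top_of_set X) (top_of_set (c ` U)) fst"
    unfolding continuous_map_subtopology_eu by (auto simp: X_def intro!: continuous_intros)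
  from continuous_map_compose[OF this continuous_map_chart_inverse[OF A]]
  have 1: "continuous_map (top_of_set X) (atlas_topology A) (\<lambda>z. inv_into U c (fst z))" by (simp add: o_def)
  have 2: "continuous_map (top_of_set X) (top_of_set {0..1}) (\<lambda>z. fst (snd z))"
    unfolding continuous_map_subtopology_eu by (auto simp: X_def intro!: continuous_intros)
  have "continuous_map (top_of_set X) (top_of_set (c ` U \<times> UNIV)) (\<lambda>z. snd (snd z))"
    unfolding continuous_map_subtopology_eu by (auto simp: X_def intro!: continuous_intros)
  from continuous_map_compose[OF this continuous_map_chart_inverse[OF smooth_atlas_jet_atlas[OF A(1)] jet_atlasI[OF A(2)], unfolded im]]
  have 3: "continuous_map (top_of_set X) (atlas_topology (jet_atlas A)) (\<lambda>z. ?inv (snd (snd z)))" by (simp add: o_def)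
  have "continuous_map (top_of_set X) (prod_topology ?L (atlas_topology (jet_atlas A))) F"
    unfolding F_def by (intro continuous_map_pairedI 1 2 3)
  moreover have "openin (prod_topology ?L (atlas_topology (jet_atlas A))) W" using W by (simp add: stationary_nbhd_def)
  ultimately have "openin (top_of_set X) {z \<in> topspace (top_of_set X). F z \<in> W}"
    by (rule openin_continuous_map_preimage)
  then obtain G where G: "open G" "{z \<in> X. F z \<in> W} = X \<inter> G" by (auto simp: openin_open)
  define C where "C = (\<lambda>(e, t). (e, t, e, 0 :: real^'n, 0 :: real)) ` (K \<times> {0..1::real})"
  have "compact C" unfolding C_def case_prod_beta'
    by (intro compact_continuous_image continuous_intros compact_Times K compact_Icc)
  moreover have "C \<subseteq> G"
  proof
    fix z assume "z \<in> C"
    then obtain e t where z: "e \<in> K" "t \<in> {0..1}" "z = (e, t, e, 0, 0)" unfolding C_def by auto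
    then obtain x where x: "x \<in> U" "e = c x" using K by auto
    note zs = jet_coords_zero_section[OF A x(1)]
    have "?inv (c x, 0, 0) = zero_section A x"
      using jet_coords_inverse[OF A zs(1)] x(1) unfolding zs(2) by (simp add: zero_section_def)
    then have "F z = ((x, t), zero_section A x)" unfolding F_def z(3) x(2) using chart_inverse(1)[OF A x(1)] by simp
    moreover have "((x, t), zero_section A x) \<in> W"
      using W carrier_ofI[OF A(2) x(1)] z(2) unfolding stationary_nbhd_def loop_graph_def by blast
    moreover have "z \<in> X" using z x by (auto simp: X_def)
    ultimately have "z \<in> {z \<in> X. F z \<in> W}" by (simp only: mem_Collect_eq simp_thms)
    then show "z \<in> G" unfolding G(2) by (rule IntD2)
  qed
  ultimately obtain \<rho> where \<rho>: "0 < \<rho>" "(\<Union>x\<in>C. ball x \<rho>) \<subseteq> G"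
    using compact_subset_open_imp_ball_epsilon_subset[OF _ G(1)] by metis
  have main: "((inv_into U c e, t), ?inv w) \<in> W"
    if e: "e \<in> K" "t \<in> {0..1}" "fst w \<in> c ` U" "dist w (e, 0, 0) < \<rho>" for e t w
  proof -
    have C: "(e, t, e, 0, 0) \<in> C" unfolding C_def using e by force
    have "(e, t, w) \<in> ball (e, t, e, 0, 0) \<rho>"
      using e(4) unfolding mem_ball dist_Pair_Pair[of e] dist_Pair_Pair[of t] by (simp add: dist_commute)
    with C have "(e, t, w) \<in> (\<Union>x\<in>C. ball x \<rho>)" by (rule UN_I)
    from subsetD[OF \<rho>(2) this] have "(e, t, w) \<in> G" .
    moreover have "(e, t, w) \<in> X" using e K(2) by (cases w) (auto simp: X_def)
    ultimately have "(e, t, w) \<in> {z \<in> X. F z \<in> W}" unfolding G(2) by (rule IntI[rotated])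
    then show ?thesis by (simp add: F_def)
  qed
  show ?thesis by (rule that[OF \<rho>(1) main])
qed

context zigzag_loop
begin

text \<open>These are the fibre coordinates before scaling, so the bound does not depend on
  \<epsilon>.\<close>

lemma jet_maps_bounded:
  obtains C where "0 \<le> C" "\<And>i e t. i < m \<Longrightarrow> e \<in> cball (y0 i) (3 * r i) \<Longrightarrow> t \<in> {0..1} \<Longrightarrow>
    norm (snd (jet_map (base i) (profile i) (e, t))) \<le> C \<and> norm (snd (jet_map fst (level (U i) (c i)) (e, t))) \<le> C"
proof -
  have "\<exists>C. \<forall>e\<in>cball (y0 i) (3 * r i). \<forall>t\<in>{0..1}.
      norm (snd (jet_map (base i) (profile i) (e, t))) \<le> C \<and> norm (snd (jet_map fst (level (U i) (c i)) (e, t))) \<le> C"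
    if i: "i < m" for i
  proof -
    note i' = charts(1)[OF i]
    have b: "\<exists>C. \<forall>z\<in>cball (y0 i) (3 * r i) \<times> {0..1}. norm (snd (J z)) \<le> C"
      if J: "smooth_on (c i ` U i \<times> UNIV) J" for J :: "(real^'n) \<times> real \<Rightarrow> (real^'n) \<times> (real^'n) \<times> real"
    proof -
      have "continuous_on (cball (y0 i) (3 * r i) \<times> {0..1}) (\<lambda>z. snd (J z))"
        by (intro continuous_on_snd continuous_on_subset[OF smooth_on_continuous_on[OF J]]) (use charts(3)[OF i] in auto)
      then have "compact ((\<lambda>z. snd (J z)) ` (cball (y0 i) (3 * r i) \<times> {0..1}))"
        by (intro compact_continuous_image compact_Times compact_cball compact_Icc)
      from compact_imp_bounded[OF this] show ?thesis unfolding bounded_iff by blast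
    qed
    have P1: "smooth_on (c i ` U i \<times> UNIV) (jet_map (base i) (profile i))"
      using zigzag_jet.jet_map_smooth[OF zigzag_jet[OF i zero_less_one], folded base_def, unfolded family_eq[OF i zero_less_one]]
      by (simp only: mult_1_left)
    have P2: "smooth_on (c i ` U i \<times> UNIV) (jet_map fst (level (U i) (c i)))"
      using jet_map_still(2)[OF smooth_atlasD(2)[OF A i' i'] height_in_smooth[OF i'], of 1, folded level_def]
      by (simp only: mult_1_left)
    obtain C1 where C1: "\<forall>z\<in>cball (y0 i) (3 * r i) \<times> {0..1}. norm (snd (jet_map (base i) (profile i) z)) \<le> C1"
      using b[OF P1] by blast
    obtain C2 where C2: "\<forall>z\<in>cball (y0 i) (3 * r i) \<times> {0..1}. norm (snd (jet_map fst (level (U i) (c i)) z)) \<le> C2"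
      using b[OF P2] by blast
    show ?thesis by (rule exI[of _ "max C1 C2"]) (use C1 C2 in \<open>auto simp: le_max_iff_disj\<close>)
  qed
  then obtain C where C: "\<And>i. i < m \<Longrightarrow> \<forall>e\<in>cball (y0 i) (3 * r i). \<forall>t\<in>{0..1}.
      norm (snd (jet_map (base i) (profile i) (e, t))) \<le> C i \<and> norm (snd (jet_map fst (level (U i) (c i)) (e, t))) \<le> C i"
    by metis
  have le: "C i \<le> (\<Sum>i<m. \<bar>C i\<bar>)" if "i < m" for i
    using member_le_sum[of i "{..<m}" "\<lambda>i. \<bar>C i\<bar>"] that by simp
  show ?thesis
  proof (rule that[of "\<Sum>i<m. \<bar>C i\<bar>"])
    fix i e t assume "i < m" "e \<in> cball (y0 i) (3 * r i)" "t \<in> {0..1 :: real}"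
    then have "norm (snd (jet_map (base i) (profile i) (e, t))) \<le> C i \<and> norm (snd (jet_map fst (level (U i) (c i)) (e, t))) \<le> C i"
      using C by blast
    with le[OF \<open>i < m\<close>] show "norm (snd (jet_map (base i) (profile i) (e, t))) \<le> (\<Sum>i<m. \<bar>C i\<bar>) \<and>
        norm (snd (jet_map fst (level (U i) (c i)) (e, t))) \<le> (\<Sum>i<m. \<bar>C i\<bar>)" by linarith
  qed (simp add: sum_nonneg)
qed

text \<open>The foot point is displaced by at most \<open>4 / N\<close>, which is less than
  \<open>\<rho> / 2\<close>, and the fibre coordinates are at most \<open>\<epsilon> * C\<close>.
  Where zigzags may be present their own chart is used; elsewhere the jet is \<open>still\<close>
  and any ball of the cover containing the point will do.\<close>

lemma loop_graph_subset:
  assumes W: "\<And>i e t w. i < m \<Longrightarrow> e \<in> cball (y0 i) (3 * r i) \<Longrightarrow> t \<in> {0..1} \<Longrightarrow> fst w \<in> c i ` U i \<Longrightarrow>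
      dist w (e, 0, 0) < \<rho> \<Longrightarrow> ((inv_into (U i) (c i) e, t), inv_into (jets_over A (U i)) (jet_coords (U i, c i)) w) \<in> W"
    and C: "\<And>i e t. i < m \<Longrightarrow> e \<in> cball (y0 i) (3 * r i) \<Longrightarrow> t \<in> {0..1} \<Longrightarrow>
      norm (snd (jet_map (base i) (profile i) (e, t))) \<le> C \<and> norm (snd (jet_map fst (level (U i) (c i)) (e, t))) \<le> C"
    and small: "8 / N < \<rho>" "\<epsilon> * C < \<rho> / 2"
  shows "loop_graph A loop \<subseteq> W"
proof -
  have close: "((x, t), j) \<in> W"
    if i: "i < m" "x \<in> U i" "c i x \<in> cball (y0 i) (3 * r i)" "t \<in> {0..1}"
      and j: "j \<in> J1 A" "fst j \<in> U i" "jet_coords (U i, c i) j = (q, \<epsilon> *\<^sub>R s)"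
      and q: "norm (q - c i x) \<le> 4 / N" and s: "norm s \<le> C" for i x t j q s
  proof -
    note i' = charts(1)[OF i(1)]
    have "dist (q, \<epsilon> *\<^sub>R s) (c i x, 0) \<le> dist q (c i x) + norm (\<epsilon> *\<^sub>R s)"
      using norm_Pair_le[of "q - c i x" "\<epsilon> *\<^sub>R s"] by (simp add: dist_norm)
    also have "norm (\<epsilon> *\<^sub>R s) \<le> \<epsilon> * C" using \<epsilon> s by simp
    also have "dist q (c i x) + \<epsilon> * C < \<rho>" using q small by (simp add: dist_norm)
    finally have d: "dist (q, \<epsilon> *\<^sub>R s) (c i x, 0, 0) < \<rho>" by (simp add: zero_prod_def)
    have "jet_coords (U i, c i) j \<in> c i ` U i \<times> UNIV"
      using jet_coords_image[OF A i' order_refl] j(1,2) by blast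
    then have "fst (q, \<epsilon> *\<^sub>R s) \<in> c i ` U i" unfolding j(3) by auto
    from W[OF i(1,3,4) this d] show ?thesis
      unfolding j(3)[symmetric] jet_coords_inverse[OF A i' j(1,2)] chart_inverse(1)[OF A i' i(2)] .
  qed
  have "((x, t), loop t x) \<in> W" if x: "x \<in> carrier_of A" and t: "t \<in> {0..1}" for x t
  proof (cases "\<exists>i<m. x \<in> U i \<and> t \<in> active i \<and> c i x \<in> cball (y0 i) (3 * r i)")
    case True
    then obtain i where i: "i < m" "x \<in> U i" "t \<in> active i" "c i x \<in> cball (y0 i) (3 * r i)" by blast
    have b: "base i (c i x, t) \<in> c i ` U i" using base_in_chart[OF i(1)] i(2) by blast
    have sm: "smooth_on (UNIV \<times> c i ` U i) (profile i)"
      using smooth_on_profile[OF zero_less_one i(1)] by (simp only: mult_1_left)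
    have "((c i x, t), base i (c i x, t)) \<in> UNIV \<times> c i ` U i" using b by simp
    from jet_map_scale[where F = "profile i" and q = "base i" and \<omega> = "(c i x, t)", OF sm this, of \<epsilon>]
    have J: "jet_coords (U i, c i) (moved i t x) = (base i (c i x, t), \<epsilon> *\<^sub>R snd (jet_map (base i) (profile i) (c i x, t)))"
      unfolding jet_coords_moved(3)[OF i(1,2)] by simp
    have n: "norm (base i (c i x, t) - c i x) \<le> 4 / N"
      unfolding base_def using zigzag.norm_base_diff_le[OF zigzag[OF i(1)], where \<omega> = "(c i x, t)" and sp = speed] by simp
    show ?thesis
      unfolding loop_moved[OF i(1-3)]
      by (rule close[OF i(1,2,4) t jet_coords_moved(1,2)[OF i(1,2)] J n]) (use C[OF i(1,4) t] in blast)
  next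
    case False
    have l: "loop t x = still t x" by (rule loop_still) (use False lam_mu_inactive(1) in blast)
    obtain i where i: "i < m" "x \<in> U i" "dist (y0 i) (c i x) < r i" using charts(4)[OF x] by blast
    note i' = charts(1)[OF i(1)]
    have cb: "c i x \<in> cball (y0 i) (3 * r i)" using i(3) charts(2)[OF i(1)] by simp
    have sm: "smooth_on (UNIV \<times> c i ` U i) (level (U i) (c i))"
      using smooth_on_level[OF i', of 1] by (simp only: mult_1_left)
    have "((c i x, t), fst (c i x, t)) \<in> UNIV \<times> c i ` U i" using i(2) by simp
    from jet_map_scale[where F = "level (U i) (c i)" and q = fst and \<omega> = "(c i x, t)", OF sm this, of \<epsilon>]
    have J: "jet_coords (U i, c i) (still t x) = (c i x, \<epsilon> *\<^sub>R snd (jet_map fst (level (U i) (c i)) (c i x, t)))"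
      unfolding jet_coords_still(3)[OF i' i(2)] by simp
    have n: "norm (c i x - c i x) \<le> 4 / N" using N(1) by simp
    show ?thesis
      unfolding l
      by (rule close[OF i(1,2) cb t jet_coords_still(1)[OF i' i(2)] _ J n])
        (use C[OF i(1) cb t] jet_coords_still(2)[OF i' i(2)] i(2) in auto)
  qed
  then show ?thesis unfolding loop_graph_def by blast
qed

end

lemma positive_loop_near_stationary:
  fixes A :: "('a, real^'n) atlas"
  assumes A: "closed_manifold A" and W: "stationary_nbhd A W"
  obtains \<phi> where "legendrian_loop A \<phi>" "starts_from_zero_section A \<phi>" "positive_loop A \<phi>" "loop_graph A \<phi> \<subseteq> W"
proof -
  have sA: "smooth_atlas A" and H: "Hausdorff_space (atlas_topology A)" using A by (simp_all add: closed_manifold_def)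
  from finite_chart_cover[OF A] obtain m :: nat and U c y0 r where
    "\<forall>i<m. (U i, c i) \<in> A \<and> 0 < r i \<and> cball (y0 i) (3 * r i) \<subseteq> c i ` U i"
    "\<forall>x\<in>carrier_of A. \<exists>i<m. x \<in> U i \<and> dist (y0 i) (c i x) < r i"
    by (elim exE conjE)
  then have ch: "\<And>i. i < m \<Longrightarrow> (U i, c i) \<in> A" "\<And>i. i < m \<Longrightarrow> 0 < r i"
    "\<And>i. i < m \<Longrightarrow> cball (y0 i) (3 * r i) \<subseteq> c i ` U i"
    "\<And>x. x \<in> carrier_of A \<Longrightarrow> \<exists>i<m. x \<in> U i \<and> dist (y0 i) (c i x) < r i"
    by simp_all
  obtain \<kappa> where \<kappa>: "0 < \<kappa>" "\<And>i. i < m \<Longrightarrow> \<kappa> \<le> \<bar>sin (pi * (0 - slot m i))\<bar>"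
      "\<And>i j t. i < m \<Longrightarrow> j < m \<Longrightarrow> \<bar>sin (pi * (t - slot m i))\<bar> < \<kappa> \<Longrightarrow> \<bar>sin (pi * (t - slot m j))\<bar> < \<kappa> \<Longrightarrow> i = j"
    by (rule time_slots[of m]) (rule that; blast)
  have "0 < pulse \<kappa> 2 0" by (simp add: pulse_0)
  then obtain Y M where Y: "0 < M" "smooth_on UNIV Y" "\<And>t. Y (t + 1) = Y t"
      "\<And>t. (Y has_real_derivative (pulse \<kappa> 2 t - M)) (at t)"
    by (rule periodic_primitive[OF smooth_on_pulse pulse_periodic pulse_bounds(1)]) (rule that; blast)
  have "\<exists>D. \<forall>t. \<bar>deriv (pulse \<kappa> a) t\<bar> \<le> D" for a
    by (rule periodic_bounded[of "deriv (pulse \<kappa> a)", OF periodic_deriv[OF smooth_on_pulse pulse_periodic]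
        smooth_on_continuous_on[OF smooth_on_deriv(2)[OF smooth_on_pulse]]]) blast
  then obtain D' where D': "\<And>a t. \<bar>deriv (pulse \<kappa> a) t\<bar> \<le> D' a" by metis
  define D where "D = max (D' 3) (D' 2)"
  have D: "\<bar>deriv (pulse \<kappa> 3) t\<bar> \<le> D" "\<bar>deriv (pulse \<kappa> 2) t\<bar> \<le> D" for t
    using D'[of 3 t] D'[of 2 t] by (simp_all add: D_def le_max_iff_disj)
  have "0 < 2 * pi * (M / 20)" using Y(1) by simp
  then obtain turns where "24 * D < real turns * (2 * pi * (M / 20))" using reals_Archimedean3 by blast
  then have turns: "24 * D < 2 * pi * real turns * (M / 20)" by (simp add: mult_ac)
  \<comment> \<open>Any coordinate direction will do; there is one because types are
    nonempty.\<close>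
  fix k :: 'n
  define close where "close i \<rho> \<longleftrightarrow> (\<forall>e t w. e \<in> cball (y0 i) (3 * r i) \<longrightarrow> t \<in> {0..1} \<longrightarrow> fst w \<in> c i ` U i \<longrightarrow>
      dist w (e, 0, 0) < \<rho> \<longrightarrow>
      ((inv_into (U i) (c i) e, t), inv_into (jets_over A (U i)) (jet_coords (U i, c i)) w) \<in> W)" for i \<rho>
  have "\<exists>\<rho>. 0 < \<rho> \<and> close i \<rho>" if "i < m" for i
    unfolding close_def
    by (rule stationary_nbhd_in_chart[OF sA ch(1)[OF that] W compact_cball ch(3)[OF that]]) blast
  then obtain \<rho>' where \<rho>': "\<And>i. i < m \<Longrightarrow> 0 < \<rho>' i \<and> close i (\<rho>' i)" by metis
  define \<rho> where "\<rho> = Min (insert 1 (\<rho>' ` {..<m}))"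
  have \<rho>: "0 < \<rho>" "\<And>i. i < m \<Longrightarrow> \<rho> \<le> \<rho>' i" unfolding \<rho>_def using \<rho>' by auto
  have W': "((inv_into (U i) (c i) e, t), inv_into (jets_over A (U i)) (jet_coords (U i, c i)) w) \<in> W"
    if "i < m" "e \<in> cball (y0 i) (3 * r i)" "t \<in> {0..1}" "fst w \<in> c i ` U i" "dist w (e, 0, 0) < \<rho>" for i e t w
  proof -
    have "dist w (e, 0, 0) < \<rho>' i" using \<rho>(2)[OF that(1)] that(5) by linarith
    then show ?thesis using \<rho>'[OF that(1)] that(2-4) unfolding close_def by blast
  qed
  have "\<exists>C. \<forall>w. \<bar>fderiv (bump (y0 i) (r i) 5) w (axis k 1)\<bar> \<le> C" if "i < m" for i
    by (rule bump_derivative_bounded[OF ch(2)[OF that]]) blast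
  then obtain B where B: "\<And>i w. i < m \<Longrightarrow> \<bar>fderiv (bump (y0 i) (r i) 5) w (axis k 1)\<bar> \<le> B i" by metis
  \<comment> \<open>The sum dominates the gradients of all cutoffs; the term
    \<open>9 / \<rho>\<close> gives \<open>8 / N < \<rho>\<close>.\<close>
  define N where "N = 8 * (\<Sum>i<m. \<bar>B i\<bar>) + 9 / \<rho>"
  have S: "0 \<le> (\<Sum>i<m. \<bar>B i\<bar>)" by (rule sum_nonneg) simp
  have N_pos: "0 < N" and N_large: "8 / N < \<rho>"
  proof -
    show N0: "0 < N" unfolding N_def using S \<rho>(1) by (intro add_nonneg_pos) simp_all
    have "9 / \<rho> \<le> N" using S by (simp add: N_def)
    then have "9 \<le> N * \<rho>" using \<rho>(1) by (simp add: field_simps)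
    then show "8 / N < \<rho>" using N0 by (simp add: field_simps)
  qed
  have NB: "8 * \<bar>fderiv (bump (y0 i) (r i) 5) w (axis k 1)\<bar> \<le> N" if "i < m" for i w
  proof -
    have "B i \<le> (\<Sum>i<m. \<bar>B i\<bar>)" using member_le_sum[of i "{..<m}" "\<lambda>i. \<bar>B i\<bar>"] that by simp
    moreover have "0 < 9 / \<rho>" using \<rho>(1) by simp
    ultimately show ?thesis using B[OF that, of w] unfolding N_def by linarith
  qed
  have loc: "zigzag_loop A m U c y0 r \<kappa> Y M D turns N \<epsilon> k" if "0 < \<epsilon>" for \<epsilon>
    by unfold_locales (fact sA H ch \<kappa> Y D turns N_pos NB that)+
  \<comment> \<open>The locale is used with scale 1 here. The maps \<open>base\<close>,
    \<open>profile\<close> and \<open>level\<close> do not contain the scale, so \<open>C\<close>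
    stays valid for the \<epsilon> chosen from it.\<close>
  obtain C where C: "0 \<le> C" "\<And>i e t. i < m \<Longrightarrow> e \<in> cball (y0 i) (3 * r i) \<Longrightarrow> t \<in> {0..1} \<Longrightarrow>
    norm (snd (jet_map (zigzag_loop.base m y0 r \<kappa> turns N k i) (zigzag_loop.profile m U c y0 r \<kappa> Y M turns N k i) (e, t))) \<le> C \<and>
    norm (snd (jet_map fst (zigzag_loop.level m U c y0 r Y turns N (U i) (c i)) (e, t))) \<le> C"
    by (rule zigzag_loop.jet_maps_bounded[OF loc[OF zero_less_one]]) (rule that; blast)
  define \<epsilon> where "\<epsilon> = \<rho> / (2 * (C + 1))"
  have \<epsilon>_pos: "0 < \<epsilon>" and \<epsilon>_small: "\<epsilon> * C < \<rho> / 2" using \<rho>(1) C(1) by (simp_all add: \<epsilon>_def field_simps)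
  interpret zigzag_loop A m U c y0 r \<kappa> Y M D turns N \<epsilon> k by (rule loc[OF \<epsilon>_pos])
  show ?thesis
    by (rule that[OF legendrian_positive_loop(1) loop_starts legendrian_positive_loop(2)
          loop_graph_subset[OF W' C(2) N_large \<epsilon>_small]])
qed

theorem theorem1p1:
  fixes A :: "('a, real^'n) atlas"
  assumes "closed_manifold A"
  shows "(\<exists>\<phi>. legendrian_loop A \<phi> \<and> starts_from_zero_section A \<phi> \<and> positive_loop A \<phi>) \<and>
    (\<forall>W. stationary_nbhd A W \<longrightarrow>
      (\<exists>\<phi>. legendrian_loop A \<phi> \<and> starts_from_zero_section A \<phi> \<and> positive_loop A \<phi> \<and>
        loop_graph A \<phi> \<subseteq> W))"
proof -
  have near: "\<exists>\<phi>. legendrian_loop A \<phi> \<and> starts_from_zero_section A \<phi> \<and> positive_loop A \<phi> \<and> loop_graph A \<phi> \<subseteq> W"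
    if "stationary_nbhd A W" for W
    using positive_loop_near_stationary[OF assms that] by metis
  let ?X = "prod_topology (prod_topology (atlas_topology A) (top_of_set {0..1})) (atlas_topology (jet_atlas A))"
  \<comment> \<open>The first claim is the case in which the neighbourhood is the whole
    space.\<close>
  have "stationary_nbhd A (topspace ?X)"
    unfolding stationary_nbhd_def
  proof
    show "loop_graph A (\<lambda>_. zero_section A) \<subseteq> topspace ?X"
    proof
      fix z assume "z \<in> loop_graph A (\<lambda>_. zero_section A)"
      then obtain x t where z: "z = ((x, t), zero_section A x)" "x \<in> carrier_of A" "t \<in> {0..1}"
        unfolding loop_graph_def by blast
      obtain U c where U: "(U, c) \<in> A" "x \<in> U" using carrier_ofE[OF z(2)] .
      have "smooth_atlas A" using assms by (simp add: closed_manifold_def)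
      note zs = jet_coords_zero_section(1)[OF this U]
      have "zero_section A x \<in> carrier_of (jet_atlas A)"
        by (rule carrier_ofI[OF jet_atlasI[OF U(1)]]) (use zs U(2) in \<open>simp add: zero_section_def\<close>)
      then show "z \<in> topspace ?X" using z by (simp add: topspace_atlas_topology)
    qed
  qed (rule openin_topspace)
  from near[OF this] near show ?thesis by blast
qed

end
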